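(* Let $F$ be a field of characteristic $0$. The ind-variety $\mathcal{R}=\{J_a\circ l_r\mid a\in F,\ r\in F[x]\setminus\{0\}\}$ of injective Rota--Baxter operators of weight zero on $F[x]$ admits an additive structure of generic modality two.
   Context: On $F[x]$: $l_r\colon f\mapsto rf$ is multiplication by $r$; for $a\in F$, $J_a$ is the linear operator with $J_a(x^n)=\frac{x^{n+1}-a^{n+1}}{n+1}$ for $n\ge0$; $\circ$ is composition. A Rota--Baxter operator of weight zero is a linear operator $R$ with $R(f)R(g)=R(R(f)g+fR(g))$ for all $f,g$. Ind-varieties: given an ascending sequence of closed embeddings of algebraic varieties $X_1\hookrightarrow X_2\hookrightarrow\ldots$, the inductive limit $X=\varinjlim X_n$ is called an ind-variety. A morphism $\phi\colon \varinjlim X_n\to\varinjlim Y_n$ is a collection of morphisms $\phi_n\colon X_n\to Y_{n'}$ ($n'$ depending on $n$) with $\phi_{n+1}|_{X_n}=\phi_n$. Two sequences on $X$ are equivalent if the identity map between the limits is an isomorphism of ind-varieties; $X$ is irreducible if all $X_n$ are irreducible up to equivalence. If $U=\varinjlim U_n$ with $U_n\subset X_n$ open for each $n$, then $U$ is an open ind-subvariety of $X$. Products: $X\times Y=\varinjlim X_n\times Y_n$. An ind-group is an ind-variety with a group structure whose multiplication and inverse are ind-morphisms. An action of an ind-group $G$ on $X$ is regular if $G\times X\to X$ is an ind-morphism; actions are understood to be regular. Ind-structure on $\mathcal{R}$: the map $(a,r)\mapsto J_a\circ l_r$ is a bijection $F\times (F[x]\setminus\{0\})\to\mathcal{R}$,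 and $\mathcal{R}$ carries the structure transported from $\varinjlim_d F\times(F[x]_{\le d}\setminus\{0\})\cong\varinjlim_d \mathbb{A}^1\times(\mathbb{A}^{d+1}\setminus\{0\})$, where $F[x]_{\le d}$ is the space of polynomials of degree at most $d$. Generic modality: an action of an ind-group $G$ on an irreducible ind-variety $X$ is of generic modality $k$ if there exist a non-empty open ind-subvariety $U\subset X$ and a morphism $\pi\colon U\to Z$, where $Z$ is an algebraic variety of dimension $k$, such that the fibers of $\pi$ are $G$-orbits. An additive structure of generic modality $k$ on $X$ is an action of an abelian unipotent ind-group $G$ on $X$ of generic modality $k$. Here an ind-group is unipotent if it is an inductive limit of unipotent algebraic groups. *)

theory Defs
  imports
    "HOL-Analysis.Analysis"
    "HOL-Algebra.Group_Action"
    "HOL-Algebra.Algebraic_Closure_Type"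
    "HOL-Computational_Algebra.Polynomial"
    "HOL-Library.Extended_Nat"
    "Jordan_Normal_Form.Matrix"
begin

no_notation var (\<open>X\<index>\<close>)
hide_const (open) UnivPoly.coeff UnivPoly.monom Module.smult Polynomials.degree

text \<open>
  Algebraic varieties over a field \<open>F\<close> of characteristic zero, which need not be algebraically
  closed. As in the language of Weil and Serre, a variety over \<open>F\<close> is given by the set of its
  geometric points (points over the algebraic closure of \<open>F\<close>), by the topology of its subsets that
  are open \<^emph>\<open>over\<close> \<open>F\<close>, and by the sheaf of those functions, with values in the algebraic closure,
  that are regular \<^emph>\<open>over\<close> \<open>F\<close>. Since \<open>F\<close> is perfect, this category is equivalent to
  that of reduced separated schemes of finite type over \<open>F\<close>. The points over \<open>F\<close> itself are the
  geometric points at which all functions regular over \<open>F\<close> take values in \<open>F\<close>.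

  Here \<open>F\<close> is a type \<open>'a\<close>, its algebraic closure is \<open>'a alg_closure\<close>, and the embedding is
  \<open>to_ac\<close>.
\<close>

section \<open>Spaces with functions\<close>

record (overloaded) ('p, 'a :: field) fspace =
  tp :: "'p topology"
  reg :: "'p set \<Rightarrow> ('p \<Rightarrow> 'a alg_closure) set"

abbreviation pts :: "('p, 'a::field) fspace \<Rightarrow> 'p set" where
  "pts X \<equiv> topspace (tp X)"

definition morphism ::
  "('p, 'a::field) fspace \<Rightarrow> ('q, 'a) fspace \<Rightarrow> ('p \<Rightarrow> 'q) \<Rightarrow> bool" where
  "morphism X Y \<phi> \<longleftrightarrow> continuous_map (tp X) (tp Y) \<phi> \<and>
     (\<forall>V f. openin (tp Y) V \<and> f \<in> reg Y V \<longrightarrow> f \<circ> \<phi> \<in> reg X {x \<in> pts X. \<phi> x \<in> V})"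

definition isomorphism ::
  "('p, 'a::field) fspace \<Rightarrow> ('q, 'a) fspace \<Rightarrow> ('p \<Rightarrow> 'q) \<Rightarrow> bool" where
  "isomorphism X Y \<phi> \<longleftrightarrow> morphism X Y \<phi> \<and>
     (\<exists>\<psi>. morphism Y X \<psi> \<and> (\<forall>x\<in>pts X. \<psi> (\<phi> x) = x) \<and> (\<forall>y\<in>pts Y. \<phi> (\<psi> y) = y))"

text \<open>The induced structure on a subset: regular functions are local restrictions of regular ones.
  For closed subsets of varieties this is the reduced closed subvariety.\<close>

definition sub :: "('p, 'a::field) fspace \<Rightarrow> 'p set \<Rightarrow> ('p, 'a) fspace" where
  "sub X S = \<lparr> tp = subtopology (tp X) S,
     reg = (\<lambda>U. {f. \<forall>x\<in>U. \<exists>W g. openin (tp X) W \<and> x \<in> W \<and> g \<in> reg X W \<and>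
                     (\<forall>y\<in>W \<inter> U. f y = g y)}) \<rparr>"

definition closed_embedding ::
  "('p, 'a::field) fspace \<Rightarrow> ('q, 'a) fspace \<Rightarrow> ('p \<Rightarrow> 'q) \<Rightarrow> bool" where
  "closed_embedding X Y \<phi> \<longleftrightarrow> closedin (tp Y) (\<phi> ` pts X) \<and> isomorphism X (sub Y (\<phi> ` pts X)) \<phi>"

text \<open>Transport of structure along a map that is injective on the points.\<close>

definition transport :: "('p \<Rightarrow> 'q) \<Rightarrow> ('p, 'a::field) fspace \<Rightarrow> ('q, 'a) fspace" where
  "transport h X =
     \<lparr> tp = pullback_topology (h ` pts X) (inv_into (pts X) h) (tp X),
       reg = (\<lambda>U. {f. f \<circ> h \<in> reg X {x \<in> pts X. h x \<in> U}}) \<rparr>"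

text \<open>The product of varieties. Its topology is finer than the product topology: basic open sets
  are the non-vanishing loci, in \<open>U \<times> V\<close>, of the functions \<open>\<Sum>i. f i \<otimes> g i\<close>, and regular functions
  are locally quotients of these.\<close>

definition tensor_funs ::
  "('p, 'a::field) fspace \<Rightarrow> ('q, 'a) fspace \<Rightarrow> 'p set \<Rightarrow> 'q set \<Rightarrow> ('p \<times> 'q \<Rightarrow> 'a alg_closure) set"
  where
  "tensor_funs X Y U V = {(\<lambda>(x, y). \<Sum>i<n. f i x * g i y) | f g (n::nat).
     (\<forall>i<n. f i \<in> reg X U \<and> g i \<in> reg Y V)}"

definition prod_space ::
  "('p, 'a::field) fspace \<Rightarrow> ('q, 'a) fspace \<Rightarrow> ('p \<times> 'q, 'a) fspace" where
  "prod_space X Y =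
     \<lparr> tp = topology_generated_by
         {{z \<in> U \<times> V. h z \<noteq> 0} | U V h. openin (tp X) U \<and> openin (tp Y) V \<and> h \<in> tensor_funs X Y U V},
       reg = (\<lambda>W. {f. \<forall>z\<in>W. \<exists>U V p q. openin (tp X) U \<and> openin (tp Y) V \<and> z \<in> U \<times> V \<and>
               p \<in> tensor_funs X Y U V \<and> q \<in> tensor_funs X Y U V \<and> q z \<noteq> 0 \<and>
               (\<forall>y\<in>W \<inter> (U \<times> V). q y \<noteq> 0 \<longrightarrow> f y = p y / q y)}) \<rparr>"

definition rat_pts :: "('p, 'a::field) fspace \<Rightarrow> 'p set" where
  "rat_pts X = {x \<in> pts X. \<forall>W f. openin (tp X) W \<and> x \<in> W \<and> f \<in> reg X W \<longrightarrow> f x \<in> range to_ac}"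

section \<open>Algebraic varieties\<close>

text \<open>Polynomial functions in \<open>n\<close> variables with coefficients in \<open>F\<close>. Points of affine \<open>n\<close>-space
  are the sequences vanishing from index \<open>n\<close> on.\<close>

inductive_set polyfuns :: "nat \<Rightarrow> ((nat \<Rightarrow> 'a::field alg_closure) \<Rightarrow> 'a alg_closure) set"
  for n :: nat where
  const: "(\<lambda>v. to_ac c) \<in> polyfuns n"
| coord: "i < n \<Longrightarrow> (\<lambda>v. v i) \<in> polyfuns n"
| add: "p \<in> polyfuns n \<Longrightarrow> q \<in> polyfuns n \<Longrightarrow> (\<lambda>v. p v + q v) \<in> polyfuns n"
| mult: "p \<in> polyfuns n \<Longrightarrow> q \<in> polyfuns n \<Longrightarrow> (\<lambda>v. p v * q v) \<in> polyfuns n"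

definition affine_pts :: "nat \<Rightarrow> (nat \<Rightarrow> 'a::field alg_closure) set" where
  "affine_pts n = {v. \<forall>i\<ge>n. v i = 0}"

definition affine_space :: "nat \<Rightarrow> (nat \<Rightarrow> 'a::field alg_closure, 'a) fspace" where
  "affine_space n =
     \<lparr> tp = topology_generated_by {{v \<in> affine_pts n. p v \<noteq> 0} | p. p \<in> polyfuns n},
       reg = (\<lambda>U. {f. \<forall>x\<in>U. \<exists>p q. p \<in> polyfuns n \<and> q \<in> polyfuns n \<and> q x \<noteq> 0 \<and>
                     (\<forall>y\<in>U. q y \<noteq> 0 \<longrightarrow> f y = p y / q y)}) \<rparr>"

definition affine_variety :: "('p, 'a::field) fspace \<Rightarrow> bool" where
  "affine_variety X \<longleftrightarrow> (\<exists>n (C :: (nat \<Rightarrow> 'a alg_closure) set) \<phi>.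
     closedin (tp (affine_space n)) C \<and> isomorphism X (sub (affine_space n) C) \<phi>)"

text \<open>The first conjunct says that \<open>reg X\<close> is a sheaf of functions. Varieties may be reducible.\<close>

definition variety :: "('p, 'a::field) fspace \<Rightarrow> bool" where
  "variety X \<longleftrightarrow>
     (\<forall>U. openin (tp X) U \<longrightarrow> reg X U = reg (sub X (pts X)) U) \<and>
     (\<exists>\<U>. finite \<U> \<and> \<Union>\<U> = pts X \<and> (\<forall>U\<in>\<U>. openin (tp X) U \<and> affine_variety (sub X U))) \<and>
     closedin (tp (prod_space X X)) {(x, x) | x. x \<in> pts X}"

definition irreducible_in :: "'p topology \<Rightarrow> 'p set \<Rightarrow> bool" where
  "irreducible_in T S \<longleftrightarrow> S \<noteq> {} \<and> S \<subseteq> topspace T \<and>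
     (\<forall>A B. closedin T A \<and> closedin T B \<and> S \<subseteq> A \<union> B \<longrightarrow> S \<subseteq> A \<or> S \<subseteq> B)"

text \<open>Krull dimension (with value \<open>0\<close> on the empty space).\<close>

definition dimension :: "('p, 'a::field) fspace \<Rightarrow> enat" where
  "dimension X = Sup {enat k | k. \<exists>C :: nat \<Rightarrow> 'p set.
     (\<forall>i\<le>k. closedin (tp X) (C i) \<and> irreducible_in (tp X) (C i)) \<and> (\<forall>i<k. C i \<subset> C (Suc i))}"

section \<open>Ind-varieties\<close>

text \<open>The closed embeddings of the defining sequence are taken to be inclusions, so that the
  limit is the union.\<close>

definition ind_variety :: "(nat \<Rightarrow> ('p, 'a::field) fspace) \<Rightarrow> bool" where
  "ind_variety X \<longleftrightarrow> (\<forall>n. variety (X n) \<and> pts (X n) \<subseteq> pts (X (Suc n)) \<and>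
                          closed_embedding (X n) (X (Suc n)) (\<lambda>x. x))"

definition ind_pts :: "(nat \<Rightarrow> ('p, 'a::field) fspace) \<Rightarrow> 'p set" where
  "ind_pts X = (\<Union>n. pts (X n))"

definition ind_rat_pts :: "(nat \<Rightarrow> ('p, 'a::field) fspace) \<Rightarrow> 'p set" where
  "ind_rat_pts X = (\<Union>n. rat_pts (X n))"

definition ind_morphism ::
  "(nat \<Rightarrow> ('p, 'a::field) fspace) \<Rightarrow> (nat \<Rightarrow> ('q, 'a) fspace) \<Rightarrow> ('p \<Rightarrow> 'q) \<Rightarrow> bool" where
  "ind_morphism X Y \<phi> \<longleftrightarrow> (\<forall>n. \<exists>n'. morphism (X n) (Y n') \<phi>)"

definition ind_prod ::
  "(nat \<Rightarrow> ('p, 'a::field) fspace) \<Rightarrow> (nat \<Rightarrow> ('q, 'a) fspace) \<Rightarrow> nat \<Rightarrow> ('p \<times> 'q, 'a) fspace" where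
  "ind_prod X Y = (\<lambda>n. prod_space (X n) (Y n))"

definition equivalent_seqs ::
  "(nat \<Rightarrow> ('p, 'a::field) fspace) \<Rightarrow> (nat \<Rightarrow> ('p, 'a) fspace) \<Rightarrow> bool" where
  "equivalent_seqs X X' \<longleftrightarrow> ind_variety X \<and> ind_variety X' \<and> ind_pts X = ind_pts X' \<and>
     ind_morphism X X' (\<lambda>x. x) \<and> ind_morphism X' X (\<lambda>x. x)"

definition irreducible_ind_variety :: "(nat \<Rightarrow> ('p, 'a::field) fspace) \<Rightarrow> bool" where
  "irreducible_ind_variety X \<longleftrightarrow>
     (\<exists>X'. equivalent_seqs X X' \<and> (\<forall>n. irreducible_in (tp (X' n)) (pts (X' n))))"

definition open_ind_subvariety ::
  "(nat \<Rightarrow> 'p set) \<Rightarrow> (nat \<Rightarrow> ('p, 'a::field) fspace) \<Rightarrow> bool" where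
  "open_ind_subvariety U X \<longleftrightarrow>
     (\<forall>n. openin (tp (X n)) (U n)) \<and> ind_variety (\<lambda>n. sub (X n) (U n))"

section \<open>Ind-groups and unipotence\<close>

definition ind_group :: "(nat \<Rightarrow> ('g, 'a::field) fspace) \<Rightarrow> 'g monoid \<Rightarrow> bool" where
  "ind_group G M \<longleftrightarrow> ind_variety G \<and> group M \<and> carrier M = ind_pts G \<and>
     ind_morphism (ind_prod G G) G (\<lambda>(x, y). x \<otimes>\<^bsub>M\<^esub> y) \<and>
     ind_morphism G G (\<lambda>x. inv\<^bsub>M\<^esub> x)"

definition algebraic_group :: "('g, 'a::field) fspace \<Rightarrow> 'g monoid \<Rightarrow> bool" where
  "algebraic_group G M \<longleftrightarrow> variety G \<and> group M \<and> carrier M = pts G \<and>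
     morphism (prod_space G G) G (\<lambda>(x, y). x \<otimes>\<^bsub>M\<^esub> y) \<and>
     morphism G G (\<lambda>x. inv\<^bsub>M\<^esub> x)"

definition mat_space :: "nat \<Rightarrow> ('a::field alg_closure mat, 'a) fspace" where
  "mat_space m = transport (\<lambda>v. mat m m (\<lambda>(i, j). v (i * m + j))) (affine_space (m * m))"

text \<open>Closed subgroups of groups of upper unitriangular matrices. The latter are closed in the
  space of all matrices, so it does not matter where the image of the embedding is closed.\<close>

definition unipotent_algebraic_group :: "('g, 'a::field) fspace \<Rightarrow> 'g monoid \<Rightarrow> bool" where
  "unipotent_algebraic_group G M \<longleftrightarrow> algebraic_group G M \<and>
     (\<exists>m (\<rho> :: 'g \<Rightarrow> 'a alg_closure mat). closed_embedding G (mat_space m) \<rho> \<and>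
       (\<forall>x\<in>pts G. \<forall>y\<in>pts G. \<rho> (x \<otimes>\<^bsub>M\<^esub> y) = \<rho> x * \<rho> y) \<and>
       (\<forall>x\<in>pts G. upper_triangular (\<rho> x) \<and> (\<forall>i<m. \<rho> x $$ (i, i) = 1)))"

definition unipotent_ind_group :: "(nat \<Rightarrow> ('g, 'a::field) fspace) \<Rightarrow> 'g monoid \<Rightarrow> bool" where
  "unipotent_ind_group G M \<longleftrightarrow> ind_group G M \<and>
     (\<exists>G'. equivalent_seqs G G' \<and>
        (\<forall>n. unipotent_algebraic_group (G' n) (M\<lparr>carrier := pts (G' n)\<rparr>)))"

section \<open>Additive structures of generic modality \<open>k\<close>\<close>

definition regular_action ::
  "(nat \<Rightarrow> ('g, 'a::field) fspace) \<Rightarrow> 'g monoid \<Rightarrow> ('g \<Rightarrow> 'p \<Rightarrow> 'p) \<Rightarrow> (nat \<Rightarrow> ('p, 'a) fspace) \<Rightarrow> bool"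
  where
  "regular_action G M act X \<longleftrightarrow> ind_group G M \<and> ind_variety X \<and>
     group_action M (ind_pts X) act \<and> ind_morphism (ind_prod G X) X (\<lambda>(g, x). act g x)"

text \<open>The condition that the fibres of \<open>\<pi>\<close> are orbits is imposed both on geometric points and
  on points over \<open>F\<close>; in particular every fibre is non-empty, which is what gives meaning to the
  dimension of \<open>Z\<close>. The two conditions agree when \<open>F\<close> is algebraically closed. There is no loss of
  generality in the type of points of \<open>Z\<close>: every variety is isomorphic to one whose points are
  sequences, being a finite union of affine ones.\<close>

definition generic_modality ::
  "(nat \<Rightarrow> ('g, 'a::field) fspace) \<Rightarrow> 'g monoid \<Rightarrow> ('g \<Rightarrow> 'p \<Rightarrow> 'p) \<Rightarrow>
   (nat \<Rightarrow> ('p, 'a) fspace) \<Rightarrow> nat \<Rightarrow> bool" where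
  "generic_modality G M act X k \<longleftrightarrow>
     irreducible_ind_variety X \<and> regular_action G M act X \<and>
     (\<exists>U (Z :: (nat \<Rightarrow> 'a alg_closure, 'a) fspace) \<pi>.
        open_ind_subvariety U X \<and> (\<Union>n. U n) \<noteq> {} \<and>
        variety Z \<and> dimension Z = enat k \<and>
        ind_morphism (\<lambda>n. sub (X n) (U n)) (\<lambda>_. Z) \<pi> \<and>
        (\<forall>z\<in>pts Z. {x \<in> (\<Union>n. U n). \<pi> x = z} \<in> orbits M (ind_pts X) act) \<and>
        (\<forall>z\<in>rat_pts Z. {x \<in> ind_rat_pts (\<lambda>n. sub (X n) (U n)). \<pi> x = z}
                         \<in> orbits (M\<lparr>carrier := ind_rat_pts G\<rparr>) (ind_rat_pts X) act))"

definition additive_structure ::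
  "(nat \<Rightarrow> ('g, 'a::field) fspace) \<Rightarrow> 'g monoid \<Rightarrow> ('g \<Rightarrow> 'p \<Rightarrow> 'p) \<Rightarrow>
   (nat \<Rightarrow> ('p, 'a) fspace) \<Rightarrow> nat \<Rightarrow> bool" where
  "additive_structure G M act X k \<longleftrightarrow>
     unipotent_ind_group G M \<and> comm_group M \<and> generic_modality G M act X k"

section \<open>The ind-variety of injective Rota--Baxter operators of weight zero\<close>

definition mult_op :: "'k::field_char_0 poly \<Rightarrow> 'k poly \<Rightarrow> 'k poly" where
  "mult_op r f = r * f"

text \<open>The formal integration from \<open>a\<close>, i.e. the linear operator with \<open>x^n \<mapsto> (x^(n+1) - a^(n+1)) / (n+1)\<close>.\<close>

definition J_op :: "'k::field_char_0 \<Rightarrow> 'k poly \<Rightarrow> 'k poly" where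
  "J_op a f = (\<Sum>n\<le>degree f.
     smult (coeff f n / of_nat (n + 1)) (monom 1 (n + 1) - [:a ^ (n + 1):]))"

definition RB_ops :: "('k::field_char_0 poly \<Rightarrow> 'k poly) set" where
  "RB_ops = {J_op a \<circ> mult_op r | a r. r \<noteq> 0}"

definition poly_of_coords :: "nat \<Rightarrow> (nat \<Rightarrow> 'k::comm_monoid_add) \<Rightarrow> 'k poly" where
  "poly_of_coords d w = (\<Sum>i\<le>d. monom (w i) i)"

definition RB_param :: "nat \<Rightarrow> (nat \<Rightarrow> 'k::field_char_0) \<times> (nat \<Rightarrow> 'k) \<Rightarrow> 'k poly \<Rightarrow> 'k poly" where
  "RB_param d = (\<lambda>(v, w). J_op (v 0) \<circ> mult_op (poly_of_coords d w))"

text \<open>The structure of \<open>\<A>\<^sup>1 \<times> (\<A>\<^sup>d\<^sup>+\<^sup>1 - {0})\<close> transported to operators. The geometric points of the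
  limit are the operators over the algebraic closure of \<open>F\<close>; its points over \<open>F\<close> are the operators
  over \<open>F\<close>, see \<open>ind_rat_pts_RB_ind\<close> and \<open>RB_op_to_ac\<close> below.\<close>

definition RB_ind ::
  "nat \<Rightarrow> ('a::field_char_0 alg_closure poly \<Rightarrow> 'a alg_closure poly, 'a) fspace" where
  "RB_ind d = transport (RB_param d)
     (prod_space (affine_space 1) (sub (affine_space (d + 1)) (affine_pts (d + 1) - {\<lambda>_. 0})))"

text \<open>The remaining facts relate the ind-variety to the set of operators: its geometric points, its
  points over \<open>F\<close>, and the injectivity of the parametrisation used in \<open>transport\<close>.\<close>

lemma pts_sub [simp]: "pts (sub X S) = pts X \<inter> S"
  by (simp add: sub_def)

lemma rat_pts_sub: "rat_pts (sub X S) = rat_pts X \<inter> S"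
proof (intro equalityI subsetI)
  fix x assume x: "x \<in> rat_pts (sub X S)"
  have "f x \<in> range to_ac" if W: "openin (tp X) W" "x \<in> W" "f \<in> reg X W" for W f
  proof -
    have "openin (tp (sub X S)) (W \<inter> S)" "x \<in> W \<inter> S" "f \<in> reg (sub X S) (W \<inter> S)"
      using W x by (auto simp: sub_def rat_pts_def intro: openin_subtopology_Int)
    then show ?thesis using x unfolding rat_pts_def by blast
  qed
  then show "x \<in> rat_pts X \<inter> S" using x by (auto simp: rat_pts_def)
next
  fix x assume x: "x \<in> rat_pts X \<inter> S"
  have "f x \<in> range to_ac" if "x \<in> U" "f \<in> reg (sub X S) U" for U f
  proof -
    from that obtain W g where "openin (tp X) W" "x \<in> W" "g \<in> reg X W" "f x = g x"
      by (force simp: sub_def)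
    then show ?thesis using x by (auto simp: rat_pts_def)
  qed
  then show "x \<in> rat_pts (sub X S)" using x by (auto simp: rat_pts_def)
qed

lemma pts_transport [simp]: "pts (transport h X) = h ` pts X"
  by (auto simp: transport_def topspace_pullback_topology inv_into_into)

lemma openin_transport:
  assumes "inj_on h (pts X)"
  shows "openin (tp (transport h X)) U \<longleftrightarrow>
           U \<subseteq> h ` pts X \<and> openin (tp X) {x \<in> pts X. h x \<in> U}"
proof
  assume "openin (tp (transport h X)) U"
  then obtain W where W: "openin (tp X) W" "U = inv_into (pts X) h -` W \<inter> h ` pts X"
    by (auto simp: transport_def openin_pullback_topology)
  moreover have "{x \<in> pts X. h x \<in> U} = W"
  proof -
    have "h x \<in> U \<longleftrightarrow> x \<in> W" if "x \<in> pts X" for x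
      using W(2) assms that by (simp add: inv_into_f_f)
    then show ?thesis using openin_subset[OF W(1)] by auto
  qed
  ultimately show "U \<subseteq> h ` pts X \<and> openin (tp X) {x \<in> pts X. h x \<in> U}" by auto
next
  assume U: "U \<subseteq> h ` pts X \<and> openin (tp X) {x \<in> pts X. h x \<in> U}"
  have "U = inv_into (pts X) h -` {x \<in> pts X. h x \<in> U} \<inter> h ` pts X"
    using U assms by (auto simp: inv_into_into f_inv_into_f)
  then show "openin (tp (transport h X)) U"
    using U by (auto simp: transport_def openin_pullback_topology)
qed

lemma rat_pts_transport:
  assumes inj: "inj_on h (pts X)"
    and cong: "\<And>U f g. f \<in> reg X U \<Longrightarrow> \<forall>x\<in>U. f x = g x \<Longrightarrow> g \<in> reg X U"
  shows "rat_pts (transport h X) = h ` rat_pts X"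
proof -
  have "h x \<in> rat_pts (transport h X) \<longleftrightarrow> x \<in> rat_pts X" if x: "x \<in> pts X" for x
  proof
    assume r: "h x \<in> rat_pts (transport h X)"
    have "f x \<in> range to_ac" if W: "openin (tp X) W" "x \<in> W" "f \<in> reg X W" for W f
    proof -
      have sub: "W \<subseteq> pts X" using W(1) openin_subset by blast
      have eq: "{x \<in> pts X. h x \<in> h ` W} = W"
        using sub inj by (auto simp: inj_on_def)
      have "f \<circ> inv_into (pts X) h \<in> reg (transport h X) (h ` W)"
      proof -
        have "f \<circ> inv_into (pts X) h \<circ> h \<in> reg X W"
          by (rule cong[OF W(3)]) (use sub inj in \<open>auto simp: inv_into_f_f subset_eq\<close>)
        then show ?thesis by (simp add: transport_def eq)
      qed
      moreover have "openin (tp (transport h X)) (h ` W)"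
        using sub W(1) eq by (auto simp: openin_transport[OF inj])
      ultimately have "(f \<circ> inv_into (pts X) h) (h x) \<in> range to_ac"
        using r W(2) unfolding rat_pts_def by blast
      then show ?thesis using inj x by simp
    qed
    then show "x \<in> rat_pts X" using x by (auto simp: rat_pts_def)
  next
    assume r: "x \<in> rat_pts X"
    have "f (h x) \<in> range to_ac"
      if W: "openin (tp (transport h X)) W" "h x \<in> W" "f \<in> reg (transport h X) W" for W f
    proof -
      have "openin (tp X) {x \<in> pts X. h x \<in> W}" "f \<circ> h \<in> reg X {x \<in> pts X. h x \<in> W}"
        using W(1,3) by (simp add: openin_transport[OF inj], simp add: transport_def)
      then have "(f \<circ> h) x \<in> range to_ac" using r W(2) x unfolding rat_pts_def by blast
      then show ?thesis by simp
    qed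
    then show "h x \<in> rat_pts (transport h X)" using x by (auto simp: rat_pts_def)
  qed
  moreover have "rat_pts (transport h X) \<subseteq> h ` pts X" "rat_pts X \<subseteq> pts X"
    unfolding rat_pts_def by auto
  ultimately show ?thesis by blast
qed

lemma range_to_ac_closed:
  fixes x y :: "'a::field alg_closure"
  assumes "x \<in> range to_ac" "y \<in> range to_ac"
  shows "x + y \<in> range to_ac" "x * y \<in> range to_ac" "x / y \<in> range to_ac"
proof -
  obtain a b where "x = to_ac a" "y = to_ac b" using assms by auto
  then have "x + y = to_ac (a + b)" "x * y = to_ac (a * b)" "x / y = to_ac (a / b)" by simp_all
  then show "x + y \<in> range to_ac" "x * y \<in> range to_ac" "x / y \<in> range to_ac" by blast+
qed

lemma zero_range_to_ac: "(0 :: 'a::field alg_closure) \<in> range to_ac"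
  using rangeI[of to_ac "0::'a"] by simp

lemma sum_range_to_ac:
  fixes f :: "_ \<Rightarrow> 'a::field alg_closure"
  shows "(\<And>i. i \<in> A \<Longrightarrow> f i \<in> range to_ac) \<Longrightarrow> sum f A \<in> range to_ac"
proof (induction A rule: infinite_finite_induct)
  case (insert x A) then show ?case by (simp add: range_to_ac_closed(1))
qed (simp_all add: zero_range_to_ac)

lemma tensor_fst: "f \<in> reg X U \<Longrightarrow> (\<lambda>_. 1) \<in> reg Y V \<Longrightarrow> f \<circ> fst \<in> tensor_funs X Y U V"
  unfolding tensor_funs_def mem_Collect_eq
  by (rule exI[of _ "\<lambda>_. f"], rule exI[of _ "\<lambda>_ _. 1"], rule exI[of _ 1]) (auto simp: fun_eq_iff)

lemma tensor_snd: "g \<in> reg Y V \<Longrightarrow> (\<lambda>_. 1) \<in> reg X U \<Longrightarrow> g \<circ> snd \<in> tensor_funs X Y U V"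
  unfolding tensor_funs_def mem_Collect_eq
  by (rule exI[of _ "\<lambda>_ _. 1"], rule exI[of _ "\<lambda>_. g"], rule exI[of _ 1]) (auto simp: fun_eq_iff)

context
  fixes X :: "('p, 'a::field) fspace" and Y :: "('q, 'a) fspace"
  assumes one_X: "\<And>U. openin (tp X) U \<Longrightarrow> (\<lambda>_. 1) \<in> reg X U"
    and one_Y: "\<And>V. openin (tp Y) V \<Longrightarrow> (\<lambda>_. 1) \<in> reg Y V"
begin

lemma one_tensor:
  assumes "openin (tp X) U" "openin (tp Y) V" shows "(\<lambda>_. 1) \<in> tensor_funs X Y U V"
  using tensor_fst[OF one_X one_Y] assms by (simp add: comp_def)

lemma openin_prod_Times:
  assumes "openin (tp X) U" "openin (tp Y) V" shows "openin (tp (prod_space X Y)) (U \<times> V)"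
proof -
  have "U \<times> V = {z \<in> U \<times> V. (\<lambda>_. 1) z \<noteq> (0 :: 'a alg_closure)}" by auto
  moreover have "(\<lambda>_. 1) \<in> tensor_funs X Y U V" by (rule one_tensor[OF assms])
  ultimately have "U \<times> V \<in> {{z \<in> U \<times> V. h z \<noteq> 0} | U V h. openin (tp X) U \<and> openin (tp Y) V \<and>
                h \<in> tensor_funs X Y U V}"
    unfolding mem_Collect_eq
    using assms by (intro exI[of _ U] exI[of _ V] exI[of _ "\<lambda>_. 1"] conjI)
  then show ?thesis unfolding prod_space_def by (simp add: topology_generated_by_Basis)
qed

lemma pts_prod: "pts (prod_space X Y) = pts X \<times> pts Y"
proof
  show "pts (prod_space X Y) \<subseteq> pts X \<times> pts Y"
    by (auto simp: prod_space_def dest: openin_subset)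
  show "pts X \<times> pts Y \<subseteq> pts (prod_space X Y)"
    by (intro openin_subset openin_prod_Times) auto
qed

lemma rat_pts_prod: "rat_pts (prod_space X Y) = rat_pts X \<times> rat_pts Y"
proof (intro equalityI subsetI)
  fix z assume z: "z \<in> rat_pts (prod_space X Y)"
  then obtain x y where xy: "z = (x, y)" "x \<in> pts X" "y \<in> pts Y"
    by (cases z) (auto simp: rat_pts_def pts_prod)
  have reg: "t \<in> reg (prod_space X Y) (U \<times> V)"
    if "openin (tp X) U" "openin (tp Y) V" "t \<in> tensor_funs X Y U V" for U V t
    unfolding prod_space_def using that one_tensor[OF that(1,2)] by fastforce
  have key: "t z \<in> range to_ac"
    if "openin (tp X) U" "openin (tp Y) V" "t \<in> tensor_funs X Y U V" "x \<in> U" "y \<in> V" for U V t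
    using z reg[OF that(1-3)] openin_prod_Times[OF that(1,2)] that xy
    unfolding rat_pts_def by blast
  have "f x \<in> range to_ac" if "openin (tp X) W" "x \<in> W" "f \<in> reg X W" for W f
    using key[OF that(1) openin_topspace tensor_fst[OF that(3) one_Y]] that xy by simp
  moreover have "f y \<in> range to_ac" if "openin (tp Y) W" "y \<in> W" "f \<in> reg Y W" for W f
    using key[OF openin_topspace that(1) tensor_snd[OF that(3) one_X]] that xy by simp
  ultimately show "z \<in> rat_pts X \<times> rat_pts Y" using xy by (auto simp: rat_pts_def)
next
  fix z assume z: "z \<in> rat_pts X \<times> rat_pts Y"
  have tens: "t z \<in> range to_ac"
    if "openin (tp X) U" "openin (tp Y) V" "z \<in> U \<times> V" "t \<in> tensor_funs X Y U V" for U V t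
    using that z unfolding tensor_funs_def rat_pts_def
    by (auto intro!: sum_range_to_ac range_to_ac_closed(2))
  have "f z \<in> range to_ac" if "z \<in> W" "f \<in> reg (prod_space X Y) W" for W f
  proof -
    have "\<exists>U V p q. openin (tp X) U \<and> openin (tp Y) V \<and> z \<in> U \<times> V \<and>
               p \<in> tensor_funs X Y U V \<and> q \<in> tensor_funs X Y U V \<and> q z \<noteq> 0 \<and>
               (\<forall>y\<in>W \<inter> (U \<times> V). q y \<noteq> 0 \<longrightarrow> f y = p y / q y)"
      using that(2)[unfolded prod_space_def, simplified fspace.simps mem_Collect_eq] that(1) by (rule bspec)
    then obtain U V p q where "openin (tp X) U" "openin (tp Y) V" "z \<in> U \<times> V"
      "p \<in> tensor_funs X Y U V" "q \<in> tensor_funs X Y U V" "q z \<noteq> 0"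
      "\<forall>y\<in>W \<inter> (U \<times> V). q y \<noteq> 0 \<longrightarrow> f y = p y / q y" by (elim exE conjE)
    note * = this(1-5) bspec[OF this(7) IntI[OF that(1) this(3)], rule_format, OF this(6)]
    then show ?thesis using tens[OF *(1-4)] tens[OF *(1-3,5)] range_to_ac_closed(3) by simp
  qed
  then show "z \<in> rat_pts (prod_space X Y)" using z by (auto simp: rat_pts_def pts_prod)
qed

end

lemma const_polyfuns: "(\<lambda>_. 1) \<in> polyfuns n" "(\<lambda>_. 0) \<in> polyfuns n"
  using polyfuns.const[of 1 n] polyfuns.const[of 0 n] by simp_all

lemma pts_affine [simp]: "pts (affine_space n) = affine_pts n"
proof -
  have "affine_pts n \<in> {{v \<in> affine_pts n. p v \<noteq> (0 :: 'a::field alg_closure)} | p. p \<in> polyfuns n}"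
    using const_polyfuns(1)[of n] by (intro CollectI exI[of _ "\<lambda>_. 1"]) auto
  then show ?thesis by (auto simp: affine_space_def)
qed

lemma polyfuns_reg_affine: "p \<in> polyfuns n \<Longrightarrow> p \<in> reg (affine_space n) U"
  using const_polyfuns(1)[of n] by (fastforce simp: affine_space_def)

lemma rat_pts_affine: "rat_pts (affine_space n) = {v \<in> affine_pts n. range v \<subseteq> range to_ac}"
proof (intro equalityI subsetI)
  fix v :: "nat \<Rightarrow> 'a::field alg_closure"
  assume v: "v \<in> rat_pts (affine_space n)"
  have "v i \<in> range to_ac" for i
  proof (cases "i < n")
    case True
    then show ?thesis
      using v polyfuns_reg_affine[OF polyfuns.coord[OF True]]
        openin_topspace[of "tp (affine_space n :: (_, 'a) fspace)"]
      unfolding rat_pts_def by force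
  next
    case False
    then show ?thesis using v zero_range_to_ac by (auto simp: rat_pts_def affine_pts_def)
  qed
  then show "v \<in> {v \<in> affine_pts n. range v \<subseteq> range to_ac}" using v by (auto simp: rat_pts_def)
next
  fix v :: "nat \<Rightarrow> 'a::field alg_closure"
  assume v: "v \<in> {v \<in> affine_pts n. range v \<subseteq> range to_ac}"
  have poly: "p v \<in> range to_ac" if "p \<in> polyfuns n" for p
    using that v by induction (auto intro: range_to_ac_closed)
  have "f v \<in> range to_ac" if "v \<in> W" "f \<in> reg (affine_space n) W" for W f
  proof -
    from that obtain p q where "p \<in> polyfuns n" "q \<in> polyfuns n" "f v = p v / q v"
      by (force simp: affine_space_def)
    then show ?thesis using range_to_ac_closed(3)[OF poly poly] by simp
  qed
  then show "v \<in> rat_pts (affine_space n)" using v by (auto simp: rat_pts_def)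
qed

lemma pderiv_sum': "pderiv (\<Sum>i\<in>I. f i) = (\<Sum>i\<in>I. pderiv (f i))"
  using higher_pderiv_sum[of 1 f I] by simp

lemma smult_sum': "smult c (\<Sum>i\<in>I. f i) = (\<Sum>i\<in>I. smult c (f i))"
  by (induction I rule: infinite_finite_induct) (simp_all add: smult_add_right)

lemma pcompose_power': "pcompose (p ^ n) q = pcompose p q ^ n"
  by (induction n) (simp_all add: pcompose_mult pcompose_1)

lemma coeff_poly_of_coords: "coeff (poly_of_coords d w) i = (if i \<le> d then w i else 0)"
  by (simp add: poly_of_coords_def coeff_sum)

lemma J_op_extend:
  "degree f \<le> N \<Longrightarrow> J_op a f = (\<Sum>n\<le>N.
     smult (coeff f n / of_nat (n + 1)) (monom 1 (n + 1) - [:a ^ (n + 1):]))"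
  unfolding J_op_def by (rule sum.mono_neutral_left) (auto simp: coeff_eq_0)

lemma J_op_add: "J_op a (f + g) = J_op a f + J_op a g"
proof -
  define N where "N = max (degree f) (degree g)"
  have "degree (f + g) \<le> N" unfolding N_def by (rule degree_add_le_max)
  then show ?thesis
    using J_op_extend[of f N a] J_op_extend[of g N a] J_op_extend[of "f + g" N a]
    by (simp add: N_def sum.distrib[symmetric] smult_add_left[symmetric] add_divide_distrib)
qed

lemma J_op_smult: "J_op a (smult c f) = smult c (J_op a f)"
  using J_op_extend[of "smult c f" "degree f" a] J_op_extend[of f "degree f" a]
  by (simp add: degree_smult_le smult_sum')

lemma J_op_monom: "J_op a (monom 1 n) = smult (1 / of_nat (n + 1)) (monom 1 (n + 1) - [:a ^ (n + 1):])"
proof -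
  have "J_op a (monom 1 n) = (\<Sum>i\<le>n. if i = n then
      smult (1 / of_nat (n + 1)) (monom 1 (n + 1) - [:a ^ (n + 1):]) else 0)"
    unfolding J_op_def by (intro sum.cong) (auto simp del: of_nat_Suc of_nat_add simp: degree_monom_eq)
  then show ?thesis by simp
qed

lemma pderiv_J_op: "pderiv (J_op a f) = f"
proof -
  have "pderiv (J_op a f) = (\<Sum>n\<le>degree f. monom (coeff f n) n)"
    unfolding J_op_def
    by (auto intro!: sum.cong
        simp: pderiv_sum' pderiv_smult pderiv_diff pderiv_monom smult_monom pderiv_pCons
          simp del: of_nat_Suc of_nat_add)
  then show ?thesis by (simp add: poly_as_sum_of_monoms)
qed

lemma poly_J_op: "poly (J_op a f) a = 0"
  by (simp add: J_op_def poly_sum poly_monom)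

lemma J_mult_inj:
  fixes a b :: "'k::field_char_0"
  assumes eq: "J_op a \<circ> mult_op r = J_op b \<circ> mult_op s" and r: "r \<noteq> 0"
  shows "a = b \<and> r = s"
proof -
  have *: "J_op a (r * f) = J_op b (s * f)" for f
    using fun_cong[OF eq, of f] by (simp add: mult_op_def)
  have rs: "r = s" using arg_cong[OF *[of 1], of pderiv] by (simp add: pderiv_J_op)
  show ?thesis
  proof (rule ccontr)
    assume "\<not> (a = b \<and> r = s)"
    then have ab: "b - a \<noteq> 0" using rs by simp
    define c where "c i = coeff (pcompose r [:a, 1:]) i" for i
    define n where "n = degree r"
    have r_eq: "r = (\<Sum>i\<le>n. smult (c i) ([:- a, 1:] ^ i))"
    proof -
      have "degree (pcompose r [:a, 1:]) = n" by (simp add: degree_pcompose n_def)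
      then have "pcompose r [:a, 1:] = (\<Sum>i\<le>n. smult (c i) (monom 1 i))"
        using poly_as_sum_of_monoms[of "pcompose r [:a, 1:]"] by (simp add: c_def smult_monom)
      then have "pcompose (pcompose r [:a, 1:]) [:- a, 1:]
                   = (\<Sum>i\<le>n. smult (c i) (pcompose (monom 1 i) [:- a, 1:]))"
        by (simp add: pcompose_sum pcompose_smult)
      moreover have "pcompose (pcompose r [:a, 1:]) [:- a, 1:] = r"
        by (simp add: pcompose_assoc[symmetric] pcompose_pCons pcompose_idR)
      moreover have "pcompose (monom 1 i) [:- a, 1:] = [:- a, 1:] ^ i" for i
        by (simp add: monom_altdef pcompose_smult pcompose_power' pcompose_pCons)
      ultimately show ?thesis by simp
    qed
    have moment: "(\<Sum>i\<le>n. c i * (b - a) ^ i / of_nat (i + m + 1)) = 0" for m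
    proof -
      define P where "P = (\<Sum>i\<le>n. smult (c i / of_nat (i + m + 1)) ([:- a, 1:] ^ (i + m + 1)))"
      have "pderiv P = (\<Sum>i\<le>n. smult (c i) ([:- a, 1:] ^ (i + m)))"
        unfolding P_def pderiv_sum'
        by (intro sum.cong refl)
          (simp add: pderiv_smult pderiv_power_Suc pderiv_pCons del: of_nat_Suc of_nat_add power_Suc)
      also have "\<dots> = r * [:- a, 1:] ^ m"
        by (subst r_eq) (simp add: sum_distrib_right power_add)
      finally have "pderiv (P - J_op a (r * [:- a, 1:] ^ m)) = 0" by (simp add: pderiv_diff pderiv_J_op)
      then obtain e where e: "P - J_op a (r * [:- a, 1:] ^ m) = [:e:]" using pderiv_iszero by blast
      have "poly P a = 0" by (simp add: P_def poly_sum)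
      then have "e = 0" using arg_cong[OF e, of "\<lambda>p. poly p a"] by (simp add: poly_J_op)
      then have "P = J_op b (r * [:- a, 1:] ^ m)" using e * rs by simp
      then have "poly P b = 0" by (simp add: poly_J_op)
      moreover have "poly [:- a, 1:] b = b - a" by simp
      then have "poly P b = (b - a) ^ (m + 1) * (\<Sum>i\<le>n. c i * (b - a) ^ i / of_nat (i + m + 1))"
        unfolding P_def poly_sum poly_smult poly_power sum_distrib_left
        by (intro sum.cong refl) (simp only: power_add times_divide_eq_right times_divide_eq_left mult_ac)
      ultimately have "(b - a) ^ (m + 1) * (\<Sum>i\<le>n. c i * (b - a) ^ i / of_nat (i + m + 1)) = 0" by simp
      then show ?thesis using ab by simp
    qed
    define S where "S = (\<Sum>i\<le>n. smult (c i * (b - a) ^ i) (\<Prod>j\<in>{..n} - {i}. [:of_nat (j + 1), 1:]))"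
    have S_eval: "poly S t = (\<Sum>i\<le>n. c i * (b - a) ^ i * (\<Prod>j\<in>{..n} - {i}. of_nat (j + 1) + t))" for t
      by (simp add: S_def poly_sum poly_prod)
    have "poly S (of_nat m) = 0" for m
    proof -
      have "(\<Prod>j\<in>{..n} - {i}. of_nat (j + 1) + of_nat m) =
              (\<Prod>j\<le>n. of_nat (j + m + 1) :: 'k) / of_nat (i + m + 1)" if "i \<le> n" for i
      proof -
        have "(\<Prod>j\<le>n. of_nat (j + m + 1) :: 'k) =
                of_nat (i + m + 1) * (\<Prod>j\<in>{..n} - {i}. of_nat (j + m + 1))"
          using that by (subst prod.remove[of "{..n}" i]) auto
        moreover have "of_nat (j + 1) + of_nat m = (of_nat (j + m + 1) :: 'k)" for j by simp
        moreover have "(of_nat (i + m + 1) :: 'k) \<noteq> 0" by (simp del: of_nat_Suc of_nat_add)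
        ultimately show ?thesis by (simp only: nonzero_mult_div_cancel_left not_False_eq_True)
      qed
      then have "poly S (of_nat m) = (\<Prod>j\<le>n. of_nat (j + m + 1)) *
                   (\<Sum>i\<le>n. c i * (b - a) ^ i / of_nat (i + m + 1))"
        by (simp add: S_eval sum_distrib_left mult_ac)
      then show ?thesis using moment by simp
    qed
    then have "range of_nat \<subseteq> {t. poly S t = 0}" by auto
    moreover have "infinite (range (of_nat :: nat \<Rightarrow> 'k))" by (simp add: range_inj_infinite inj_of_nat)
    ultimately have S0: "S = 0" using poly_roots_finite finite_subset by blast
    have "c i = 0" if i: "i \<le> n" for i
    proof -
      have "(\<Prod>j\<in>{..n} - {k}. of_nat (j + 1) - of_nat (i + 1) :: 'k) = 0" if "k \<noteq> i" for k
        using that i by (auto intro!: prod_zero bexI[of _ i])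
      then have "poly S (- of_nat (i + 1)) =
          (\<Sum>k\<le>n. if k = i then c i * (b - a) ^ i * (\<Prod>j\<in>{..n} - {i}. of_nat (j + 1) - of_nat (i + 1)) else 0)"
        unfolding S_eval by (intro sum.cong) auto
      then have "c i * (b - a) ^ i * (\<Prod>j\<in>{..n} - {i}. of_nat (j + 1) - of_nat (i + 1)) = 0"
        using i S0 by simp
      moreover have "(\<Prod>j\<in>{..n} - {i}. of_nat (j + 1) - of_nat (i + 1) :: 'k) \<noteq> 0"
        by (auto simp: prod_zero_iff)
      ultimately show ?thesis using ab by simp
    qed
    then have "r = 0" by (subst r_eq) simp
    then show False using r by simp
  qed
qed

lemma inj_RB_param:
  "inj_on (RB_param d) ((affine_pts 1 :: (nat \<Rightarrow> 'a::field_char_0 alg_closure) set) \<times> (affine_pts (d + 1) - {\<lambda>_. 0}))"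
proof (rule inj_onI)
  fix z z' :: "(nat \<Rightarrow> 'a alg_closure) \<times> _"
  assume z: "z \<in> affine_pts 1 \<times> (affine_pts (d + 1) - {\<lambda>_. 0})"
    "z' \<in> affine_pts 1 \<times> (affine_pts (d + 1) - {\<lambda>_. 0})" and eq: "RB_param d z = RB_param d z'"
  obtain v w v' w' where [simp]: "z = (v, w)" "z' = (v', w')" by (cases z, cases z')
  have ext: "w = w'" if "w \<in> affine_pts (d + 1)" "w' \<in> affine_pts (d + 1)"
    "poly_of_coords d w = poly_of_coords d w'" for w w' :: "nat \<Rightarrow> 'a alg_closure"
  proof
    fix i show "w i = w' i"
    proof (cases "i \<le> d")
      case True
      have "coeff (poly_of_coords d w) i = coeff (poly_of_coords d w') i" using that(3) by simp
      then show ?thesis using True by (simp add: coeff_poly_of_coords)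
    qed (use that in \<open>auto simp: affine_pts_def\<close>)
  qed
  have "poly_of_coords d w \<noteq> 0"
    using ext[of w "\<lambda>_. 0"] z by (auto simp: affine_pts_def poly_of_coords_def)
  then have "v 0 = v' 0 \<and> poly_of_coords d w = poly_of_coords d w'"
    using eq J_mult_inj[of "v 0" "poly_of_coords d w"] by (simp add: RB_param_def)
  moreover from this have "v = v'" using z by (auto simp: affine_pts_def fun_eq_iff Suc_le_eq)
      (metis not_gr_zero)
  ultimately show "z = z'" using ext z by auto
qed

lemma one_reg_affine: "(\<lambda>_. 1) \<in> reg (affine_space n) U"
  using polyfuns_reg_affine const_polyfuns(1) by blast

lemma one_reg_sub_affine:
  "openin (tp (sub (affine_space n) S)) U \<Longrightarrow> (\<lambda>_. 1) \<in> reg (sub (affine_space n) S) U"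
  using one_reg_affine[of n "affine_pts n"] openin_topspace[of "tp (affine_space n)"]
  by (fastforce simp: sub_def dest: openin_subset)

lemma pts_RB_ind:
  "pts (RB_ind d) = RB_param d ` (affine_pts 1 \<times> (affine_pts (d + 1) - {\<lambda>_. 0}))"
  by (simp add: RB_ind_def pts_prod one_reg_affine one_reg_sub_affine Int_absorb1)

lemma rat_pts_RB_ind:
  "rat_pts (RB_ind d :: (_, 'a::field_char_0) fspace) = RB_param d ` (rat_pts (affine_space 1) \<times>
     (rat_pts (affine_space (d + 1)) - {\<lambda>_. 0}))"
proof -
  have "rat_pts (affine_space (d + 1) :: (_, 'a) fspace) \<inter> (affine_pts (d + 1) - {\<lambda>_. 0})
          = rat_pts (affine_space (d + 1)) - {\<lambda>_. 0}"
    by (auto simp: rat_pts_affine)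
  moreover have "rat_pts (RB_ind d :: (_, 'a) fspace) = RB_param d ` rat_pts (prod_space (affine_space 1)
      (sub (affine_space (d + 1)) (affine_pts (d + 1) - {\<lambda>_. 0})))"
    unfolding RB_ind_def
  proof (rule rat_pts_transport)
    show "inj_on (RB_param d) (pts (prod_space (affine_space 1)
        (sub (affine_space (d + 1)) (affine_pts (d + 1) - {\<lambda>_. 0}))))"
      using inj_RB_param by (simp add: pts_prod one_reg_affine one_reg_sub_affine Int_absorb1)
  next
    fix U f g assume f: "f \<in> reg (prod_space (affine_space 1)
        (sub (affine_space (d + 1)) (affine_pts (d + 1) - {\<lambda>_. 0}))) U" and fg: "\<forall>x\<in>U. f x = g x"
    have "(\<forall>y\<in>U \<inter> V. q y \<noteq> 0 \<longrightarrow> f y = p y / q y) \<longleftrightarrow> (\<forall>y\<in>U \<inter> V. q y \<noteq> 0 \<longrightarrow> g y = p y / q y)"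
      for V p q using fg by auto
    then show "g \<in> reg (prod_space (affine_space 1)
        (sub (affine_space (d + 1)) (affine_pts (d + 1) - {\<lambda>_. 0}))) U"
      using f unfolding prod_space_def by simp
  qed
  moreover have "rat_pts (prod_space (affine_space 1 :: (_, 'a) fspace)
      (sub (affine_space (d + 1)) (affine_pts (d + 1) - {\<lambda>_. 0})))
      = rat_pts (affine_space 1) \<times> rat_pts (sub (affine_space (d + 1)) (affine_pts (d + 1) - {\<lambda>_. 0}))"
    by (rule rat_pts_prod) (rule one_reg_affine, erule one_reg_sub_affine)
  ultimately show ?thesis by (simp only: rat_pts_sub)
qed

lemma RB_param_affine_image:
  assumes "0 \<in> A"
  shows "(\<Union>d. RB_param d ` ({v \<in> affine_pts 1. range v \<subseteq> A} \<times>
            ({w \<in> affine_pts (d + 1). range w \<subseteq> A} - {\<lambda>_. 0})))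
         = {J_op a \<circ> mult_op r | a r. r \<noteq> 0 \<and> a \<in> A \<and> range (coeff r) \<subseteq> A}" (is "?L = ?R")
proof
  show "?L \<subseteq> ?R"
  proof
    fix T assume "T \<in> ?L"
    then obtain d v w where T: "T = RB_param d (v, w)" "range v \<subseteq> A" "w \<in> affine_pts (d + 1)"
      "range w \<subseteq> A" "w \<noteq> (\<lambda>_. 0)" by auto
    have "coeff (poly_of_coords d w) = w"
      using T(3) by (force simp: coeff_poly_of_coords affine_pts_def fun_eq_iff)
    moreover from this have "poly_of_coords d w \<noteq> 0" using T(5) by (auto simp: fun_eq_iff)
    ultimately show "T \<in> ?R"
      using T by (auto simp: RB_param_def intro!: exI[of _ "v 0"] exI[of _ "poly_of_coords d w"])
  qed
  show "?R \<subseteq> ?L"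
  proof
    fix T assume "T \<in> ?R"
    then obtain a r where T: "T = J_op a \<circ> mult_op r" "r \<noteq> 0" "a \<in> A" "range (coeff r) \<subseteq> A" by blast
    define v where "v = (\<lambda>i::nat. if i = 0 then a else 0)"
    have "poly_of_coords (degree r) (coeff r) = r"
      by (simp add: poly_of_coords_def poly_as_sum_of_monoms)
    then have "T = RB_param (degree r) (v, coeff r)" by (simp add: RB_param_def T v_def)
    moreover have "v \<in> affine_pts 1" "range v \<subseteq> A" "coeff r \<in> affine_pts (degree r + 1)"
      using T assms by (auto simp: v_def affine_pts_def coeff_eq_0)
    moreover have "coeff r \<noteq> (\<lambda>_. 0)" using T(2) by (simp add: zero_poly.rep_eq[symmetric] coeff_inject)
    ultimately show "T \<in> ?L" using T(4) by blast
  qed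
qed

lemma ind_pts_RB_ind: "ind_pts RB_ind = RB_ops"
  using RB_param_affine_image[of UNIV] by (simp add: ind_pts_def pts_RB_ind RB_ops_def)

lemma RB_op_to_ac:
  "(J_op (to_ac a) \<circ> mult_op (map_poly to_ac r)) (map_poly to_ac f)
     = map_poly to_ac ((J_op a \<circ> mult_op r) f)"
proof -
  have 1: "map_poly to_ac (p + q) = map_poly to_ac p + map_poly to_ac q" for p q :: "'a poly"
    by (rule poly_eqI) (simp add: coeff_map_poly)
  have 2: "map_poly to_ac (p - q) = map_poly to_ac p - map_poly to_ac q" for p q :: "'a poly"
    by (rule poly_eqI) (simp add: coeff_map_poly)
  have 3: "map_poly to_ac (p * q) = map_poly to_ac p * map_poly to_ac q" for p q :: "'a poly"
    by (rule poly_eqI) (simp add: coeff_map_poly coeff_mult to_ac_sum)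
  have 4: "map_poly to_ac (\<Sum>i\<in>I. p i) = (\<Sum>i\<in>I. map_poly to_ac (p i))" for p :: "nat \<Rightarrow> 'a poly" and I
    by (rule poly_eqI) (simp add: coeff_map_poly coeff_sum to_ac_sum)
  have deg: "degree (map_poly to_ac p) = degree p" for p :: "'a poly"
    by (rule degree_map_poly) simp
  have "J_op (to_ac a) (map_poly to_ac g) = map_poly to_ac (J_op a g)" for g
    unfolding J_op_def 4 deg
    by (intro sum.cong refl poly_eqI)
      (simp add: coeff_map_poly coeff_pCons split: nat.split)
  then show ?thesis by (simp add: mult_op_def 3[symmetric])
qed

lemma ind_rat_pts_RB_ind:
  "ind_rat_pts RB_ind = {J_op (to_ac a) \<circ> mult_op (map_poly to_ac r) | a r. r \<noteq> 0}"
proof -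
  have "(range (coeff r) \<subseteq> range to_ac) = (\<exists>s. r = map_poly to_ac s)" for r :: "'a alg_closure poly"
  proof
    assume *: "range (coeff r) \<subseteq> range to_ac"
    have "r = map_poly to_ac (map_poly of_ac r)"
    proof (rule poly_eqI)
      fix i
      have "coeff r i \<in> range to_ac" using * by blast
      then show "coeff r i = coeff (map_poly to_ac (map_poly of_ac r)) i"
        by (simp add: coeff_map_poly to_ac_of_ac)
    qed
    then show "\<exists>s. r = map_poly to_ac s" by blast
  qed (auto simp: coeff_map_poly)
  moreover have "map_poly to_ac s = 0 \<longleftrightarrow> s = 0" for s :: "'a poly"
    by (auto simp: poly_eq_iff coeff_map_poly)
  ultimately have "{J_op a \<circ> mult_op r | a r. r \<noteq> 0 \<and> a \<in> range to_ac \<and> range (coeff r) \<subseteq> range to_ac}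
      = {J_op (to_ac a) \<circ> mult_op (map_poly to_ac (r :: 'a poly)) | a r. r \<noteq> 0}"
    by auto (metis, metis rangeI)
  moreover have "(0 :: 'a alg_closure) \<in> range to_ac" by (rule zero_range_to_ac)
  ultimately show ?thesis
    using RB_param_affine_image[of "range (to_ac :: 'a \<Rightarrow> _)"]
    by (simp add: ind_rat_pts_def rat_pts_RB_ind rat_pts_affine)
qed

lemma J_op_unique:
  assumes "pderiv P = f" "poly P a = 0" shows "P = J_op a f"
proof -
  have "pderiv (P - J_op a f) = 0" using assms by (simp add: pderiv_diff pderiv_J_op)
  then obtain e where e: "P - J_op a f = [:e:]" using pderiv_iszero by blast
  have "e = 0" using arg_cong[OF e, of "\<lambda>p. poly p a"] assms by (simp add: poly_J_op)
  then show ?thesis using e by simp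
qed

lemma RB_ops_rota_baxter:
  assumes "R \<in> RB_ops"
  shows "inj R" "R (f + g) = R f + R g" "R (smult c f) = smult c (R f)"
    "R f * R g = R (R f * g + f * R g)"
proof -
  obtain a r where R: "R = J_op a \<circ> mult_op r" "r \<noteq> 0" using assms by (auto simp: RB_ops_def)
  show "inj R"
  proof (rule injI)
    fix x y assume "R x = R y"
    then have "pderiv (R x) = pderiv (R y)" by simp
    then show "x = y" using R by (simp add: mult_op_def pderiv_J_op)
  qed
  show "R (f + g) = R f + R g" "R (smult c f) = smult c (R f)"
    by (simp_all add: R mult_op_def distrib_left J_op_add J_op_smult)
  have "R f * R g = J_op a (r * (R f * g + f * R g))"
    by (rule J_op_unique) (simp_all add: R mult_op_def pderiv_mult pderiv_J_op poly_J_op algebra_simps)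
  then show "R f * R g = R (R f * g + f * R g)" by (simp add: R mult_op_def)
qed

end

theory Submission
  imports Defs "HOL-Library.Function_Algebras"
begin

text \<open>
  In the coordinates \<open>(a, r\<^sub>0, r\<^sub>1, \<dots>)\<close> of the operator \<open>J\<^sub>a \<circ> l\<^sub>r\<close>, where \<open>r = \<Sum>i. r\<^sub>i x\<^sup>i\<close>, the ind-variety
  of operators is \<open>\<A>\<^sup>1 \<times> (\<A>\<^sup>\<infinity> - {0})\<close>. The additive group of finitely supported sequences \<open>t\<close>, which is
  the limit of the vector groups \<open>\<A>\<^sup>n\<close>, acts by adding \<open>t\<^sub>j r\<^sub>0\<close> to \<open>r\<^sub>j\<^sub>+\<^sub>1\<close> and fixing \<open>a\<close> and \<open>r\<^sub>0\<close>.
  A translation of \<open>r\<close> by a non-zero vector independent of \<open>r\<close> would hit the excluded point \<open>r = 0\<close>; here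
  the vector is proportional to \<open>r\<^sub>0\<close>, so that \<open>r \<noteq> 0\<close> is preserved. Where \<open>r\<^sub>0 \<noteq> 0\<close>, the coefficients
  \<open>r\<^sub>1, r\<^sub>2, \<dots>\<close> can be moved to arbitrary values, and this is possible over the ground field as soon as
  the operators are defined over it. Hence \<open>(a, r\<^sub>0)\<close> is a quotient map from the open set \<open>r\<^sub>0 \<noteq> 0\<close> to the
  surface \<open>\<A>\<^sup>1 \<times> (\<A>\<^sup>1 - {0})\<close> whose fibres are the orbits (\<open>fibre_is_orbit\<close>).

  The rest is the verification that these spaces and maps are varieties and morphisms. It is
  reduced to statements on coordinate functions: a map into an affine space is a morphism if its
  coordinates are regular (\<open>morphism_into_affine\<close>), the product of spaces with functions is
  categorical (\<open>morphism_pair\<close>), and a space that is isomorphic to a finite union of principal open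
  subsets of an affine space is a variety (\<open>variety_coordinates\<close>). The group \<open>\<A>\<^sup>n\<close> is unipotent
  because the matrices that differ from the identity only in the first row, off the diagonal, multiply
  by adding these entries (\<open>closed_embedding_row_mat\<close>).

  The quotient has dimension two because a non-empty open subset of \<open>\<A>\<^sup>n\<close> with a point over the ground
  field has Krull dimension \<open>n\<close> (\<open>dimension_open_affine\<close>). For the upper bound, functions that
  separate the members of a chain of irreducible closed sets are algebraically independent
  (\<open>chain_functions_independent\<close>), while \<open>n + 1\<close> polynomials in \<open>n\<close> variables never are
  (\<open>polyfuns_algebraically_dependent\<close>).
\<close>

section \<open>Spaces with functions\<close>

text \<open>
  A sheaf of rings of functions in which a function can be inverted where it does not vanish. Each
  \<open>reg X U\<close> consists of functions on the whole type of points; the first condition, with its local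
  comparison on \<open>U\<close>, makes membership depend on the values on \<open>U\<close> alone if \<open>U\<close> is open.\<close>

definition space_with_functions :: "('p, 'a::field) fspace \<Rightarrow> bool" where
  "space_with_functions X \<longleftrightarrow> (\<forall>U. openin (tp X) U \<longrightarrow>
     reg X U = reg (sub X (pts X)) U \<and>
     (\<forall>c. (\<lambda>_. to_ac c) \<in> reg X U) \<and>
     (\<forall>f\<in>reg X U. \<forall>g\<in>reg X U. (\<lambda>x. f x + g x) \<in> reg X U \<and> (\<lambda>x. f x * g x) \<in> reg X U) \<and>
     (\<forall>f\<in>reg X U. openin (tp X) {x \<in> U. f x \<noteq> 0} \<and> (\<lambda>x. inverse (f x)) \<in> reg X {x \<in> U. f x \<noteq> 0}))"

lemma openin_sub: "openin (tp (sub X S)) U \<longleftrightarrow> (\<exists>T. openin (tp X) T \<and> U = T \<inter> S)"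
  by (simp add: sub_def openin_subtopology)

lemma mem_reg_sub:
  "f \<in> reg (sub X S) U \<longleftrightarrow> (\<forall>x\<in>U. \<exists>W g. openin (tp X) W \<and> x \<in> W \<and> g \<in> reg X W \<and> (\<forall>y\<in>W \<inter> U. f y = g y))"
  by (simp add: sub_def)

lemma reg_subE:
  assumes "f \<in> reg (sub X S) U" "x \<in> U"
  obtains W g where "openin (tp X) W" "x \<in> W" "g \<in> reg X W" "\<And>y. y \<in> W \<inter> U \<Longrightarrow> f y = g y"
  using bspec[OF assms(1)[unfolded mem_reg_sub] assms(2)] by blast

lemma mem_reg_iff:
  assumes "space_with_functions X" "openin (tp X) U"
  shows "f \<in> reg X U \<longleftrightarrow> (\<forall>x\<in>U. \<exists>W g. openin (tp X) W \<and> x \<in> W \<and> g \<in> reg X W \<and> (\<forall>y\<in>W \<inter> U. f y = g y))"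
proof -
  have "reg X U = reg (sub X (pts X)) U" using assms unfolding space_with_functions_def by blast
  then have "f \<in> reg X U \<longleftrightarrow> f \<in> reg (sub X (pts X)) U" by (rule arg_cong)
  also note mem_reg_sub
  finally show ?thesis .
qed

lemma reg_restrict:
  assumes "space_with_functions X" "openin (tp X) U" "openin (tp X) V" "V \<subseteq> U" "f \<in> reg X U"
  shows "f \<in> reg X V"
  unfolding mem_reg_iff[OF assms(1,3)] using assms by blast

lemma reg_cong:
  assumes "space_with_functions X" "openin (tp X) U" "f \<in> reg X U" "\<And>x. x \<in> U \<Longrightarrow> f x = g x"
  shows "g \<in> reg X U"
  unfolding mem_reg_iff[OF assms(1,2)] using assms by (metis IntD2)

context
  fixes X :: "('p, 'a::field) fspace" and U :: "'p set"
  assumes X: "space_with_functions X" and U: "openin (tp X) U"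
begin

lemma reg_const: "(\<lambda>_. to_ac c) \<in> reg X U"
  using X U unfolding space_with_functions_def by blast

lemma reg_0: "(\<lambda>_. 0) \<in> reg X U" and reg_1: "(\<lambda>_. 1) \<in> reg X U"
  using reg_const[of 0] reg_const[of 1] by simp_all

lemma reg_add: "f \<in> reg X U \<Longrightarrow> g \<in> reg X U \<Longrightarrow> (\<lambda>x. f x + g x) \<in> reg X U"
  and reg_mult: "f \<in> reg X U \<Longrightarrow> g \<in> reg X U \<Longrightarrow> (\<lambda>x. f x * g x) \<in> reg X U"
  and openin_nonzero: "f \<in> reg X U \<Longrightarrow> openin (tp X) {x \<in> U. f x \<noteq> 0}"
  and reg_inverse: "f \<in> reg X U \<Longrightarrow> (\<lambda>x. inverse (f x)) \<in> reg X {x \<in> U. f x \<noteq> 0}"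
  using X U unfolding space_with_functions_def by blast+

lemma reg_uminus: "f \<in> reg X U \<Longrightarrow> (\<lambda>x. - f x) \<in> reg X U"
  using reg_mult[OF reg_const[of "-1"], of f] by simp

lemma reg_diff: "f \<in> reg X U \<Longrightarrow> g \<in> reg X U \<Longrightarrow> (\<lambda>x. f x - g x) \<in> reg X U"
  using reg_add[OF _ reg_uminus, of f g] by simp

lemma reg_sum: "(\<And>i. i \<in> I \<Longrightarrow> f i \<in> reg X U) \<Longrightarrow> (\<lambda>x. \<Sum>i\<in>I. f i x) \<in> reg X U"
  by (induction I rule: infinite_finite_induct) (simp_all add: reg_0 reg_add)

lemma reg_polyfuns:
  assumes "p \<in> polyfuns n" "\<And>i. i < n \<Longrightarrow> (\<lambda>x. \<phi> x i) \<in> reg X U"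
  shows "(\<lambda>x. p (\<phi> x)) \<in> reg X U"
  using assms(1) by induction (simp_all add: reg_const reg_add reg_mult assms(2))

end

lemma closedin_zeros:
  assumes "space_with_functions X" "f \<in> reg X (pts X)"
  shows "closedin (tp X) {x \<in> pts X. f x = 0}"
proof -
  have "pts X - {x \<in> pts X. f x = 0} = {x \<in> pts X. f x \<noteq> 0}" by auto
  then show ?thesis
    using openin_nonzero[OF assms(1) openin_topspace assms(2)] by (auto simp: closedin_def)
qed

lemma closedin_equalizer:
  fixes n :: nat
  assumes X: "space_with_functions X"
    and "\<And>i. i < n \<Longrightarrow> (\<lambda>x. \<phi> x i) \<in> reg X (pts X)" "\<And>i. i < n \<Longrightarrow> (\<lambda>x. \<psi> x i) \<in> reg X (pts X)"
  shows "closedin (tp X) {x \<in> pts X. \<forall>i<n. \<phi> x i = \<psi> x i}"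
proof -
  have "closedin (tp X) {x \<in> pts X. \<phi> x i - \<psi> x i = 0}" if "i < n" for i
    using assms that by (intro closedin_zeros reg_diff) auto
  then have "closedin (tp X) (topspace (tp X) \<inter> (\<Inter>i\<in>{..<n}. {x \<in> pts X. \<phi> x i - \<psi> x i = 0}))"
    by (cases "n = 0") (auto intro!: closedin_Int closedin_INT)
  also have "topspace (tp X) \<inter> (\<Inter>i\<in>{..<n}. {x \<in> pts X. \<phi> x i - \<psi> x i = 0}) = {x \<in> pts X. \<forall>i<n. \<phi> x i = \<psi> x i}"
    by auto
  finally show ?thesis .
qed

lemma space_with_functionsI:
  assumes loc: "\<And>U f. openin (tp X) U \<Longrightarrow>
      (\<And>x. x \<in> U \<Longrightarrow> \<exists>W g. openin (tp X) W \<and> x \<in> W \<and> g \<in> reg X W \<and> (\<forall>y\<in>W \<inter> U. f y = g y)) \<Longrightarrow> f \<in> reg X U"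
    and const: "\<And>U c. openin (tp X) U \<Longrightarrow> (\<lambda>_. to_ac c) \<in> reg X U"
    and add: "\<And>U f g. openin (tp X) U \<Longrightarrow> f \<in> reg X U \<Longrightarrow> g \<in> reg X U \<Longrightarrow> (\<lambda>x. f x + g x) \<in> reg X U"
    and mult: "\<And>U f g. openin (tp X) U \<Longrightarrow> f \<in> reg X U \<Longrightarrow> g \<in> reg X U \<Longrightarrow> (\<lambda>x. f x * g x) \<in> reg X U"
    and nz: "\<And>U f. openin (tp X) U \<Longrightarrow> f \<in> reg X U \<Longrightarrow> openin (tp X) {x \<in> U. f x \<noteq> 0}"
    and inv: "\<And>U f. openin (tp X) U \<Longrightarrow> f \<in> reg X U \<Longrightarrow> (\<lambda>x. inverse (f x)) \<in> reg X {x \<in> U. f x \<noteq> 0}"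
  shows "space_with_functions X"
proof -
  have "reg X U = reg (sub X (pts X)) U" if U: "openin (tp X) U" for U
  proof (intro equalityI subsetI)
    fix f assume f: "f \<in> reg X U"
    show "f \<in> reg (sub X (pts X)) U" unfolding mem_reg_sub
    proof
      fix x assume "x \<in> U"
      then show "\<exists>W g. openin (tp X) W \<and> x \<in> W \<and> g \<in> reg X W \<and> (\<forall>y\<in>W \<inter> U. f y = g y)"
        using U f by (intro exI[of _ U] exI[of _ f]) simp
    qed
  next
    fix f assume "f \<in> reg (sub X (pts X)) U"
    then show "f \<in> reg X U" by (intro loc[OF U]) (simp add: mem_reg_sub)
  qed
  then show ?thesis unfolding space_with_functions_def
    by (intro allI impI conjI ballI const add mult nz inv)
qed

lemma space_with_functions_sub:
  assumes X: "space_with_functions X"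
  shows "space_with_functions (sub X S)"
proof (rule space_with_functionsI)
  fix U f assume U: "openin (tp (sub X S)) U"
    and *: "\<And>x. x \<in> U \<Longrightarrow> \<exists>W g. openin (tp (sub X S)) W \<and> x \<in> W \<and> g \<in> reg (sub X S) W \<and> (\<forall>y\<in>W \<inter> U. f y = g y)"
  show "f \<in> reg (sub X S) U" unfolding mem_reg_sub
  proof
    fix x assume x: "x \<in> U"
    then obtain W g where W: "openin (tp (sub X S)) W" "x \<in> W" "g \<in> reg (sub X S) W" "\<forall>y\<in>W \<inter> U. f y = g y"
      using * by blast
    then obtain W1 where W1: "openin (tp X) W1" "W = W1 \<inter> S" by (auto simp: openin_sub)
    obtain W2 g2 where W2: "openin (tp X) W2" "x \<in> W2" "g2 \<in> reg X W2" "\<forall>y\<in>W2 \<inter> W. g y = g2 y"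
      using W(2,3) unfolding mem_reg_sub by blast
    have US: "U \<subseteq> S" using U by (auto simp: openin_sub)
    have "\<forall>y\<in>(W1 \<inter> W2) \<inter> U. f y = g2 y" using W(4) W2(4) W1(2) US by auto
    moreover have "g2 \<in> reg X (W1 \<inter> W2)"
      by (rule reg_restrict[OF X W2(1)]) (use W1 W2 in auto)
    ultimately show "\<exists>W g. openin (tp X) W \<and> x \<in> W \<and> g \<in> reg X W \<and> (\<forall>y\<in>W \<inter> U. f y = g y)"
      using W1 W2 W(2) by (intro exI[of _ "W1 \<inter> W2"] exI[of _ g2]) auto
  qed
next
  fix U c assume U: "openin (tp (sub X S)) U"
  then obtain T where "openin (tp X) T" "U = T \<inter> S" by (auto simp: openin_sub)
  then show "(\<lambda>_. to_ac c) \<in> reg (sub X S) U"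
    unfolding mem_reg_sub using reg_const[OF X, of T c]
    by (intro ballI exI[of _ T] exI[of _ "\<lambda>_. to_ac c"]) simp
next
  fix U f g assume U: "openin (tp (sub X S)) U" and f: "f \<in> reg (sub X S) U" and g: "g \<in> reg (sub X S) U"
  have *: "\<exists>W f' g'. openin (tp X) W \<and> x \<in> W \<and> f' \<in> reg X W \<and> g' \<in> reg X W \<and>
      (\<forall>y\<in>W \<inter> U. f y = f' y \<and> g y = g' y)" if "x \<in> U" for x
  proof -
    obtain W1 f1 where 1: "openin (tp X) W1" "x \<in> W1" "f1 \<in> reg X W1" "\<And>y. y \<in> W1 \<inter> U \<Longrightarrow> f y = f1 y"
      using reg_subE[OF f \<open>x \<in> U\<close>] by blast
    obtain W2 f2 where 2: "openin (tp X) W2" "x \<in> W2" "f2 \<in> reg X W2" "\<And>y. y \<in> W2 \<inter> U \<Longrightarrow> g y = f2 y"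
      using reg_subE[OF g \<open>x \<in> U\<close>] by blast
    have "f1 \<in> reg X (W1 \<inter> W2)" by (rule reg_restrict[OF X 1(1)]) (use 1 2 in auto)
    moreover have "f2 \<in> reg X (W1 \<inter> W2)" by (rule reg_restrict[OF X 2(1)]) (use 1 2 in auto)
    ultimately show ?thesis using 1 2
      by - (rule exI[of _ "W1 \<inter> W2"], rule exI[of _ f1], rule exI[of _ f2], auto)
  qed
  show "(\<lambda>x. f x + g x) \<in> reg (sub X S) U" unfolding mem_reg_sub
  proof
    fix x assume "x \<in> U"
    from *[OF this] obtain W f' g' where W: "openin (tp X) W" "x \<in> W" "f' \<in> reg X W" "g' \<in> reg X W"
      "\<forall>y\<in>W \<inter> U. f y = f' y \<and> g y = g' y" by blast
    then show "\<exists>W h. openin (tp X) W \<and> x \<in> W \<and> h \<in> reg X W \<and> (\<forall>y\<in>W \<inter> U. f y + g y = h y)"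
      by (intro exI[of _ W] exI[of _ "\<lambda>x. f' x + g' x"]) (simp add: reg_add[OF X])
  qed
  show "(\<lambda>x. f x * g x) \<in> reg (sub X S) U" unfolding mem_reg_sub
  proof
    fix x assume "x \<in> U"
    from *[OF this] obtain W f' g' where W: "openin (tp X) W" "x \<in> W" "f' \<in> reg X W" "g' \<in> reg X W"
      "\<forall>y\<in>W \<inter> U. f y = f' y \<and> g y = g' y" by blast
    then show "\<exists>W h. openin (tp X) W \<and> x \<in> W \<and> h \<in> reg X W \<and> (\<forall>y\<in>W \<inter> U. f y * g y = h y)"
      by (intro exI[of _ W] exI[of _ "\<lambda>x. f' x * g' x"]) (simp add: reg_mult[OF X])
  qed
next
  fix U f assume U: "openin (tp (sub X S)) U" and f: "f \<in> reg (sub X S) U"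
  have *: "\<exists>W g. openin (tp X) W \<and> x \<in> W \<and> g \<in> reg X W \<and> (\<forall>y\<in>W \<inter> U. f y = g y)" if "x \<in> U" for x
    using f that unfolding mem_reg_sub by blast
  show "openin (tp (sub X S)) {x \<in> U. f x \<noteq> 0}"
  proof (subst openin_subopen, intro ballI)
    fix x assume x: "x \<in> {x \<in> U. f x \<noteq> 0}"
    then obtain W g where W: "openin (tp X) W" "x \<in> W" "g \<in> reg X W" "\<forall>y\<in>W \<inter> U. f y = g y" using * by blast
    obtain T where T: "openin (tp X) T" "U = T \<inter> S" using U by (auto simp: openin_sub)
    have "openin (tp X) ({x \<in> W. g x \<noteq> 0} \<inter> T)"
      using openin_nonzero[OF X W(1,3)] T(1) by blast
    then have "openin (tp (sub X S)) ({x \<in> W. g x \<noteq> 0} \<inter> T \<inter> S)" by (auto simp: openin_sub)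
    then show "\<exists>T. openin (tp (sub X S)) T \<and> x \<in> T \<and> T \<subseteq> {x \<in> U. f x \<noteq> 0}"
      using x W T by (intro exI[of _ "{x \<in> W. g x \<noteq> 0} \<inter> T \<inter> S"]) auto
  qed
  show "(\<lambda>x. inverse (f x)) \<in> reg (sub X S) {x \<in> U. f x \<noteq> 0}" unfolding mem_reg_sub
  proof
    fix x assume x: "x \<in> {x \<in> U. f x \<noteq> 0}"
    then obtain W g where W: "openin (tp X) W" "x \<in> W" "g \<in> reg X W" "\<forall>y\<in>W \<inter> U. f y = g y" using * by blast
    show "\<exists>W g. openin (tp X) W \<and> x \<in> W \<and> g \<in> reg X W \<and> (\<forall>y\<in>W \<inter> {x \<in> U. f x \<noteq> 0}. inverse (f y) = g y)"
      using openin_nonzero[OF X W(1,3)] reg_inverse[OF X W(1,3)] x W(2,4)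
      by (intro exI[of _ "{x \<in> W. g x \<noteq> 0}"] exI[of _ "\<lambda>x. inverse (g x)"]) auto
  qed
qed

lemma reg_transport: "f \<in> reg (transport h X) U \<longleftrightarrow> f \<circ> h \<in> reg X {x \<in> pts X. h x \<in> U}"
  by (simp add: transport_def)

lemma space_with_functions_transport:
  assumes X: "space_with_functions X" and inj: "inj_on h (pts X)"
  shows "space_with_functions (transport h X)"
proof (rule space_with_functionsI)
  note op = openin_transport[OF inj]
  have opI: "openin (tp (transport h X)) (h ` W)" if "openin (tp X) W" for W
  proof -
    have "W \<subseteq> pts X" using that openin_subset by blast
    moreover from this have "{x \<in> pts X. h x \<in> h ` W} = W" using inj by (auto simp: inj_on_def)
    ultimately show ?thesis using that by (auto simp: op)
  qed
  {
    fix U f assume U: "openin (tp (transport h X)) U"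
      and *: "\<And>x. x \<in> U \<Longrightarrow> \<exists>W g. openin (tp (transport h X)) W \<and> x \<in> W \<and> g \<in> reg (transport h X) W \<and> (\<forall>y\<in>W \<inter> U. f y = g y)"
    have U': "openin (tp X) {x \<in> pts X. h x \<in> U}" using U by (simp add: op)
    show "f \<in> reg (transport h X) U" unfolding reg_transport mem_reg_iff[OF X U']
    proof
      fix x assume "x \<in> {x \<in> pts X. h x \<in> U}"
      moreover from this obtain W g where "openin (tp (transport h X)) W" "h x \<in> W" "g \<in> reg (transport h X) W" "\<forall>y\<in>W \<inter> U. f y = g y"
        using *[of "h x"] by auto
      ultimately show "\<exists>W g. openin (tp X) W \<and> x \<in> W \<and> g \<in> reg X W \<and>
           (\<forall>y\<in>W \<inter> {x \<in> pts X. h x \<in> U}. (f \<circ> h) y = g y)"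
        by (intro exI[of _ "{x \<in> pts X. h x \<in> W}"] exI[of _ "g \<circ> h"]) (auto simp: op reg_transport)
    qed
  next
    fix U c assume "openin (tp (transport h X)) U"
    then show "(\<lambda>_. to_ac c) \<in> reg (transport h X) U"
      using reg_const[OF X] by (simp add: op reg_transport comp_def)
  next
    fix U f g assume "openin (tp (transport h X)) U" "f \<in> reg (transport h X) U" "g \<in> reg (transport h X) U"
    then show "(\<lambda>x. f x + g x) \<in> reg (transport h X) U" "(\<lambda>x. f x * g x) \<in> reg (transport h X) U"
      using reg_add[OF X] reg_mult[OF X] by (simp_all add: op reg_transport comp_def)
  next
    fix U f assume *: "openin (tp (transport h X)) U" "f \<in> reg (transport h X) U"
    have eq: "{x \<in> pts X. h x \<in> U \<and> f (h x) \<noteq> 0} = {x \<in> {x \<in> pts X. h x \<in> U}. (f \<circ> h) x \<noteq> 0}" by auto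
    show "openin (tp (transport h X)) {x \<in> U. f x \<noteq> 0}"
      using * openin_nonzero[OF X, of "{x \<in> pts X. h x \<in> U}" "f \<circ> h"] unfolding op reg_transport mem_Collect_eq eq by blast
    show "(\<lambda>x. inverse (f x)) \<in> reg (transport h X) {x \<in> U. f x \<noteq> 0}"
      using * reg_inverse[OF X, of "{x \<in> pts X. h x \<in> U}" "f \<circ> h"] unfolding op reg_transport mem_Collect_eq eq by (simp only: comp_def)
  }
qed

section \<open>Morphisms\<close>

lemma morphismI:
  assumes "\<And>x. x \<in> pts X \<Longrightarrow> \<phi> x \<in> pts Y"
    and "\<And>V. openin (tp Y) V \<Longrightarrow> openin (tp X) {x \<in> pts X. \<phi> x \<in> V}"
    and "\<And>V f. openin (tp Y) V \<Longrightarrow> f \<in> reg Y V \<Longrightarrow> f \<circ> \<phi> \<in> reg X {x \<in> pts X. \<phi> x \<in> V}"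
  shows "morphism X Y \<phi>"
  using assms by (auto simp: morphism_def continuous_map_def)

lemma morphismD:
  assumes "morphism X Y \<phi>"
  shows "x \<in> pts X \<Longrightarrow> \<phi> x \<in> pts Y"
    and "openin (tp Y) V \<Longrightarrow> openin (tp X) {x \<in> pts X. \<phi> x \<in> V}"
    and "openin (tp Y) V \<Longrightarrow> f \<in> reg Y V \<Longrightarrow> f \<circ> \<phi> \<in> reg X {x \<in> pts X. \<phi> x \<in> V}"
  using assms by (auto simp: morphism_def continuous_map_def)

lemma morphism_pullback:
  assumes "morphism X Y \<phi>" "f \<in> reg Y (pts Y)"
  shows "(\<lambda>x. f (\<phi> x)) \<in> reg X (pts X)"
proof -
  have "{x \<in> pts X. \<phi> x \<in> pts Y} = pts X" using morphismD(1)[OF assms(1)] by auto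
  then show ?thesis using morphismD(3)[OF assms(1) openin_topspace assms(2)] by (simp add: comp_def)
qed

lemma morphism_comp:
  assumes \<phi>: "morphism X Y \<phi>" and \<psi>: "morphism Y Z \<psi>"
  shows "morphism X Z (\<psi> \<circ> \<phi>)"
proof -
  have eq: "{x \<in> pts X. \<phi> x \<in> {y \<in> pts Y. \<psi> y \<in> V}} = {x \<in> pts X. (\<psi> \<circ> \<phi>) x \<in> V}" for V
    using morphismD(1)[OF \<phi>] by auto
  show ?thesis
  proof (rule morphismI)
    show "(\<psi> \<circ> \<phi>) x \<in> pts Z" if "x \<in> pts X" for x using morphismD(1)[OF \<phi>] morphismD(1)[OF \<psi>] that by simp
    show "openin (tp X) {x \<in> pts X. (\<psi> \<circ> \<phi>) x \<in> V}" if "openin (tp Z) V" for V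
      using morphismD(2)[OF \<phi> morphismD(2)[OF \<psi> that]] by (simp only: eq)
    show "f \<circ> (\<psi> \<circ> \<phi>) \<in> reg X {x \<in> pts X. (\<psi> \<circ> \<phi>) x \<in> V}" if "openin (tp Z) V" "f \<in> reg Z V" for V f
      using morphismD(3)[OF \<phi> morphismD(2)[OF \<psi> that(1)] morphismD(3)[OF \<psi> that]] by (simp only: eq o_assoc)
  qed
qed

lemma morphism_cong:
  assumes X: "space_with_functions X" and \<phi>: "morphism X Y \<phi>" and eq: "\<And>x. x \<in> pts X \<Longrightarrow> \<phi> x = \<psi> x"
  shows "morphism X Y \<psi>"
proof -
  have eq': "{x \<in> pts X. \<psi> x \<in> V} = {x \<in> pts X. \<phi> x \<in> V}" for V using eq by auto
  show ?thesis
  proof (rule morphismI)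
    show "\<psi> x \<in> pts Y" if "x \<in> pts X" for x using morphismD(1)[OF \<phi> that] eq[OF that] by simp
    show op: "openin (tp X) {x \<in> pts X. \<psi> x \<in> V}" if "openin (tp Y) V" for V
      using morphismD(2)[OF \<phi> that] by (simp only: eq')
    show "f \<circ> \<psi> \<in> reg X {x \<in> pts X. \<psi> x \<in> V}" if "openin (tp Y) V" "f \<in> reg Y V" for V f
      unfolding eq' by (rule reg_cong[OF X morphismD(2)[OF \<phi> that(1)] morphismD(3)[OF \<phi> that]]) (simp add: eq)
  qed
qed

text \<open>
  Regular functions on a subspace extend locally to the ambient space, and being regular on the
  source is a local condition.\<close>

lemma morphism_into_sub:
  assumes X: "space_with_functions X" and \<phi>: "morphism X Y \<phi>" and "\<And>x. x \<in> pts X \<Longrightarrow> \<phi> x \<in> S"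
  shows "morphism X (sub Y S) \<phi>"
proof (rule morphismI)
  show "\<phi> x \<in> pts (sub Y S)" if "x \<in> pts X" for x using morphismD(1)[OF \<phi> that] assms(3)[OF that] by simp
  have eq: "{x \<in> pts X. \<phi> x \<in> T \<and> \<phi> x \<in> S} = {x \<in> pts X. \<phi> x \<in> T}" for T using assms(3) by auto
  show op: "openin (tp X) {x \<in> pts X. \<phi> x \<in> V}" if "openin (tp (sub Y S)) V" for V
    using that morphismD(2)[OF \<phi>] by (auto simp: openin_sub eq)
  fix V f assume V: "openin (tp (sub Y S)) V" and f: "f \<in> reg (sub Y S) V"
  show "f \<circ> \<phi> \<in> reg X {x \<in> pts X. \<phi> x \<in> V}" unfolding mem_reg_iff[OF X op[OF V]]
  proof
    fix x assume "x \<in> {x \<in> pts X. \<phi> x \<in> V}"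
    moreover from this obtain W g where "openin (tp Y) W" "\<phi> x \<in> W" "g \<in> reg Y W" "\<forall>y\<in>W \<inter> V. f y = g y"
      using f unfolding mem_reg_sub by blast
    ultimately show "\<exists>W g. openin (tp X) W \<and> x \<in> W \<and> g \<in> reg X W \<and>
           (\<forall>y\<in>W \<inter> {x \<in> pts X. \<phi> x \<in> V}. (f \<circ> \<phi>) y = g y)"
      using morphismD(2,3)[OF \<phi>]
      by (intro exI[of _ "{x \<in> pts X. \<phi> x \<in> W}"] exI[of _ "g \<circ> \<phi>"]) auto
  qed
qed

lemma morphism_inclusion: "space_with_functions X \<Longrightarrow> morphism (sub X S) X (\<lambda>x. x)"
proof (rule morphismI)
  assume X: "space_with_functions X"
  fix V assume V: "openin (tp X) V"
  then have eq: "{x \<in> pts (sub X S). x \<in> V} = V \<inter> S" using openin_subset[OF V] by auto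
  show "openin (tp (sub X S)) {x \<in> pts (sub X S). x \<in> V}" unfolding eq using V by (auto simp: openin_sub)
  fix f assume "f \<in> reg X V"
  then show "f \<circ> (\<lambda>x. x) \<in> reg (sub X S) {x \<in> pts (sub X S). x \<in> V}"
    unfolding eq mem_reg_sub using V by (intro ballI exI[of _ V] exI[of _ f]) simp
qed simp

lemma morphism_from_sub:
  "space_with_functions X \<Longrightarrow> morphism X Y \<phi> \<Longrightarrow> morphism (sub X S) Y \<phi>"
  using morphism_comp[OF morphism_inclusion] by (fastforce simp: comp_def)

lemma morphism_id: "space_with_functions X \<Longrightarrow> morphism X X (\<lambda>x. x)"
proof (rule morphismI)
  fix V f assume V: "openin (tp X) V"
  then have eq: "{x \<in> pts X. x \<in> V} = V" using openin_subset by blast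
  show "openin (tp X) {x \<in> pts X. x \<in> V}" using V by (simp add: eq)
  assume "f \<in> reg X V"
  then show "f \<circ> (\<lambda>x. x) \<in> reg X {x \<in> pts X. x \<in> V}" by (simp add: eq comp_def)
qed

lemma isomorphismI:
  assumes "morphism X Y \<phi>" "morphism Y X \<psi>"
    "\<And>x. x \<in> pts X \<Longrightarrow> \<psi> (\<phi> x) = x" "\<And>y. y \<in> pts Y \<Longrightarrow> \<phi> (\<psi> y) = y"
  shows "isomorphism X Y \<phi>"
  using assms unfolding isomorphism_def by blast

lemma transport_morphisms:
  assumes X: "space_with_functions X" and inj: "inj_on h (pts X)"
  shows "morphism X (transport h X) h" "morphism (transport h X) X (inv_into (pts X) h)"
proof -
  show "morphism X (transport h X) h"
    by (rule morphismI) (auto simp: openin_transport[OF inj] reg_transport)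
  show "morphism (transport h X) X (inv_into (pts X) h)"
  proof (rule morphismI)
    show "inv_into (pts X) h x \<in> pts X" if "x \<in> pts (transport h X)" for x
      using that by (auto simp: inv_into_f_f[OF inj])
    fix V f assume V: "openin (tp X) V"
    have eq: "{x \<in> pts X. h x \<in> pts (transport h X) \<and> inv_into (pts X) h (h x) \<in> V} = V"
      using openin_subset[OF V] inv_into_f_f[OF inj] by (auto dest: inj_onD[OF inj])
    show "openin (tp (transport h X)) {x \<in> pts (transport h X). inv_into (pts X) h x \<in> V}"
      using V eq by (auto simp: openin_transport[OF inj])
    assume f: "f \<in> reg X V"
    have "f \<circ> inv_into (pts X) h \<circ> h \<in> reg X V"
      using openin_subset[OF V] by (intro reg_cong[OF X V f]) (auto simp: inv_into_f_f[OF inj])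
    then show "f \<circ> inv_into (pts X) h \<in> reg (transport h X) {x \<in> pts (transport h X). inv_into (pts X) h x \<in> V}"
      unfolding reg_transport using eq by simp
  qed
qed

section \<open>Functions that are local quotients\<close>

text \<open>
  The common pattern of affine spaces and products: over each patch \<open>D i\<close> there is a ring \<open>A i\<close> of
  functions; the non-vanishing loci of these functions form a basis of the topology, and regular
  functions are local quotients of them. An affine space has one patch, with the polynomial
  functions on it; the patches of a product are the sets \<open>U \<times> V\<close>, with the tensors on them. The
  last assumption allows descriptions over two patches to be compared near a common point.\<close>

locale quotient_functions =
  fixes X :: "('p, 'a::field) fspace" and I :: "'i set" and D :: "'i \<Rightarrow> 'p set"
    and A :: "'i \<Rightarrow> ('p \<Rightarrow> 'a alg_closure) set"
  assumes tp: "tp X = topology_generated_by {{z \<in> D i. h z \<noteq> 0} | i h. i \<in> I \<and> h \<in> A i}"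
    and reg: "openin (tp X) W \<Longrightarrow> f \<in> reg X W \<longleftrightarrow> (\<forall>z\<in>W. \<exists>i\<in>I. \<exists>p\<in>A i. \<exists>q\<in>A i. z \<in> D i \<and> q z \<noteq> 0 \<and>
           (\<forall>y\<in>W \<inter> D i. q y \<noteq> 0 \<longrightarrow> f y = p y / q y))"
    and const: "i \<in> I \<Longrightarrow> (\<lambda>_. to_ac c) \<in> A i"
    and add: "i \<in> I \<Longrightarrow> p \<in> A i \<Longrightarrow> q \<in> A i \<Longrightarrow> (\<lambda>z. p z + q z) \<in> A i"
    and mult: "i \<in> I \<Longrightarrow> p \<in> A i \<Longrightarrow> q \<in> A i \<Longrightarrow> (\<lambda>z. p z * q z) \<in> A i"
    and refine: "i \<in> I \<Longrightarrow> j \<in> I \<Longrightarrow> \<exists>k\<in>I. D k = D i \<inter> D j \<and> A i \<subseteq> A k \<and> A j \<subseteq> A k"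
begin

lemma openin_basic: "i \<in> I \<Longrightarrow> h \<in> A i \<Longrightarrow> openin (tp X) {z \<in> D i. h z \<noteq> 0}"
  unfolding tp by (rule topology_generated_by_Basis) blast

lemma openin_patch: "i \<in> I \<Longrightarrow> openin (tp X) (D i)"
  using openin_basic[of i, OF _ const[of i 1]] by simp

lemma basic_nbhdE:
  assumes "openin (tp X) U" "z \<in> U"
  obtains i h where "i \<in> I" "h \<in> A i" "z \<in> D i" "h z \<noteq> 0" "\<And>y. y \<in> D i \<Longrightarrow> h y \<noteq> 0 \<Longrightarrow> y \<in> U"
proof -
  have "generate_topology_on {{z \<in> D i. h z \<noteq> 0} | i h. i \<in> I \<and> h \<in> A i} U"
    using assms(1) unfolding tp by (rule openin_topology_generated_by)
  then have "\<forall>z\<in>U. \<exists>i\<in>I. \<exists>h\<in>A i. z \<in> D i \<and> h z \<noteq> 0 \<and> {y \<in> D i. h y \<noteq> 0} \<subseteq> U"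
  proof induction
    case (Int a b)
    show ?case
    proof
      fix z assume "z \<in> a \<inter> b"
      then have z: "z \<in> a" "z \<in> b" by blast+
      from bspec[OF Int.IH(1) z(1)] obtain i h
        where 1: "i \<in> I" "h \<in> A i" "z \<in> D i" "h z \<noteq> 0" "{y \<in> D i. h y \<noteq> 0} \<subseteq> a" by blast
      from bspec[OF Int.IH(2) z(2)] obtain j g
        where 2: "j \<in> I" "g \<in> A j" "z \<in> D j" "g z \<noteq> 0" "{y \<in> D j. g y \<noteq> 0} \<subseteq> b" by blast
      obtain k where k: "k \<in> I" "D k = D i \<inter> D j" "A i \<subseteq> A k" "A j \<subseteq> A k"
        using refine[OF 1(1) 2(1)] by blast
      have "(\<lambda>z. h z * g z) \<in> A k" using k 1(2) 2(2) by (intro mult) auto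
      then show "\<exists>i\<in>I. \<exists>h\<in>A i. z \<in> D i \<and> h z \<noteq> 0 \<and> {y \<in> D i. h y \<noteq> 0} \<subseteq> a \<inter> b"
        using 1 2 k by (intro bexI[of _ k] bexI[of _ "\<lambda>z. h z * g z"]) auto
    qed
  next
    case (UN K)
    show ?case
    proof
      fix z assume "z \<in> \<Union>K"
      then obtain k where k: "k \<in> K" "z \<in> k" by blast
      from bspec[OF UN.IH[OF k(1)] k(2)] obtain i h where "i \<in> I" "h \<in> A i" "z \<in> D i" "h z \<noteq> 0" "{y \<in> D i. h y \<noteq> 0} \<subseteq> k" by blast
      then show "\<exists>i\<in>I. \<exists>h\<in>A i. z \<in> D i \<and> h z \<noteq> 0 \<and> {y \<in> D i. h y \<noteq> 0} \<subseteq> \<Union>K"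
        using \<open>k \<in> K\<close> by blast
    qed
  next
    case (Basis s)
    then obtain i h where "i \<in> I" "h \<in> A i" "s = {z \<in> D i. h z \<noteq> 0}" by blast
    then show ?case by blast
  qed simp
  from bspec[OF this assms(2)] obtain i h
    where "i \<in> I" "h \<in> A i" "z \<in> D i" "h z \<noteq> 0" "{y \<in> D i. h y \<noteq> 0} \<subseteq> U" by blast
  then show thesis by (intro that[of i h]) auto
qed

lemma reg_quotE:
  assumes "openin (tp X) W" "f \<in> reg X W" "z \<in> W"
  obtains i p q where "i \<in> I" "p \<in> A i" "q \<in> A i" "z \<in> D i" "q z \<noteq> 0"
    "\<And>y. y \<in> W \<Longrightarrow> y \<in> D i \<Longrightarrow> q y \<noteq> 0 \<Longrightarrow> f y = p y / q y"
  using bspec[OF assms(2)[unfolded reg[OF assms(1)]] assms(3)] by blast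

lemma reg_quotI:
  assumes "openin (tp X) W"
    and "\<And>z. z \<in> W \<Longrightarrow> \<exists>i p q. i \<in> I \<and> p \<in> A i \<and> q \<in> A i \<and> z \<in> D i \<and> q z \<noteq> 0 \<and>
           (\<forall>y. y \<in> W \<longrightarrow> y \<in> D i \<longrightarrow> q y \<noteq> 0 \<longrightarrow> f y = p y / q y)"
  shows "f \<in> reg X W"
  unfolding reg[OF assms(1)]
proof
  fix z assume "z \<in> W"
  from assms(2)[OF this] obtain i p q where "i \<in> I" "p \<in> A i" "q \<in> A i" "z \<in> D i" "q z \<noteq> 0"
    "\<forall>y. y \<in> W \<longrightarrow> y \<in> D i \<longrightarrow> q y \<noteq> 0 \<longrightarrow> f y = p y / q y" by blast
  then show "\<exists>i\<in>I. \<exists>p\<in>A i. \<exists>q\<in>A i. z \<in> D i \<and> q z \<noteq> 0 \<and> (\<forall>y\<in>W \<inter> D i. q y \<noteq> 0 \<longrightarrow> f y = p y / q y)"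
    by - (rule bexI[of _ i], rule bexI[of _ p], rule bexI[of _ q], auto)
qed

lemma reg_patch:
  assumes "i \<in> I" "h \<in> A i"
  shows "h \<in> reg X (D i)"
proof (rule reg_quotI[OF openin_patch[OF assms(1)]])
  fix z assume "z \<in> D i"
  then show "\<exists>j p q. j \<in> I \<and> p \<in> A j \<and> q \<in> A j \<and> z \<in> D j \<and> q z \<noteq> 0 \<and>
           (\<forall>y. y \<in> D i \<longrightarrow> y \<in> D j \<longrightarrow> q y \<noteq> 0 \<longrightarrow> h y = p y / q y)"
    using assms const[of i 1] by - (rule exI[of _ i], rule exI[of _ h], rule exI[of _ "\<lambda>_. 1"], simp)
qed

text \<open>
  Finitely many local descriptions near a point can be brought to a common patch and, by
  multiplication, to a common denominator.\<close>

lemma space_with_functions: "space_with_functions X"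
proof (rule space_with_functionsI)
  fix U f assume U: "openin (tp X) U"
    and *: "\<And>x. x \<in> U \<Longrightarrow> \<exists>W g. openin (tp X) W \<and> x \<in> W \<and> g \<in> reg X W \<and> (\<forall>y\<in>W \<inter> U. f y = g y)"
  show "f \<in> reg X U"
  proof (rule reg_quotI[OF U])
    fix z assume "z \<in> U"
    from *[OF this] obtain W g where W: "openin (tp X) W" "z \<in> W" "g \<in> reg X W" "\<forall>y\<in>W \<inter> U. f y = g y" by blast
    obtain i p q where 1: "i \<in> I" "p \<in> A i" "q \<in> A i" "z \<in> D i" "q z \<noteq> 0"
      "\<And>y. y \<in> W \<Longrightarrow> y \<in> D i \<Longrightarrow> q y \<noteq> 0 \<Longrightarrow> g y = p y / q y"
      using reg_quotE[OF W(1,3,2)] by blast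
    obtain j h where 2: "j \<in> I" "h \<in> A j" "z \<in> D j" "h z \<noteq> 0" "\<And>y. y \<in> D j \<Longrightarrow> h y \<noteq> 0 \<Longrightarrow> y \<in> W"
      using basic_nbhdE[OF W(1,2)] by blast
    obtain k where k: "k \<in> I" "D k = D i \<inter> D j" "A i \<subseteq> A k" "A j \<subseteq> A k" using refine[OF 1(1) 2(1)] by blast
    have m: "(\<lambda>z. p z * h z) \<in> A k" "(\<lambda>z. q z * h z) \<in> A k"
      using k 1 2 by (auto intro!: mult)
    show "\<exists>i p q. i \<in> I \<and> p \<in> A i \<and> q \<in> A i \<and> z \<in> D i \<and> q z \<noteq> 0 \<and>
           (\<forall>y. y \<in> U \<longrightarrow> y \<in> D i \<longrightarrow> q y \<noteq> 0 \<longrightarrow> f y = p y / q y)"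
      by (rule exI[of _ k], rule exI[of _ "\<lambda>z. p z * h z"], rule exI[of _ "\<lambda>z. q z * h z"])
        (use k m 1 2 W(4) in auto)
  qed
next
  fix U c assume U: "openin (tp X) U"
  show "(\<lambda>_. to_ac c) \<in> reg X U"
  proof (rule reg_quotI[OF U])
    fix z assume "z \<in> U"
    then obtain i h where "i \<in> I" "z \<in> D i" using basic_nbhdE[OF U] by blast
    then show "\<exists>i p q. i \<in> I \<and> p \<in> A i \<and> q \<in> A i \<and> z \<in> D i \<and> q z \<noteq> 0 \<and>
           (\<forall>y. y \<in> U \<longrightarrow> y \<in> D i \<longrightarrow> q y \<noteq> 0 \<longrightarrow> to_ac c = p y / q y)"
      using const[of i c] const[of i 1]
      by - (rule exI[of _ i], rule exI[of _ "\<lambda>_. to_ac c"], rule exI[of _ "\<lambda>_. 1"], simp)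
  qed
next
  fix U f g assume U: "openin (tp X) U" and f: "f \<in> reg X U" and g: "g \<in> reg X U"
  have *: "\<exists>k p q r s. k \<in> I \<and> p \<in> A k \<and> q \<in> A k \<and> r \<in> A k \<and> s \<in> A k \<and> z \<in> D k \<and> q z \<noteq> 0 \<and> s z \<noteq> 0 \<and>
      (\<forall>y. y \<in> U \<longrightarrow> y \<in> D k \<longrightarrow> (q y \<noteq> 0 \<longrightarrow> f y = p y / q y) \<and> (s y \<noteq> 0 \<longrightarrow> g y = r y / s y))" if "z \<in> U" for z
  proof -
    obtain i p q where 1: "i \<in> I" "p \<in> A i" "q \<in> A i" "z \<in> D i" "q z \<noteq> 0"
      "\<And>y. y \<in> U \<Longrightarrow> y \<in> D i \<Longrightarrow> q y \<noteq> 0 \<Longrightarrow> f y = p y / q y"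
      using reg_quotE[OF U f \<open>z \<in> U\<close>] by blast
    obtain j r s where 2: "j \<in> I" "r \<in> A j" "s \<in> A j" "z \<in> D j" "s z \<noteq> 0"
      "\<And>y. y \<in> U \<Longrightarrow> y \<in> D j \<Longrightarrow> s y \<noteq> 0 \<Longrightarrow> g y = r y / s y"
      using reg_quotE[OF U g \<open>z \<in> U\<close>] by blast
    obtain k where k: "k \<in> I" "D k = D i \<inter> D j" "A i \<subseteq> A k" "A j \<subseteq> A k" using refine[OF 1(1) 2(1)] by blast
    show ?thesis
      by (rule exI[of _ k], rule exI[of _ p], rule exI[of _ q], rule exI[of _ r], rule exI[of _ s])
        (use k 1 2 in auto)
  qed
  show "(\<lambda>x. f x + g x) \<in> reg X U"
  proof (rule reg_quotI[OF U])
    fix z assume "z \<in> U"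
    from *[OF this] obtain k p q r s where k: "k \<in> I" "p \<in> A k" "q \<in> A k" "r \<in> A k" "s \<in> A k" "z \<in> D k"
      "q z \<noteq> 0" "s z \<noteq> 0"
      "\<forall>y. y \<in> U \<longrightarrow> y \<in> D k \<longrightarrow> (q y \<noteq> 0 \<longrightarrow> f y = p y / q y) \<and> (s y \<noteq> 0 \<longrightarrow> g y = r y / s y)" by blast
    have m: "(\<lambda>z. p z * s z + r z * q z) \<in> A k" "(\<lambda>z. q z * s z) \<in> A k"
      using k by (auto intro!: mult add)
    show "\<exists>i p q. i \<in> I \<and> p \<in> A i \<and> q \<in> A i \<and> z \<in> D i \<and> q z \<noteq> 0 \<and>
           (\<forall>y. y \<in> U \<longrightarrow> y \<in> D i \<longrightarrow> q y \<noteq> 0 \<longrightarrow> f y + g y = p y / q y)"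
      by (rule exI[of _ k], rule exI[of _ "\<lambda>z. p z * s z + r z * q z"], rule exI[of _ "\<lambda>z. q z * s z"])
        (use k m in \<open>auto simp: add_frac_eq\<close>)
  qed
  show "(\<lambda>x. f x * g x) \<in> reg X U"
  proof (rule reg_quotI[OF U])
    fix z assume "z \<in> U"
    from *[OF this] obtain k p q r s where k: "k \<in> I" "p \<in> A k" "q \<in> A k" "r \<in> A k" "s \<in> A k" "z \<in> D k"
      "q z \<noteq> 0" "s z \<noteq> 0"
      "\<forall>y. y \<in> U \<longrightarrow> y \<in> D k \<longrightarrow> (q y \<noteq> 0 \<longrightarrow> f y = p y / q y) \<and> (s y \<noteq> 0 \<longrightarrow> g y = r y / s y)" by blast
    have m: "(\<lambda>z. p z * r z) \<in> A k" "(\<lambda>z. q z * s z) \<in> A k"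
      using k by (auto intro!: mult)
    show "\<exists>i p q. i \<in> I \<and> p \<in> A i \<and> q \<in> A i \<and> z \<in> D i \<and> q z \<noteq> 0 \<and>
           (\<forall>y. y \<in> U \<longrightarrow> y \<in> D i \<longrightarrow> q y \<noteq> 0 \<longrightarrow> f y * g y = p y / q y)"
      by (rule exI[of _ k], rule exI[of _ "\<lambda>z. p z * r z"], rule exI[of _ "\<lambda>z. q z * s z"])
        (use k m in auto)
  qed
next
  fix U f assume U: "openin (tp X) U" and f: "f \<in> reg X U"
  show op: "openin (tp X) {x \<in> U. f x \<noteq> 0}"
  proof (subst openin_subopen, intro ballI)
    fix z assume z: "z \<in> {x \<in> U. f x \<noteq> 0}"
    then have zU: "z \<in> U" by simp
    obtain i p q where 1: "i \<in> I" "p \<in> A i" "q \<in> A i" "z \<in> D i" "q z \<noteq> 0"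
      "\<And>y. y \<in> U \<Longrightarrow> y \<in> D i \<Longrightarrow> q y \<noteq> 0 \<Longrightarrow> f y = p y / q y"
      using reg_quotE[OF U f zU] by blast
    have "(\<lambda>z. p z * q z) \<in> A i" using 1 by (auto intro!: mult)
    then have "openin (tp X) ({z \<in> D i. p z * q z \<noteq> 0} \<inter> U)"
      using openin_basic 1 U by blast
    then show "\<exists>T. openin (tp X) T \<and> z \<in> T \<and> T \<subseteq> {x \<in> U. f x \<noteq> 0}"
      using 1 z by (intro exI[of _ "{z \<in> D i. p z * q z \<noteq> 0} \<inter> U"]) auto
  qed
  show "(\<lambda>x. inverse (f x)) \<in> reg X {x \<in> U. f x \<noteq> 0}"
  proof (rule reg_quotI[OF op])
    fix z assume z: "z \<in> {x \<in> U. f x \<noteq> 0}"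
    then have zU: "z \<in> U" by simp
    obtain i p q where 1: "i \<in> I" "p \<in> A i" "q \<in> A i" "z \<in> D i" "q z \<noteq> 0"
      "\<And>y. y \<in> U \<Longrightarrow> y \<in> D i \<Longrightarrow> q y \<noteq> 0 \<Longrightarrow> f y = p y / q y"
      using reg_quotE[OF U f zU] by blast
    \<comment> \<open>The quotient \<open>q / p\<close> does not suffice: where \<open>q\<close> vanishes, nothing is known about \<open>f\<close>. The denominator \<open>p q\<close> excludes these points.\<close>
    have m: "(\<lambda>z. q z * q z) \<in> A i" "(\<lambda>z. p z * q z) \<in> A i" using 1 by (auto intro!: mult)
    show "\<exists>i p q. i \<in> I \<and> p \<in> A i \<and> q \<in> A i \<and> z \<in> D i \<and> q z \<noteq> 0 \<and>
           (\<forall>y. y \<in> {x \<in> U. f x \<noteq> 0} \<longrightarrow> y \<in> D i \<longrightarrow> q y \<noteq> 0 \<longrightarrow> inverse (f y) = p y / q y)"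
      by (rule exI[of _ i], rule exI[of _ "\<lambda>z. q z * q z"], rule exI[of _ "\<lambda>z. p z * q z"])
        (use 1 m z in auto)
  qed
qed

text \<open>
  Quotients can be formed on the source of a map, hence only the functions on the patches have to
  be pulled back.\<close>

lemma morphism_into:
  assumes Z: "space_with_functions Z" and \<phi>: "\<And>z. z \<in> pts Z \<Longrightarrow> \<phi> z \<in> pts X"
    and patch: "\<And>i. i \<in> I \<Longrightarrow> openin (tp Z) {z \<in> pts Z. \<phi> z \<in> D i}"
    and pull: "\<And>i h. i \<in> I \<Longrightarrow> h \<in> A i \<Longrightarrow> (\<lambda>z. h (\<phi> z)) \<in> reg Z {z \<in> pts Z. \<phi> z \<in> D i}"
  shows "morphism Z X \<phi>"
proof (rule morphismI)
  show "\<phi> z \<in> pts X" if "z \<in> pts Z" for z using \<phi> that .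
  have nz: "openin (tp Z) {z \<in> {z \<in> pts Z. \<phi> z \<in> D i}. h (\<phi> z) \<noteq> 0}" if "i \<in> I" "h \<in> A i" for i h
    by (rule openin_nonzero[OF Z patch pull]) (use that in auto)
  show op: "openin (tp Z) {z \<in> pts Z. \<phi> z \<in> V}" if V: "openin (tp X) V" for V
  proof (subst openin_subopen, intro ballI)
    fix z assume z: "z \<in> {z \<in> pts Z. \<phi> z \<in> V}"
    then have "\<phi> z \<in> V" by simp
    then obtain i h where *: "i \<in> I" "h \<in> A i" "\<phi> z \<in> D i" "h (\<phi> z) \<noteq> 0" "\<And>y. y \<in> D i \<Longrightarrow> h y \<noteq> 0 \<Longrightarrow> y \<in> V"
      using basic_nbhdE[OF V] by blast
    then show "\<exists>T. openin (tp Z) T \<and> z \<in> T \<and> T \<subseteq> {z \<in> pts Z. \<phi> z \<in> V}"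
      using nz[OF *(1,2)] z by blast
  qed
  show "f \<circ> \<phi> \<in> reg Z {z \<in> pts Z. \<phi> z \<in> V}" if V: "openin (tp X) V" and f: "f \<in> reg X V" for V f
    unfolding mem_reg_iff[OF Z op[OF V]]
  proof
    fix z assume z: "z \<in> {z \<in> pts Z. \<phi> z \<in> V}"
    then have zV: "\<phi> z \<in> V" by simp
    obtain i p q where *: "i \<in> I" "p \<in> A i" "q \<in> A i" "\<phi> z \<in> D i" "q (\<phi> z) \<noteq> 0"
      "\<And>y. y \<in> V \<Longrightarrow> y \<in> D i \<Longrightarrow> q y \<noteq> 0 \<Longrightarrow> f y = p y / q y"
      using reg_quotE[OF V f zV] by blast
    define W where "W = {z \<in> {z \<in> pts Z. \<phi> z \<in> D i}. q (\<phi> z) \<noteq> 0}"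
    have W: "openin (tp Z) W" unfolding W_def using nz *(1,3) .
    have "(\<lambda>z. p (\<phi> z)) \<in> reg Z W"
      by (rule reg_restrict[OF Z patch W _ pull]) (use * in \<open>auto simp: W_def\<close>)
    moreover have "(\<lambda>z. inverse (q (\<phi> z))) \<in> reg Z W"
      unfolding W_def by (rule reg_inverse[OF Z patch pull]) (use * in auto)
    ultimately have "(\<lambda>z. p (\<phi> z) * inverse (q (\<phi> z))) \<in> reg Z W" by (rule reg_mult[OF Z W])
    then show "\<exists>W g. openin (tp Z) W \<and> z \<in> W \<and> g \<in> reg Z W \<and> (\<forall>y\<in>W \<inter> {z \<in> pts Z. \<phi> z \<in> V}. (f \<circ> \<phi>) y = g y)"
      using W z * by (intro exI[of _ W] exI[of _ "\<lambda>z. p (\<phi> z) * inverse (q (\<phi> z))"])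
        (auto simp: W_def divide_inverse)
  qed
qed

end

section \<open>Affine spaces and products\<close>

lemma quotient_functions_affine:
  "quotient_functions (affine_space n :: (_, 'a::field) fspace) {()} (\<lambda>_. affine_pts n) (\<lambda>_. polyfuns n)"
proof
  show "tp (affine_space n :: (_, 'a) fspace) =
      topology_generated_by {{z \<in> affine_pts n. h z \<noteq> 0} | (i::unit) h. i \<in> {()} \<and> h \<in> polyfuns n}"
    by (simp add: affine_space_def)
  fix W :: "(nat \<Rightarrow> 'a alg_closure) set" and f :: "(nat \<Rightarrow> 'a alg_closure) \<Rightarrow> 'a alg_closure"
  assume "openin (tp (affine_space n :: (_, 'a) fspace)) W"
  then have W: "W \<subseteq> affine_pts n" using openin_subset by fastforce
  then have "W \<inter> affine_pts n = W" by blast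
  then show "f \<in> reg (affine_space n) W \<longleftrightarrow> (\<forall>z\<in>W. \<exists>i\<in>{()}. \<exists>p\<in>polyfuns n. \<exists>q\<in>polyfuns n.
      z \<in> affine_pts n \<and> q z \<noteq> 0 \<and> (\<forall>y\<in>W \<inter> affine_pts n. q y \<noteq> 0 \<longrightarrow> f y = p y / q y))"
    using W by (auto simp: affine_space_def Bex_def subset_iff)
qed (auto intro: polyfuns.intros)

lemma space_with_functions_affine: "space_with_functions (affine_space n)"
  by (rule quotient_functions.space_with_functions[OF quotient_functions_affine])

lemma coord_reg_affine: "(\<lambda>v. v i) \<in> reg (affine_space n) (pts (affine_space n))"
proof (cases "i < n")
  case True
  then show ?thesis by (intro polyfuns_reg_affine polyfuns.coord)
next
  case False
  then show ?thesis
    by (intro reg_cong[OF space_with_functions_affine openin_topspace reg_0[OF space_with_functions_affine openin_topspace]])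
      (auto simp: affine_pts_def)
qed

text \<open>
  The polynomial functions are generated by the coordinates and the constants.\<close>

lemma morphism_into_affine:
  assumes X: "space_with_functions X" and "\<And>x. x \<in> pts X \<Longrightarrow> \<phi> x \<in> affine_pts n"
    and reg: "\<And>i. i < n \<Longrightarrow> (\<lambda>x. \<phi> x i) \<in> reg X (pts X)"
  shows "morphism X (affine_space n) \<phi>"
proof (rule quotient_functions.morphism_into[OF quotient_functions_affine X])
  have eq: "{x \<in> pts X. \<phi> x \<in> affine_pts n} = pts X" using assms(2) by auto
  show "openin (tp X) {x \<in> pts X. \<phi> x \<in> affine_pts n}" unfolding eq by simp
  show "(\<lambda>z. h (\<phi> z)) \<in> reg X {x \<in> pts X. \<phi> x \<in> affine_pts n}" if "h \<in> polyfuns n" for h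
    unfolding eq using that reg by (rule reg_polyfuns[OF X openin_topspace])
qed (use assms in auto)

lemma tensor_funs_0: "(\<lambda>_. 0) \<in> tensor_funs X Y U V"
  unfolding tensor_funs_def mem_Collect_eq by (rule exI, rule exI, rule exI[of _ 0]) auto

lemma tensor_funs_pure:
  assumes "f \<in> reg X U" "g \<in> reg Y V" shows "(\<lambda>z. f (fst z) * g (snd z)) \<in> tensor_funs X Y U V"
  unfolding tensor_funs_def mem_Collect_eq
  by (rule exI[of _ "\<lambda>_. f"], rule exI[of _ "\<lambda>_. g"], rule exI[of _ 1]) (use assms in \<open>auto simp: fun_eq_iff\<close>)

lemma tensor_funs_add:
  assumes "p \<in> tensor_funs X Y U V" "q \<in> tensor_funs X Y U V"
  shows "(\<lambda>z. p z + q z) \<in> tensor_funs X Y U V"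
proof -
  obtain f g and n :: nat where 1: "p = (\<lambda>(x, y). \<Sum>i<n. f i x * g i y)" "\<forall>i<n. f i \<in> reg X U \<and> g i \<in> reg Y V"
    using assms(1) unfolding tensor_funs_def by blast
  obtain f' g' and m :: nat where 2: "q = (\<lambda>(x, y). \<Sum>i<m. f' i x * g' i y)" "\<forall>i<m. f' i \<in> reg X U \<and> g' i \<in> reg Y V"
    using assms(2) unfolding tensor_funs_def by blast
  define F where "F i = (if i < n then f i else f' (i - n))" for i
  define G where "G i = (if i < n then g i else g' (i - n))" for i
  have split: "(\<Sum>i<n+m. h i) = (\<Sum>i<n. h i) + (\<Sum>i<m. h (n + i))" for h :: "nat \<Rightarrow> 'c alg_closure"
    by (induction m) (simp_all add: add.assoc)
  have "(\<lambda>z. p z + q z) = (\<lambda>(x, y). \<Sum>i<n+m. F i x * G i y)"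
    by (auto simp: 1 2 fun_eq_iff split F_def G_def)
  moreover have "\<forall>i<n+m. F i \<in> reg X U \<and> G i \<in> reg Y V" using 1(2) 2(2) by (auto simp: F_def G_def)
  ultimately show ?thesis unfolding tensor_funs_def mem_Collect_eq by blast
qed

lemma tensor_funs_sum:
  "(\<And>i. i \<in> I \<Longrightarrow> p i \<in> tensor_funs X Y U V) \<Longrightarrow> (\<lambda>z. \<Sum>i\<in>I. p i z) \<in> tensor_funs X Y U V"
  by (induction I rule: infinite_finite_induct) (simp_all add: tensor_funs_0 tensor_funs_add)

lemma tensor_funs_mult:
  assumes X: "space_with_functions X" and Y: "space_with_functions Y"
    and U: "openin (tp X) U" and V: "openin (tp Y) V"
    and "p \<in> tensor_funs X Y U V" "q \<in> tensor_funs X Y U V"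
  shows "(\<lambda>z. p z * q z) \<in> tensor_funs X Y U V"
proof -
  obtain f g and n :: nat where 1: "p = (\<lambda>(x, y). \<Sum>i<n. f i x * g i y)" "\<forall>i<n. f i \<in> reg X U \<and> g i \<in> reg Y V"
    using assms(5) unfolding tensor_funs_def by blast
  obtain f' g' and m :: nat where 2: "q = (\<lambda>(x, y). \<Sum>i<m. f' i x * g' i y)" "\<forall>i<m. f' i \<in> reg X U \<and> g' i \<in> reg Y V"
    using assms(6) unfolding tensor_funs_def by blast
  have "(\<lambda>z. p z * q z) = (\<lambda>z. \<Sum>i<n. \<Sum>j<m. (f i (fst z) * f' j (fst z)) * (g i (snd z) * g' j (snd z)))"
    unfolding 1 2 case_prod_beta sum_product by (intro ext sum.cong refl) (simp add: mult_ac)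
  also have "\<dots> \<in> tensor_funs X Y U V"
    using 1(2) 2(2) by (intro tensor_funs_sum tensor_funs_pure reg_mult[OF X U] reg_mult[OF Y V]) auto
  finally show ?thesis .
qed

lemma tensor_funs_restrict:
  assumes X: "space_with_functions X" and Y: "space_with_functions Y"
    and "openin (tp X) U" "openin (tp X) U'" "U' \<subseteq> U" "openin (tp Y) V" "openin (tp Y) V'" "V' \<subseteq> V"
  shows "tensor_funs X Y U V \<subseteq> tensor_funs X Y U' V'"
proof
  fix p assume "p \<in> tensor_funs X Y U V"
  then obtain f g and n :: nat where 1: "p = (\<lambda>(x, y). \<Sum>i<n. f i x * g i y)" "\<forall>i<n. f i \<in> reg X U \<and> g i \<in> reg Y V"
    unfolding tensor_funs_def by blast
  have "p = (\<lambda>z. \<Sum>i<n. f i (fst z) * g i (snd z))" by (auto simp: 1 fun_eq_iff)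
  also have "\<dots> \<in> tensor_funs X Y U' V'"
    using 1(2) assms by (intro tensor_funs_sum tensor_funs_pure) (auto intro: reg_restrict)
  finally show "p \<in> tensor_funs X Y U' V'" .
qed

context
  fixes X :: "('p, 'a::field) fspace" and Y :: "('q, 'a) fspace"
  assumes X: "space_with_functions X" and Y: "space_with_functions Y"
begin

lemma quotient_functions_prod:
  "quotient_functions (prod_space X Y) {(U, V). openin (tp X) U \<and> openin (tp Y) V}
     (\<lambda>(U, V). U \<times> V) (\<lambda>(U, V). tensor_funs X Y U V)"
proof
  have "{{z \<in> U \<times> V. h z \<noteq> 0} | U V h. openin (tp X) U \<and> openin (tp Y) V \<and> h \<in> tensor_funs X Y U V}
    = {{z \<in> case i of (U, V) \<Rightarrow> U \<times> V. h z \<noteq> 0} | i h.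
        i \<in> {(U, V). openin (tp X) U \<and> openin (tp Y) V} \<and> h \<in> (case i of (U, V) \<Rightarrow> tensor_funs X Y U V)}"
    (is "?L = ?R")
  proof (intro equalityI subsetI)
    fix S assume "S \<in> ?L"
    then obtain U V h where "S = {z \<in> U \<times> V. h z \<noteq> 0}" "openin (tp X) U" "openin (tp Y) V" "h \<in> tensor_funs X Y U V"
      by blast
    then show "S \<in> ?R" unfolding mem_Collect_eq by (intro exI[of _ "(U, V)"] exI[of _ h]) simp
  next
    fix S assume "S \<in> ?R"
    then obtain i h where "S = {z \<in> case i of (U, V) \<Rightarrow> U \<times> V. h z \<noteq> 0}"
      "i \<in> {(U, V). openin (tp X) U \<and> openin (tp Y) V}" "h \<in> (case i of (U, V) \<Rightarrow> tensor_funs X Y U V)" by blast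
    then show "S \<in> ?L" by (cases i) auto
  qed
  then show "tp (prod_space X Y) = topology_generated_by {{z \<in> case i of (U, V) \<Rightarrow> U \<times> V. h z \<noteq> 0} | i h.
        i \<in> {(U, V). openin (tp X) U \<and> openin (tp Y) V} \<and> h \<in> (case i of (U, V) \<Rightarrow> tensor_funs X Y U V)}"
    by (simp add: prod_space_def)
next
  fix W f
  show "f \<in> reg (prod_space X Y) W \<longleftrightarrow>
     (\<forall>z\<in>W. \<exists>i\<in>{(U, V). openin (tp X) U \<and> openin (tp Y) V}.
       \<exists>p\<in>case i of (U, V) \<Rightarrow> tensor_funs X Y U V. \<exists>q\<in>case i of (U, V) \<Rightarrow> tensor_funs X Y U V.
         z \<in> (case i of (U, V) \<Rightarrow> U \<times> V) \<and> q z \<noteq> 0 \<and>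
         (\<forall>y\<in>W \<inter> (case i of (U, V) \<Rightarrow> U \<times> V). q y \<noteq> 0 \<longrightarrow> f y = p y / q y))"
  proof -
    have eq: "(\<exists>i\<in>{(U, V). openin (tp X) U \<and> openin (tp Y) V}. Q i) \<longleftrightarrow>
        (\<exists>U V. openin (tp X) U \<and> openin (tp Y) V \<and> Q (U, V))" for Q by auto
    show ?thesis unfolding eq by (simp add: prod_space_def Bex_def)
  qed
next
  fix i c assume "i \<in> {(U, V). openin (tp X) U \<and> openin (tp Y) V}"
  then obtain U V where i: "i = (U, V)" "openin (tp X) U" "openin (tp Y) V" by blast
  show "(\<lambda>_. to_ac c) \<in> (case i of (U, V) \<Rightarrow> tensor_funs X Y U V)"
    using tensor_funs_pure[OF reg_const[OF X i(2), of c] reg_1[OF Y i(3)]] by (simp add: i)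
next
  fix i p q assume "i \<in> {(U, V). openin (tp X) U \<and> openin (tp Y) V}"
    and pq: "p \<in> (case i of (U, V) \<Rightarrow> tensor_funs X Y U V)" "q \<in> (case i of (U, V) \<Rightarrow> tensor_funs X Y U V)"
  then obtain U V where i: "i = (U, V)" "openin (tp X) U" "openin (tp Y) V" by blast
  show "(\<lambda>z. p z + q z) \<in> (case i of (U, V) \<Rightarrow> tensor_funs X Y U V)"
    using pq tensor_funs_add by (simp add: i)
  show "(\<lambda>z. p z * q z) \<in> (case i of (U, V) \<Rightarrow> tensor_funs X Y U V)"
    using pq tensor_funs_mult[OF X Y i(2,3)] by (simp add: i)
next
  fix i j assume "i \<in> {(U, V). openin (tp X) U \<and> openin (tp Y) V}" "j \<in> {(U, V). openin (tp X) U \<and> openin (tp Y) V}"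
  then obtain U V U' V' where i: "i = (U, V)" "openin (tp X) U" "openin (tp Y) V"
    and j: "j = (U', V')" "openin (tp X) U'" "openin (tp Y) V'" by blast
  have "tensor_funs X Y U V \<subseteq> tensor_funs X Y (U \<inter> U') (V \<inter> V')"
    "tensor_funs X Y U' V' \<subseteq> tensor_funs X Y (U \<inter> U') (V \<inter> V')"
    by (rule tensor_funs_restrict[OF X Y]; use i j in auto)+
  then show "\<exists>k\<in>{(U, V). openin (tp X) U \<and> openin (tp Y) V}.
      (case k of (U, V) \<Rightarrow> U \<times> V) = (case i of (U, V) \<Rightarrow> U \<times> V) \<inter> (case j of (U, V) \<Rightarrow> U \<times> V) \<and>
      (case i of (U, V) \<Rightarrow> tensor_funs X Y U V) \<subseteq> (case k of (U, V) \<Rightarrow> tensor_funs X Y U V) \<and>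
      (case j of (U, V) \<Rightarrow> tensor_funs X Y U V) \<subseteq> (case k of (U, V) \<Rightarrow> tensor_funs X Y U V)"
    using i j by (intro bexI[of _ "(U \<inter> U', V \<inter> V')"]) auto
qed

lemma space_with_functions_prod: "space_with_functions (prod_space X Y)"
  by (rule quotient_functions.space_with_functions[OF quotient_functions_prod])

lemma pts_prod_space [simp]: "pts (prod_space X Y) = pts X \<times> pts Y"
  by (rule pts_prod) (auto intro: reg_1[OF X] reg_1[OF Y])

lemma reg_prod_fst:
  assumes U: "openin (tp X) U" and f: "f \<in> reg X U"
  shows "(\<lambda>z. f (fst z)) \<in> reg (prod_space X Y) (U \<times> pts Y)"
proof -
  have "(\<lambda>z. f (fst z) * 1) \<in> tensor_funs X Y U (pts Y)"
    by (rule tensor_funs_pure[OF f reg_1[OF Y openin_topspace]])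
  then show ?thesis
    using quotient_functions.reg_patch[OF quotient_functions_prod, of "(U, pts Y)" "\<lambda>z. f (fst z)"] U by simp
qed

lemma reg_prod_snd:
  assumes V: "openin (tp Y) V" and g: "g \<in> reg Y V"
  shows "(\<lambda>z. g (snd z)) \<in> reg (prod_space X Y) (pts X \<times> V)"
proof -
  have "(\<lambda>z. 1 * g (snd z)) \<in> tensor_funs X Y (pts X) V"
    by (rule tensor_funs_pure[OF reg_1[OF X openin_topspace] g])
  then show ?thesis
    using quotient_functions.reg_patch[OF quotient_functions_prod, of "(pts X, V)" "\<lambda>z. g (snd z)"] V by simp
qed

lemma morphism_fst: "morphism (prod_space X Y) X fst"
proof (rule morphismI)
  fix V f assume V: "openin (tp X) V"
  then have eq: "{z \<in> pts (prod_space X Y). fst z \<in> V} = V \<times> pts Y" using openin_subset[OF V] by auto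
  show "openin (tp (prod_space X Y)) {z \<in> pts (prod_space X Y). fst z \<in> V}"
    using quotient_functions.openin_patch[OF quotient_functions_prod, of "(V, pts Y)"] V by (simp add: eq del: pts_prod_space)
  assume "f \<in> reg X V"
  then show "f \<circ> fst \<in> reg (prod_space X Y) {z \<in> pts (prod_space X Y). fst z \<in> V}"
    using reg_prod_fst[OF V] by (simp add: eq comp_def del: pts_prod_space)
qed auto

lemma morphism_snd: "morphism (prod_space X Y) Y snd"
proof (rule morphismI)
  fix V f assume V: "openin (tp Y) V"
  then have eq: "{z \<in> pts (prod_space X Y). snd z \<in> V} = pts X \<times> V" using openin_subset[OF V] by auto
  show "openin (tp (prod_space X Y)) {z \<in> pts (prod_space X Y). snd z \<in> V}"
    using quotient_functions.openin_patch[OF quotient_functions_prod, of "(pts X, V)"] V by (simp add: eq del: pts_prod_space)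
  assume "f \<in> reg Y V"
  then show "f \<circ> snd \<in> reg (prod_space X Y) {z \<in> pts (prod_space X Y). snd z \<in> V}"
    using reg_prod_snd[OF V] by (simp add: eq comp_def del: pts_prod_space)
qed auto

text \<open>
  A tensor \<open>\<Sum>i. f i \<otimes> g i\<close> pulls back to the sum of the products of the pullbacks of \<open>f i\<close> and \<open>g i\<close>.\<close>

lemma morphism_pair:
  assumes Z: "space_with_functions Z" and \<phi>: "morphism Z X \<phi>" and \<psi>: "morphism Z Y \<psi>"
  shows "morphism Z (prod_space X Y) (\<lambda>z. (\<phi> z, \<psi> z))"
proof (rule quotient_functions.morphism_into[OF quotient_functions_prod Z])
  show "(\<phi> z, \<psi> z) \<in> pts (prod_space X Y)" if "z \<in> pts Z" for z
    using that morphismD(1)[OF \<phi>] morphismD(1)[OF \<psi>] by simp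
  fix i assume "i \<in> {(U, V). openin (tp X) U \<and> openin (tp Y) V}"
  then obtain U V where i: "i = (U, V)" "openin (tp X) U" "openin (tp Y) V" by blast
  have eq: "{z \<in> pts Z. (\<phi> z, \<psi> z) \<in> (case i of (U, V) \<Rightarrow> U \<times> V)} = {z \<in> pts Z. \<phi> z \<in> U} \<inter> {z \<in> pts Z. \<psi> z \<in> V}"
    by (auto simp: i)
  have op: "openin (tp Z) {z \<in> pts Z. \<phi> z \<in> U}" "openin (tp Z) {z \<in> pts Z. \<psi> z \<in> V}"
    using morphismD(2)[OF \<phi> i(2)] morphismD(2)[OF \<psi> i(3)] .
  then have op3: "openin (tp Z) ({z \<in> pts Z. \<phi> z \<in> U} \<inter> {z \<in> pts Z. \<psi> z \<in> V})" by blast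
  then show "openin (tp Z) {z \<in> pts Z. (\<phi> z, \<psi> z) \<in> (case i of (U, V) \<Rightarrow> U \<times> V)}" unfolding eq .
  fix h assume "h \<in> (case i of (U, V) \<Rightarrow> tensor_funs X Y U V)"
  then obtain f g n where h: "h = (\<lambda>(x, y). \<Sum>i<n. f i x * g i y)" "\<forall>i<(n::nat). f i \<in> reg X U \<and> g i \<in> reg Y V"
    by (auto simp: i tensor_funs_def)
  have "(\<lambda>z. f j (\<phi> z)) \<in> reg Z ({z \<in> pts Z. \<phi> z \<in> U} \<inter> {z \<in> pts Z. \<psi> z \<in> V})"
    "(\<lambda>z. g j (\<psi> z)) \<in> reg Z ({z \<in> pts Z. \<phi> z \<in> U} \<inter> {z \<in> pts Z. \<psi> z \<in> V})" if "j < n" for j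
    using that h(2) morphismD(3)[OF \<phi> i(2), of "f j", unfolded comp_def]
      morphismD(3)[OF \<psi> i(3), of "g j", unfolded comp_def]
    by (auto intro: reg_restrict[OF Z op(1) op3] reg_restrict[OF Z op(2) op3])
  then have "(\<lambda>z. \<Sum>j<n. f j (\<phi> z) * g j (\<psi> z)) \<in> reg Z ({z \<in> pts Z. \<phi> z \<in> U} \<inter> {z \<in> pts Z. \<psi> z \<in> V})"
    by (intro reg_sum[OF Z op3] reg_mult[OF Z op3]) auto
  then show "(\<lambda>z. h (\<phi> z, \<psi> z)) \<in> reg Z {z \<in> pts Z. (\<phi> z, \<psi> z) \<in> (case i of (U, V) \<Rightarrow> U \<times> V)}"
    unfolding eq by (simp add: h)
qed

end

section \<open>Irreducibility\<close>

lemma irreducible_inI: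
  assumes "S \<noteq> {}" "S \<subseteq> topspace T"
    and "\<And>U V. openin T U \<Longrightarrow> openin T V \<Longrightarrow> U \<inter> S \<noteq> {} \<Longrightarrow> V \<inter> S \<noteq> {} \<Longrightarrow> U \<inter> V \<inter> S \<noteq> {}"
  shows "irreducible_in T S"
  unfolding irreducible_in_def
proof (intro conjI allI impI)
  fix A B assume AB: "closedin T A \<and> closedin T B \<and> S \<subseteq> A \<union> B"
  show "S \<subseteq> A \<or> S \<subseteq> B"
  proof (rule ccontr)
    assume "\<not> (S \<subseteq> A \<or> S \<subseteq> B)"
    then have "(topspace T - A) \<inter> S \<noteq> {}" "(topspace T - B) \<inter> S \<noteq> {}" using assms(2) by auto
    then have "(topspace T - A) \<inter> (topspace T - B) \<inter> S \<noteq> {}" using AB by (intro assms(3)) auto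
    then show False using AB by auto
  qed
qed (use assms in auto)

lemma irreducible_inD:
  "irreducible_in T S \<Longrightarrow> closedin T A \<Longrightarrow> closedin T B \<Longrightarrow> S \<subseteq> A \<union> B \<Longrightarrow> S \<subseteq> A \<or> S \<subseteq> B"
  by (simp add: irreducible_in_def)

lemma irreducible_in_image:
  assumes "continuous_map T T' \<phi>" "irreducible_in T S"
  shows "irreducible_in T' (\<phi> ` S)"
  unfolding irreducible_in_def
proof (intro conjI allI impI)
  have S: "S \<noteq> {}" "S \<subseteq> topspace T" using assms(2) by (auto simp: irreducible_in_def)
  then show "\<phi> ` S \<noteq> {}" "\<phi> ` S \<subseteq> topspace T'" using assms(1) by (auto simp: continuous_map_def)
  fix A B assume AB: "closedin T' A \<and> closedin T' B \<and> \<phi> ` S \<subseteq> A \<union> B"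
  have "closedin T {x \<in> topspace T. \<phi> x \<in> A}" "closedin T {x \<in> topspace T. \<phi> x \<in> B}"
    using assms(1) AB by (auto intro: closedin_continuous_map_preimage)
  moreover have "S \<subseteq> {x \<in> topspace T. \<phi> x \<in> A} \<union> {x \<in> topspace T. \<phi> x \<in> B}" using S AB by auto
  ultimately have "S \<subseteq> {x \<in> topspace T. \<phi> x \<in> A} \<or> S \<subseteq> {x \<in> topspace T. \<phi> x \<in> B}"
    by (rule irreducible_inD[OF assms(2)])
  then show "\<phi> ` S \<subseteq> A \<or> \<phi> ` S \<subseteq> B" by auto
qed

text \<open>
  An irreducible set has a coordinate ring without zero divisors, which is what permits cancelling
  a factor in the bound on the dimension.\<close>

lemma irreducible_in_no_zero_divisors:
  assumes X: "space_with_functions X" and C: "irreducible_in (tp X) C"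
    and "f \<in> reg X (pts X)" "g \<in> reg X (pts X)" "\<And>x. x \<in> C \<Longrightarrow> f x * g x = 0"
  shows "(\<forall>x\<in>C. f x = 0) \<or> (\<forall>x\<in>C. g x = 0)"
proof -
  have "closedin (tp X) {x \<in> pts X. f x = 0}" "closedin (tp X) {x \<in> pts X. g x = 0}"
    using assms by (auto intro: closedin_zeros)
  moreover have "C \<subseteq> {x \<in> pts X. f x = 0} \<union> {x \<in> pts X. g x = 0}"
    using assms(5) C by (auto simp: irreducible_in_def)
  ultimately have "C \<subseteq> {x \<in> pts X. f x = 0} \<or> C \<subseteq> {x \<in> pts X. g x = 0}"
    by (rule irreducible_inD[OF C])
  then show ?thesis
  proof
    assume "C \<subseteq> {x \<in> pts X. f x = 0}"
    from subsetD[OF this] have "\<forall>x\<in>C. f x = 0" by blast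
    then show ?thesis ..
  next
    assume "C \<subseteq> {x \<in> pts X. g x = 0}"
    from subsetD[OF this] have "\<forall>x\<in>C. g x = 0" by blast
    then show ?thesis ..
  qed
qed

lemma affine_nbhdE:
  assumes "openin (tp (affine_space n)) U" "u \<in> U"
  obtains p where "p \<in> polyfuns n" "p u \<noteq> 0" "\<And>v. v \<in> affine_pts n \<Longrightarrow> p v \<noteq> 0 \<Longrightarrow> v \<in> U"
proof (rule quotient_functions.basic_nbhdE[OF quotient_functions_affine assms])
  fix i :: unit and h
  assume "h \<in> polyfuns n" "h u \<noteq> 0" "\<And>v. v \<in> affine_pts n \<Longrightarrow> h v \<noteq> 0 \<Longrightarrow> v \<in> U"
  then show thesis by (rule that)
qed

lemma polyfuns_on_line:
  "p \<in> polyfuns n \<Longrightarrow> \<exists>P. \<forall>t. p (\<lambda>i. u i + t * (w i - u i)) = poly P t"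
proof (induction rule: polyfuns.induct)
  case (const c)
  show ?case by (rule exI[of _ "[:to_ac c:]"]) simp
next
  case (coord i)
  show ?case by (rule exI[of _ "[:u i, w i - u i:]"]) simp
next
  case (add p q)
  then obtain P Q where "\<forall>t. p (\<lambda>i. u i + t * (w i - u i)) = poly P t" "\<forall>t. q (\<lambda>i. u i + t * (w i - u i)) = poly Q t"
    by blast
  then show ?case by (intro exI[of _ "P + Q"]) simp
next
  case (mult p q)
  then obtain P Q where "\<forall>t. p (\<lambda>i. u i + t * (w i - u i)) = poly P t" "\<forall>t. q (\<lambda>i. u i + t * (w i - u i)) = poly Q t"
    by blast
  then show ?case by (intro exI[of _ "P * Q"]) simp
qed

text \<open>
  Two open sets that meet \<open>L \<inter> S\<close> contain the non-vanishing loci of two polynomial functions, the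
  first non-zero at \<open>u\<close> and the second at \<open>w\<close>, both points of \<open>L\<close>. On the line through \<open>u\<close> and \<open>w\<close>
  they restrict to non-zero polynomials in one variable over an infinite field, which have a common
  non-root.\<close>

lemma irreducible_in_linear:
  fixes L :: "(nat \<Rightarrow> 'a::field_char_0 alg_closure) set"
  assumes L: "L \<subseteq> affine_pts n" and line: "\<And>u w t. u \<in> L \<Longrightarrow> w \<in> L \<Longrightarrow> (\<lambda>i. u i + t * (w i - u i)) \<in> L"
    and S: "openin (tp (affine_space n)) S" and ne: "L \<inter> S \<noteq> {}"
  shows "irreducible_in (tp (sub (affine_space n) S)) (L \<inter> S)"
proof (rule irreducible_inI)
  show "L \<inter> S \<noteq> {}" "L \<inter> S \<subseteq> topspace (tp (sub (affine_space n) S))" using ne L by auto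
  fix U V assume UV: "openin (tp (sub (affine_space n) S)) U" "openin (tp (sub (affine_space n) S)) V"
    "U \<inter> (L \<inter> S) \<noteq> {}" "V \<inter> (L \<inter> S) \<noteq> {}"
  obtain U1 V1 where U1: "openin (tp (affine_space n)) U1" "U = U1 \<inter> S"
    and V1: "openin (tp (affine_space n)) V1" "V = V1 \<inter> S" using UV(1,2) by (auto simp: openin_sub)
  obtain u w where u: "u \<in> U" "u \<in> L" and w: "w \<in> V" "w \<in> L" using UV by blast
  have oU: "openin (tp (affine_space n)) U" and oV: "openin (tp (affine_space n)) V"
    using U1 V1 S by (auto intro: openin_Int)
  obtain p where p: "p \<in> polyfuns n" "p u \<noteq> 0" "\<And>v. v \<in> affine_pts n \<Longrightarrow> p v \<noteq> 0 \<Longrightarrow> v \<in> U"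
    using affine_nbhdE[OF oU u(1)] by blast
  obtain q where q: "q \<in> polyfuns n" "q w \<noteq> 0" "\<And>v. v \<in> affine_pts n \<Longrightarrow> q v \<noteq> 0 \<Longrightarrow> v \<in> V"
    using affine_nbhdE[OF oV w(1)] by blast
  obtain P where P: "\<And>t. p (\<lambda>i. u i + t * (w i - u i)) = poly P t" using polyfuns_on_line[OF p(1)] by blast
  obtain Q where Q: "\<And>t. q (\<lambda>i. u i + t * (w i - u i)) = poly Q t" using polyfuns_on_line[OF q(1)] by blast
  have "poly P 0 \<noteq> 0" "poly Q 1 \<noteq> 0" using P[of 0] Q[of 1] p(2) q(2) by simp_all
  then have "P * Q \<noteq> 0" by auto
  then obtain t where "poly (P * Q) t \<noteq> 0" using poly_all_0_iff_0 by blast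
  then have t: "p (\<lambda>i. u i + t * (w i - u i)) \<noteq> 0" "q (\<lambda>i. u i + t * (w i - u i)) \<noteq> 0" by (auto simp: P Q)
  have in_L: "(\<lambda>i. u i + t * (w i - u i)) \<in> L" using line u w by blast
  then have "(\<lambda>i. u i + t * (w i - u i)) \<in> U \<inter> V" using p(3) q(3) t L by blast
  then show "U \<inter> V \<inter> (L \<inter> S) \<noteq> {}" using in_L U1(2) by blast
qed

lemma irreducible_in_open_affine:
  assumes "openin (tp (affine_space n :: (_, 'a::field_char_0) fspace)) S" "S \<noteq> {}"
  shows "irreducible_in (tp (sub (affine_space n) S)) S"
proof -
  have "S \<subseteq> affine_pts n" using openin_subset[OF assms(1)] by simp
  then have "affine_pts n \<inter> S = S" by blast
  moreover have "irreducible_in (tp (sub (affine_space n) S)) (affine_pts n \<inter> S)"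
    using assms calculation by (intro irreducible_in_linear) (auto simp: affine_pts_def)
  ultimately show ?thesis by simp
qed

section \<open>Dimension\<close>

text \<open>
  Functions \<open>g i\<close> that vanish on \<open>C i\<close> but not on \<open>C (Suc i)\<close> are algebraically independent on the last
  member \<open>C m\<close> of the chain. In a relation on \<open>C (Suc m)\<close>, let \<open>k\<close> be the lowest exponent of \<open>g m\<close>.
  Since \<open>C (Suc m)\<close> is irreducible and \<open>g m\<close> is not zero on it, the factor \<open>g m ^ k\<close> can be cancelled.
  On \<open>C m\<close>, where \<open>g m\<close> vanishes, the terms with exponent exactly \<open>k\<close> remain, and they are a relation
  between \<open>g 0, \<dots>, g (m - 1)\<close>, to which induction applies. Exponents are functions on all natural
  numbers; as only their values below \<open>m\<close> matter, the elements of \<open>E\<close> must differ there.\<close>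

lemma chain_functions_independent:
  fixes X :: "('p, 'a::field) fspace"
  assumes X: "space_with_functions X"
  shows "\<lbrakk>\<And>i. i \<le> m \<Longrightarrow> irreducible_in (tp X) (C i); \<And>i. i < m \<Longrightarrow> C i \<subseteq> C (Suc i);
    \<And>i. i < m \<Longrightarrow> g i \<in> reg X (pts X); \<And>i x. i < m \<Longrightarrow> x \<in> C i \<Longrightarrow> g i x = 0;
    \<And>i. i < m \<Longrightarrow> \<exists>x\<in>C (Suc i). g i x \<noteq> 0;
    finite E; inj_on (\<lambda>e. restrict e {..<m}) E;
    \<And>x. x \<in> C m \<Longrightarrow> (\<Sum>e\<in>E. to_ac (c e) * (\<Prod>i<m. g i x ^ e i)) = 0; e \<in> E\<rbrakk> \<Longrightarrow> c e = 0"
proof (induction m arbitrary: E e)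
  case 0
  have "E = {e}"
  proof -
    have "e' = e" if "e' \<in> E" for e' using inj_onD[OF "0.prems"(7) _ that \<open>e \<in> E\<close>] by simp
    then show ?thesis using \<open>e \<in> E\<close> by blast
  qed
  moreover obtain x where "x \<in> C 0" using "0.prems"(1)[of 0] by (auto simp: irreducible_in_def)
  ultimately show ?case using "0.prems"(8)[of x] by simp
next
  case (Suc m)
  note g_reg = Suc.prems(3)
  show ?case
  proof (rule ccontr)
    assume "c e \<noteq> 0"
    define E' where "E' = {e \<in> E. c e \<noteq> 0}"
    have E': "finite E'" "E' \<noteq> {}" using Suc.prems(6,9) \<open>c e \<noteq> 0\<close> by (auto simp: E'_def)
    define k where "k = Min ((\<lambda>e. e m) ` E')"
    have k_le: "k \<le> e m" if "e \<in> E'" for e unfolding k_def using E' that by (intro Min_le) auto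
    have "k \<in> (\<lambda>e. e m) ` E'" unfolding k_def using E' by (intro Min_in) auto
    then obtain e0 where e0: "e0 \<in> E'" "e0 m = k" by auto
    define h where "h x = (\<Sum>e\<in>E'. to_ac (c e) * (\<Prod>i<m. g i x ^ e i) * g m x ^ (e m - k))" for x
    have pow: "(\<lambda>x. g i x ^ j) \<in> reg X (pts X)" if "i < Suc m" for i j
    proof (induction j)
      case (Suc j)
      then show ?case using reg_mult[OF X openin_topspace g_reg[OF that]] by simp
    qed (simp add: reg_1[OF X])
    have prod: "(\<lambda>x. \<Prod>i<l. g i x ^ e i) \<in> reg X (pts X)" if "l \<le> m" for l e
      using that
    proof (induction l)
      case (Suc l)
      then show ?case using reg_mult[OF X openin_topspace _ pow[of l "e l"]] by simp
    qed (simp add: reg_1[OF X])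
    have h: "h \<in> reg X (pts X)"
      unfolding h_def
      by (intro reg_sum[OF X openin_topspace] reg_mult[OF X openin_topspace] reg_const[OF X openin_topspace] prod pow) auto
    have "g m x ^ k * h x = 0" if "x \<in> C (Suc m)" for x
    proof -
      have "0 = (\<Sum>e\<in>E. to_ac (c e) * (\<Prod>i<Suc m. g i x ^ e i))" using Suc.prems(8)[OF that] by simp
      also have "\<dots> = (\<Sum>e\<in>E'. to_ac (c e) * (\<Prod>i<Suc m. g i x ^ e i))"
        by (rule sum.mono_neutral_right) (use Suc.prems(6) in \<open>auto simp: E'_def\<close>)
      also have "\<dots> = g m x ^ k * h x"
        unfolding h_def sum_distrib_left
      proof (rule sum.cong)
        fix e assume "e \<in> E'"
        then have "g m x ^ e m = g m x ^ k * g m x ^ (e m - k)" using k_le by (simp flip: power_add)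
        then show "to_ac (c e) * (\<Prod>i<Suc m. g i x ^ e i) = g m x ^ k * (to_ac (c e) * (\<Prod>i<m. g i x ^ e i) * g m x ^ (e m - k))"
          by (simp add: mult_ac)
      qed simp
      finally show ?thesis by simp
    qed
    then have "(\<forall>x\<in>C (Suc m). g m x ^ k = 0) \<or> (\<forall>x\<in>C (Suc m). h x = 0)"
      by (intro irreducible_in_no_zero_divisors[OF X Suc.prems(1)] pow h) auto
    moreover obtain y where "y \<in> C (Suc m)" "g m y \<noteq> 0" using Suc.prems(5) by blast
    ultimately have h0: "\<forall>x\<in>C (Suc m). h x = 0" by auto
    define E2 where "E2 = {e \<in> E'. e m = k}"
    have "c e0 = 0"
    proof (rule Suc.IH)
      show "irreducible_in (tp X) (C i)" if "i \<le> m" for i using Suc.prems(1) that by simp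
      show "C i \<subseteq> C (Suc i)" "g i \<in> reg X (pts X)" "\<exists>x\<in>C (Suc i). g i x \<noteq> 0" if "i < m" for i
        using Suc.prems(2,3,5) that by simp_all
      show "g i x = 0" if "i < m" "x \<in> C i" for i x using Suc.prems(4) that by simp
      show "finite E2" using E' by (simp add: E2_def)
      show "e0 \<in> E2" using e0 by (simp add: E2_def)
      show "inj_on (\<lambda>e. restrict e {..<m}) E2"
      proof (rule inj_onI)
        fix e e' assume e: "e \<in> E2" "e' \<in> E2" "restrict e {..<m} = restrict e' {..<m}"
        have "e i = e' i" if "i < Suc m" for i
          using e(1,2) fun_cong[OF e(3), of i] that by (cases "i = m") (simp_all add: E2_def)
        then have "restrict e {..<Suc m} = restrict e' {..<Suc m}" by (intro restrict_ext) simp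
        then show "e = e'" using inj_onD[OF Suc.prems(7), of e e'] e by (auto simp: E2_def E'_def)
      qed
      fix x assume x: "x \<in> C m"
      have "g m x = 0" using Suc.prems(4) x by simp
      have "(\<Sum>e\<in>E2. to_ac (c e) * (\<Prod>i<m. g i x ^ e i)) = (\<Sum>e\<in>E2. to_ac (c e) * (\<Prod>i<m. g i x ^ e i) * g m x ^ (e m - k))"
        by (rule sum.cong) (auto simp: E2_def)
      also have "\<dots> = h x" unfolding h_def
      proof (rule sum.mono_neutral_left)
        show "\<forall>e\<in>E' - E2. to_ac (c e) * (\<Prod>i<m. g i x ^ e i) * g m x ^ (e m - k) = 0"
        proof
          fix e assume "e \<in> E' - E2"
          then have "e m - k \<noteq> 0" using k_le[of e] by (auto simp: E2_def)
          then show "to_ac (c e) * (\<Prod>i<m. g i x ^ e i) * g m x ^ (e m - k) = 0"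
            using \<open>g m x = 0\<close> by (simp add: power_0_left)
        qed
      qed (use E' in \<open>auto simp: E2_def\<close>)
      also have "\<dots> = 0" using h0 Suc.prems(2)[of m] x by blast
      finally show "(\<Sum>e\<in>E2. to_ac (c e) * (\<Prod>i<m. g i x ^ e i)) = 0" .
    qed
    then show False using e0 by (simp add: E'_def)
  qed
qed

text \<open>
  The values lie in the algebraic closure, but the scalars in the ground field: this is where the
  coefficients of polynomial functions lie, and algebraic relations have to be regular over it.\<close>

lemma vector_space_functions:
  "vector_space (\<lambda>(c::'a::field) (f::'b \<Rightarrow> 'a alg_closure) v. to_ac c * f v)"
  by standard (auto simp: fun_eq_iff algebra_simps)

interpretation funs: vector_space "\<lambda>(c::'a::field) (f::'b \<Rightarrow> 'a alg_closure) v. to_ac c * f v"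
  by (rule vector_space_functions)

definition monomial_funs :: "nat \<Rightarrow> nat \<Rightarrow> ((nat \<Rightarrow> 'a::field alg_closure) \<Rightarrow> 'a alg_closure) set" where
  "monomial_funs n d = (\<lambda>e v. \<Prod>i<n. v i ^ e i) ` ({..<n} \<rightarrow>\<^sub>E {..d})"

lemma finite_monomial_funs: "finite (monomial_funs n d)"
  by (simp add: monomial_funs_def finite_PiE)

lemma card_monomial_funs: "card (monomial_funs n d) \<le> (d + 1) ^ n"
proof -
  have "card (monomial_funs n d :: ((nat \<Rightarrow> 'a alg_closure) \<Rightarrow> _) set) \<le> card ({..<n} \<rightarrow>\<^sub>E {..d})"
    unfolding monomial_funs_def by (rule card_image_le) (simp add: finite_PiE)
  then show ?thesis by (simp add: card_PiE)
qed

lemma monomial_funs_mono: "a \<le> b \<Longrightarrow> monomial_funs n a \<subseteq> monomial_funs n b"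
  unfolding monomial_funs_def by (intro image_mono PiE_mono) auto

lemma monomial_funs_mult:
  assumes "p \<in> monomial_funs n a" "q \<in> monomial_funs n b"
  shows "(\<lambda>v. p v * q v) \<in> monomial_funs n (a + b)"
proof -
  obtain e e' where e: "p = (\<lambda>v. \<Prod>i<n. v i ^ e i)" "e \<in> {..<n} \<rightarrow>\<^sub>E {..a}"
    and e': "q = (\<lambda>v. \<Prod>i<n. v i ^ e' i)" "e' \<in> {..<n} \<rightarrow>\<^sub>E {..b}"
    using assms unfolding monomial_funs_def by blast
  have "(\<lambda>v. p v * q v) = (\<lambda>v. \<Prod>i<n. v i ^ (restrict (\<lambda>i. e i + e' i) {..<n}) i)"
    by (simp add: e e' power_add prod.distrib)
  moreover have "restrict (\<lambda>i. e i + e' i) {..<n} \<in> {..<n} \<rightarrow>\<^sub>E {..a + b}"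
    using e(2) e'(2) by (auto intro!: add_mono simp: PiE_iff)
  ultimately show ?thesis unfolding monomial_funs_def by blast
qed

lemma subspace_multiplier: "funs.subspace {p. (\<lambda>v. p v * q v) \<in> funs.span T}"
proof (rule funs.subspaceI)
  show "0 \<in> {p. (\<lambda>v. p v * q v) \<in> funs.span T}"
    using funs.span_zero[of T] by (simp add: zero_fun_def)
next
  fix x y assume "x \<in> {p. (\<lambda>v. p v * q v) \<in> funs.span T}" "y \<in> {p. (\<lambda>v. p v * q v) \<in> funs.span T}"
  then have "(\<lambda>v. x v * q v) + (\<lambda>v. y v * q v) \<in> funs.span T" by (simp add: funs.span_add)
  moreover have "(\<lambda>v. x v * q v) + (\<lambda>v. y v * q v) = (\<lambda>v. (x + y) v * q v)"
    by (simp add: fun_eq_iff distrib_right)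
  ultimately show "x + y \<in> {p. (\<lambda>v. p v * q v) \<in> funs.span T}" by simp
next
  fix c x assume "x \<in> {p. (\<lambda>v. p v * q v) \<in> funs.span T}"
  then show "(\<lambda>v. to_ac c * x v) \<in> {p. (\<lambda>v. p v * q v) \<in> funs.span T}"
    using funs.span_scale[of "\<lambda>v. x v * q v" T c] by (simp add: mult.assoc)
qed

lemma span_monomial_funs_mult:
  fixes p q :: "(nat \<Rightarrow> 'a::field alg_closure) \<Rightarrow> 'a alg_closure"
  assumes "p \<in> funs.span (monomial_funs n a)" "q \<in> funs.span (monomial_funs n b)"
  shows "(\<lambda>v. p v * q v) \<in> funs.span (monomial_funs n (a + b))"
proof -
  have "monomial_funs n a \<subseteq> {p. (\<lambda>v. p v * q v) \<in> funs.span (monomial_funs n (a + b))}"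
  proof
    fix p :: "(nat \<Rightarrow> 'a alg_closure) \<Rightarrow> 'a alg_closure"
    assume p: "p \<in> monomial_funs n a"
    have "monomial_funs n b \<subseteq> {q. (\<lambda>v. q v * p v) \<in> funs.span (monomial_funs n (a + b))}"
      using monomial_funs_mult[OF _ p, of _ b] by (auto simp: add.commute intro: funs.span_base)
    from funs.span_minimal[OF this subspace_multiplier] assms(2)
    have "(\<lambda>v. q v * p v) \<in> funs.span (monomial_funs n (a + b))" by blast
    then show "p \<in> {p. (\<lambda>v. p v * q v) \<in> funs.span (monomial_funs n (a + b))}"
      by (simp add: mult.commute)
  qed
  from funs.span_minimal[OF this subspace_multiplier] assms(1) show ?thesis by blast
qed

lemma one_monomial_funs: "(\<lambda>_. 1) \<in> monomial_funs n d"
  unfolding monomial_funs_def by (rule image_eqI[of _ _ "\<lambda>i\<in>{..<n}. 0"]) auto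

lemma polyfuns_in_span:
  "p \<in> polyfuns n \<Longrightarrow> \<exists>d. p \<in> funs.span (monomial_funs n d)"
proof (induction rule: polyfuns.induct)
  case (const c)
  have "(\<lambda>v. to_ac c * 1) \<in> funs.span (monomial_funs n 0)"
    by (rule funs.span_scale[OF funs.span_base[OF one_monomial_funs]])
  then show ?case by auto
next
  case (coord i)
  have "(\<lambda>v :: nat \<Rightarrow> 'a alg_closure. v i) = (\<lambda>v. \<Prod>j<n. v j ^ (if j < n then if j = i then 1 else 0 else undefined))"
  proof
    fix v :: "nat \<Rightarrow> 'a alg_closure"
    have "(\<Prod>j<n. v j ^ (if j < n then if j = i then 1 else 0 else undefined)) = (\<Prod>j<n. if j = i then v j else 1)"
      by (rule prod.cong) auto
    then show "v i = (\<Prod>j<n. v j ^ (if j < n then if j = i then 1 else 0 else undefined))" using coord by simp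
  qed
  then have "(\<lambda>v :: nat \<Rightarrow> 'a alg_closure. v i) \<in> monomial_funs n 1"
    unfolding monomial_funs_def
    by (rule image_eqI[of _ _ "\<lambda>j. if j < n then if j = i then 1 else 0 else undefined"]) (auto simp: PiE_iff extensional_def)
  then show ?case using funs.span_base by blast
next
  case (add p q)
  then obtain a b where "p \<in> funs.span (monomial_funs n a)" "q \<in> funs.span (monomial_funs n b)" by blast
  then have "p \<in> funs.span (monomial_funs n (max a b))" "q \<in> funs.span (monomial_funs n (max a b))"
    using funs.span_mono[OF monomial_funs_mono[of a "max a b"]] funs.span_mono[OF monomial_funs_mono[of b "max a b"]] by auto
  then show ?case using funs.span_add[unfolded plus_fun_def] by blast
next
  case (mult p q)
  then show ?case using span_monomial_funs_mult by blast
qed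

lemma span_monomial_funs_power:
  assumes "p \<in> funs.span (monomial_funs n d)"
  shows "(\<lambda>v. p v ^ k) \<in> funs.span (monomial_funs n (k * d))"
proof (induction k)
  case 0
  show ?case using funs.span_base[OF one_monomial_funs] by simp
next
  case (Suc k)
  then show ?case using span_monomial_funs_mult[OF assms] by simp
qed

text \<open>
  If \<open>g i\<close> has degree at most \<open>d i\<close> in each variable and \<open>D = \<Sum>i. d i\<close>, then the \<open>(N + 1) ^ (n + 1)\<close>
  products of the \<open>g i\<close> with all exponents at most \<open>N\<close> lie in the span of the \<open>(D N + 1) ^ n\<close> monomials
  with exponents at most \<open>D N\<close>. For large \<open>N\<close> there are more products than the dimension of this span.\<close>

lemma polyfuns_algebraically_dependent:
  fixes g :: "nat \<Rightarrow> (nat \<Rightarrow> 'a::field alg_closure) \<Rightarrow> 'a alg_closure"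
  assumes g: "\<And>i. i < Suc n \<Longrightarrow> g i \<in> polyfuns n"
  obtains N c e where "e \<in> {..<Suc n} \<rightarrow>\<^sub>E {..N}" "c e \<noteq> 0"
    "\<And>v. (\<Sum>e\<in>{..<Suc n} \<rightarrow>\<^sub>E {..N}. to_ac (c e) * (\<Prod>i<Suc n. g i v ^ e i)) = 0"
proof -
  have "\<forall>i. \<exists>d. i < Suc n \<longrightarrow> g i \<in> funs.span (monomial_funs n d)" using polyfuns_in_span[OF g] by blast
  then obtain d where d: "\<And>i. i < Suc n \<Longrightarrow> g i \<in> funs.span (monomial_funs n (d i))" by metis
  define D where "D = (\<Sum>i<Suc n. d i)"
  \<comment> \<open>With this \<open>N\<close>, \<open>(D N + 1) ^ n \<le> ((D + 1) (N + 1)) ^ n = N (N + 1) ^ n < (N + 1) ^ (n + 1)\<close>.\<close>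
  define N where "N = (D + 1) ^ n"
  define E where "E = ({..<Suc n} \<rightarrow>\<^sub>E {..N} :: (nat \<Rightarrow> nat) set)"
  define M where "M e v = (\<Prod>i<Suc n. g i v ^ e i)" for e :: "nat \<Rightarrow> nat" and v
  have fin: "finite E" by (simp add: E_def finite_PiE)
  have M_span: "M e \<in> funs.span (monomial_funs n (D * N))" if "e \<in> E" for e
  proof -
    have "(\<lambda>v. \<Prod>i<l. g i v ^ e i) \<in> funs.span (monomial_funs n (\<Sum>i<l. e i * d i))" if "l \<le> Suc n" for l
      using that
    proof (induction l)
      case 0
      show ?case using funs.span_base[OF one_monomial_funs] by simp
    next
      case (Suc l)
      then show ?case
        using span_monomial_funs_mult[OF Suc.IH span_monomial_funs_power[OF d, of l "e l"]] by simp
    qed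
    then have "M e \<in> funs.span (monomial_funs n (\<Sum>i<Suc n. e i * d i))" unfolding M_def by blast
    moreover have "(\<Sum>i<Suc n. e i * d i) \<le> (\<Sum>i<Suc n. N * d i)"
      by (rule sum_mono) (use that in \<open>auto simp: E_def PiE_iff\<close>)
    then have "(\<Sum>i<Suc n. e i * d i) \<le> D * N" by (simp only: D_def sum_distrib_left[symmetric] mult.commute)
    ultimately show ?thesis using funs.span_mono[OF monomial_funs_mono] by blast
  qed
  have "card (monomial_funs n (D * N) :: ((nat \<Rightarrow> 'a alg_closure) \<Rightarrow> _) set) \<le> (D * N + 1) ^ n" by (rule card_monomial_funs)
  also have "\<dots> \<le> ((D + 1) * (N + 1)) ^ n" by (rule power_mono) auto
  also have "\<dots> = N * (N + 1) ^ n" by (simp only: power_mult_distrib N_def)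
  also have "\<dots> < (N + 1) ^ Suc n" by simp
  also have "\<dots> = card E" by (simp add: E_def card_PiE)
  finally have card: "card (monomial_funs n (D * N) :: ((nat \<Rightarrow> 'a alg_closure) \<Rightarrow> _) set) < card E" .
  have "\<exists>c e. e \<in> E \<and> c e \<noteq> 0 \<and> (\<forall>v. (\<Sum>e\<in>E. to_ac (c e) * M e v) = 0)"
  proof (cases "inj_on M E")
    case True
    have "\<not> funs.independent (M ` E)"
    proof
      assume "funs.independent (M ` E)"
      then have "card (M ` E) \<le> card (monomial_funs n (D * N) :: ((nat \<Rightarrow> 'a alg_closure) \<Rightarrow> _) set)"
        using M_span funs.independent_span_bound[OF finite_monomial_funs] by blast
      then show False using card by (simp add: card_image[OF True])
    qed
    then obtain f x where f: "(\<Sum>x\<in>M ` E. (\<lambda>v. to_ac (f x) * x v)) = 0" "x \<in> M ` E" "f x \<noteq> 0"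
      using funs.independent_if_scalars_zero[of "M ` E"] fin by blast
    obtain e where e: "e \<in> E" "x = M e" using f(2) by blast
    have "(\<Sum>e\<in>E. to_ac (f (M e)) * M e v) = 0" for v
    proof -
      have "(\<Sum>x\<in>M ` E. (\<lambda>v. to_ac (f x) * x v)) v = (\<Sum>e\<in>E. (\<lambda>v. to_ac (f (M e)) * M e v)) v"
        by (simp add: sum.reindex[OF True])
      also have "\<dots> = (\<Sum>e\<in>E. to_ac (f (M e)) * M e v)" by (induction rule: finite_induct[OF fin]) auto
      finally show ?thesis using f(1) by simp
    qed
    then show ?thesis using e f(3) by (intro exI[of _ "\<lambda>e. f (M e)"] exI[of _ e]) simp
  next
    \<comment> \<open>Two equal products are a relation as well, but the set \<open>M ` E\<close> identifies them.\<close>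
    case False
    then obtain e e' where e: "e \<in> E" "e' \<in> E" "M e = M e'" "e \<noteq> e'" by (auto simp: inj_on_def)
    define c :: "(nat \<Rightarrow> nat) \<Rightarrow> 'a" where "c x = (if x = e then 1 else 0) - (if x = e' then 1 else 0)" for x
    have "(\<Sum>x\<in>E. to_ac (c x) * M x v) = 0" for v
    proof -
      have "(\<Sum>x\<in>E. to_ac (c x) * M x v) = (\<Sum>x\<in>E. (if x = e then M x v else 0) - (if x = e' then M x v else 0))"
        by (rule sum.cong) (auto simp: c_def)
      also have "\<dots> = M e v - M e' v" using e fin by (simp add: sum_subtractf)
      finally show ?thesis using e(3) by simp
    qed
    then show ?thesis using e by (intro exI[of _ c] exI[of _ e]) (simp add: c_def)
  qed
  then show thesis using that unfolding E_def M_def by blast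
qed

text \<open>
  Each member of the chain is closed, so some polynomial function vanishes on it but not on the
  next member. A chain of length more than \<open>n\<close> would provide \<open>n + 1\<close> independent functions.\<close>

lemma chain_length_le:
  fixes C :: "nat \<Rightarrow> (nat \<Rightarrow> 'a::field alg_closure) set"
  assumes "\<And>i. i \<le> k \<Longrightarrow> closedin (tp (sub (affine_space n) S)) (C i)"
    and "\<And>i. i \<le> k \<Longrightarrow> irreducible_in (tp (sub (affine_space n) S)) (C i)" "\<And>i. i < k \<Longrightarrow> C i \<subset> C (Suc i)"
  shows "k \<le> n"
proof (rule ccontr)
  assume "\<not> k \<le> n"
  let ?X = "sub (affine_space n :: (_, 'a) fspace) S"
  have X: "space_with_functions ?X" by (rule space_with_functions_sub[OF space_with_functions_affine])
  have "\<forall>i. \<exists>g. i < Suc n \<longrightarrow> g \<in> polyfuns n \<and> (\<forall>x\<in>C i. g x = 0) \<and> (\<exists>x\<in>C (Suc i). g x \<noteq> 0)"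
  proof
    fix i
    show "\<exists>g. i < Suc n \<longrightarrow> g \<in> polyfuns n \<and> (\<forall>x\<in>C i. g x = 0) \<and> (\<exists>x\<in>C (Suc i). g x \<noteq> 0)"
    proof (cases "i < Suc n")
      case True
      then have i: "i < k" "i \<le> k" "Suc i \<le> k" using \<open>\<not> k \<le> n\<close> by auto
      obtain x where x: "x \<in> C (Suc i)" "x \<notin> C i" using assms(3)[OF i(1)] by blast
      have sub: "C i \<subseteq> pts ?X" "C (Suc i) \<subseteq> pts ?X"
        using closedin_subset[OF assms(1)] i by auto
      have "openin (tp ?X) (pts ?X - C i)" using assms(1)[OF i(2)] by (simp add: closedin_def)
      then obtain T where T: "openin (tp (affine_space n :: (_, 'a) fspace)) T" "pts ?X - C i = T \<inter> S"
        unfolding openin_sub by blast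
      have "x \<in> T" using T(2) x sub by blast
      obtain p where p: "p \<in> polyfuns n" "p x \<noteq> 0" "\<And>v. v \<in> affine_pts n \<Longrightarrow> p v \<noteq> 0 \<Longrightarrow> v \<in> T"
        using affine_nbhdE[OF T(1) \<open>x \<in> T\<close>] by blast
      have "p y = 0" if "y \<in> C i" for y
      proof (rule ccontr)
        assume "p y \<noteq> 0"
        moreover have y: "y \<in> affine_pts n" "y \<in> S" using that sub(1) by auto
        ultimately have "y \<in> T \<inter> S" using p(3) by blast
        then show False using T(2) that by blast
      qed
      then show ?thesis using p x by blast
    qed blast
  qed
  from choice[OF this] obtain g where "\<forall>i. i < Suc n \<longrightarrow>
      g i \<in> polyfuns n \<and> (\<forall>x\<in>C i. g i x = 0) \<and> (\<exists>x\<in>C (Suc i). g i x \<noteq> 0)" by (rule exE)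
  note g = this[rule_format, THEN conjunct1] this[rule_format, THEN conjunct2, THEN conjunct1, rule_format]
    this[rule_format, THEN conjunct2, THEN conjunct2]
  obtain N c e where *: "e \<in> {..<Suc n} \<rightarrow>\<^sub>E {..N}" "c e \<noteq> 0"
    "\<And>v. (\<Sum>e\<in>{..<Suc n} \<rightarrow>\<^sub>E {..N}. to_ac (c e) * (\<Prod>i<Suc n. g i v ^ e i)) = 0"
    by (rule polyfuns_algebraically_dependent[OF g(1)]) (assumption, rule that)
  have "c e = 0"
  proof (rule chain_functions_independent[OF X, where m = "Suc n" and C = C and g = g
        and E = "{..<Suc n} \<rightarrow>\<^sub>E {..N}" and c = c and e = e])
    show "irreducible_in (tp ?X) (C i)" if "i \<le> Suc n" for i using assms(2) that \<open>\<not> k \<le> n\<close> by simp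
    show "C i \<subseteq> C (Suc i)" if "i < Suc n" for i using assms(3)[of i] that \<open>\<not> k \<le> n\<close> by auto
    show "g i \<in> reg ?X (pts ?X)" if "i < Suc n" for i
      using morphism_pullback[OF morphism_inclusion[OF space_with_functions_affine] polyfuns_reg_affine[OF g(1)[OF that]]] .
    show "inj_on (\<lambda>e. restrict e {..<Suc n}) ({..<Suc n} \<rightarrow>\<^sub>E {..N})"
      by (rule inj_onI) (metis PiE_restrict)
    show "finite ({..<Suc n} \<rightarrow>\<^sub>E {..N})" by (simp add: finite_PiE)
    show "(\<Sum>e\<in>{..<Suc n} \<rightarrow>\<^sub>E {..N}. to_ac (c e) * (\<Prod>i<Suc n. g i x ^ e i)) = 0" for x by (rule *(3))
  qed (fact g(2) g(3) *(1))+
  then show False using *(2) by simp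
qed

text \<open>
  The lower bound comes from the flag of coordinate subspaces through \<open>u\<close>. They are closed over the
  ground field because the coordinates of \<open>u\<close> lie in it.\<close>

theorem dimension_open_affine:
  fixes S :: "(nat \<Rightarrow> 'a::field_char_0 alg_closure) set"
  assumes S: "openin (tp (affine_space n)) S" and u: "u \<in> S" "range u \<subseteq> range to_ac"
  shows "dimension (sub (affine_space n) S) = enat n"
proof (rule antisym)
  let ?X = "sub (affine_space n :: (_, 'a) fspace) S"
  have X: "space_with_functions ?X" by (rule space_with_functions_sub[OF space_with_functions_affine])
  have SA: "S \<subseteq> affine_pts n" using openin_subset[OF S] by simp
  then have pX: "pts ?X = S" by auto
  show "dimension ?X \<le> enat n"
    unfolding dimension_def
  proof (rule Sup_least)
    fix d assume "d \<in> {enat k | k. \<exists>C. (\<forall>i\<le>k. closedin (tp ?X) (C i) \<and> irreducible_in (tp ?X) (C i)) \<and> (\<forall>i<k. C i \<subset> C (Suc i))}"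
    then obtain k C where "d = enat k" and C: "\<forall>i\<le>k. closedin (tp ?X) (C i) \<and> irreducible_in (tp ?X) (C i)"
      "\<forall>i<k. C i \<subset> C (Suc i)" by blast
    moreover have "k \<le> n" by (rule chain_length_le[of k n S C]) (use C in simp_all)
    ultimately show "d \<le> enat n" by simp
  qed
  define L where "L i = {v \<in> affine_pts n. \<forall>j<n. i \<le> j \<longrightarrow> v j = u j}" for i
  have "closedin (tp ?X) (L i \<inter> S) \<and> irreducible_in (tp ?X) (L i \<inter> S)" for i
  proof
    have reg: "(\<lambda>v. if i \<le> j then v j else 0) \<in> reg ?X (pts ?X)" "(\<lambda>v. if i \<le> j then u j else 0) \<in> reg ?X (pts ?X)" for j
    proof -
      obtain c where "u j = to_ac c" using u(2) by blast
      then show "(\<lambda>v. if i \<le> j then u j else 0) \<in> reg ?X (pts ?X)"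
        using reg_const[OF X openin_topspace, of c] reg_0[OF X openin_topspace] by simp
      show "(\<lambda>v. if i \<le> j then v j else 0) \<in> reg ?X (pts ?X)"
        by (cases "i \<le> j") (use morphism_pullback[OF morphism_inclusion[OF space_with_functions_affine] coord_reg_affine] reg_0[OF X openin_topspace] in simp_all)
    qed
    have "L i \<inter> S = {v \<in> pts ?X. \<forall>j<n. (if i \<le> j then v j else 0) = (if i \<le> j then u j else 0)}"
      unfolding pX using SA by (auto simp: L_def)
    then show "closedin (tp ?X) (L i \<inter> S)"
      using closedin_equalizer[OF X, of n "\<lambda>v j. if i \<le> j then v j else 0" "\<lambda>v j. if i \<le> j then u j else 0"] reg by simp
    show "irreducible_in (tp ?X) (L i \<inter> S)"
    proof (rule irreducible_in_linear[OF _ _ S])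
      have "u \<in> L i \<inter> S" using u(1) SA by (auto simp: L_def)
      then show "L i \<inter> S \<noteq> {}" by blast
    qed (auto simp: L_def affine_pts_def)
  qed
  moreover have "L i \<inter> S \<subset> L (Suc i) \<inter> S" if "i < n" for i
  proof -
    obtain p where p: "p \<in> polyfuns n" "p u \<noteq> 0" "\<And>v. v \<in> affine_pts n \<Longrightarrow> p v \<noteq> 0 \<Longrightarrow> v \<in> S"
      using affine_nbhdE[OF S u(1)] by blast
    define w where "w = u(i := u i + 1)"
    obtain P where P: "\<And>t. p (\<lambda>j. u j + t * (w j - u j)) = poly P t" using polyfuns_on_line[OF p(1)] by blast
    \<comment> \<open>The factor \<open>x\<close> forces a parameter \<open>t \<noteq> 0\<close>, that is, a point of \<open>S\<close> on the line other than \<open>u\<close>.\<close>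
    have "poly P 0 \<noteq> 0" using P[of 0] p(2) by simp
    then have "P * [:0, 1:] \<noteq> 0" by auto
    then obtain t where t: "poly (P * [:0, 1:]) t \<noteq> 0" using poly_all_0_iff_0 by blast
    define v where "v = (\<lambda>j. u j + t * (w j - u j))"
    have v: "v = u(i := u i + t)" by (auto simp: v_def w_def)
    have "u \<in> affine_pts n" using SA u(1) by blast
    then have "v \<in> affine_pts n" using that by (auto simp: v affine_pts_def)
    moreover from this have "v \<in> S" using p(3) P[of t] t by (simp add: v_def)
    ultimately have "v \<in> L (Suc i) \<inter> S" "v \<notin> L i" using t that by (auto simp: L_def v)
    moreover have "L i \<subseteq> L (Suc i)" by (auto simp: L_def)
    ultimately show ?thesis by blast
  qed
  ultimately show "enat n \<le> dimension ?X"
    unfolding dimension_def by (intro Sup_upper CollectI exI[of _ n] conjI exI[of _ "\<lambda>i. L i \<inter> S"]) auto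
qed

section \<open>Coordinates\<close>

text \<open>
  The maps \<open>\<kappa>\<close> and \<open>\<Lambda>\<close> are inverse isomorphisms between \<open>X\<close> and the part of the affine space in \<open>T\<close>.
  None of \<open>T\<close>, \<open>\<kappa>\<close> and \<open>\<Lambda>\<close> has to refer to \<open>n\<close>, so that the same coordinates can be used on all members
  of an ascending sequence of spaces.\<close>

definition coordinates ::
  "('p, 'a::field) fspace \<Rightarrow> nat \<Rightarrow> (nat \<Rightarrow> 'a alg_closure) set \<Rightarrow>
   ('p \<Rightarrow> nat \<Rightarrow> 'a alg_closure) \<Rightarrow> ((nat \<Rightarrow> 'a alg_closure) \<Rightarrow> 'p) \<Rightarrow> bool" where
  "coordinates X n T \<kappa> \<Lambda> \<longleftrightarrow> space_with_functions X \<and>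
     morphism X (sub (affine_space n) T) \<kappa> \<and> morphism (sub (affine_space n) T) X \<Lambda> \<and>
     (\<forall>x\<in>pts X. \<Lambda> (\<kappa> x) = x) \<and> (\<forall>v\<in>affine_pts n \<inter> T. \<kappa> (\<Lambda> v) = v)"

lemma reg_coord: "morphism X (affine_space n) \<phi> \<Longrightarrow> (\<lambda>x. \<phi> x i) \<in> reg X (pts X)"
  using morphism_pullback[OF _ coord_reg_affine] .

lemma reg_sub_restrict:
  assumes "openin (tp X) U" "f \<in> reg X U"
  shows "f \<in> reg (sub X U) (pts (sub X U))"
  unfolding mem_reg_sub using assms by (intro ballI exI[of _ U] exI[of _ f]) simp

lemma affine_pts_mono: "n \<le> m \<Longrightarrow> affine_pts n \<subseteq> affine_pts m"
  by (auto simp: affine_pts_def)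

context
  fixes X :: "('p, 'a::field) fspace" and n T \<kappa> \<Lambda>
  assumes co: "coordinates X n T \<kappa> \<Lambda>"
begin

lemma coordinatesD:
  shows "space_with_functions X" "morphism X (sub (affine_space n) T) \<kappa>"
    "morphism (sub (affine_space n) T) X \<Lambda>"
    "\<And>x. x \<in> pts X \<Longrightarrow> \<Lambda> (\<kappa> x) = x" "\<And>v. v \<in> affine_pts n \<Longrightarrow> v \<in> T \<Longrightarrow> \<kappa> (\<Lambda> v) = v"
  using co by (auto simp: coordinates_def)

lemma coordinates_morphism: "morphism X (affine_space n) \<kappa>"
  using morphism_comp[OF coordinatesD(2) morphism_inclusion[OF space_with_functions_affine]]
  by (simp add: comp_def)

lemma reg_coordinates: "(\<lambda>x. \<kappa> x i) \<in> reg X (pts X)"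
  by (rule reg_coord[OF coordinates_morphism])

lemma coordinates_in: "x \<in> pts X \<Longrightarrow> \<kappa> x \<in> affine_pts n" "x \<in> pts X \<Longrightarrow> \<kappa> x \<in> T"
  using morphismD(1)[OF coordinatesD(2)] by auto

lemma coordinates_out: "v \<in> affine_pts n \<Longrightarrow> v \<in> T \<Longrightarrow> \<Lambda> v \<in> pts X"
  using morphismD(1)[OF coordinatesD(3)] by auto

lemma pts_coordinates: "pts X = \<Lambda> ` (affine_pts n \<inter> T)"
  using coordinates_in coordinates_out coordinatesD(4) by force

lemma morphism_into_coordinates:
  assumes Z: "space_with_functions Z" and "\<And>z. z \<in> pts Z \<Longrightarrow> c z \<in> affine_pts n" "\<And>z. z \<in> pts Z \<Longrightarrow> c z \<in> T"
    and "\<And>i. i < n \<Longrightarrow> (\<lambda>z. c z i) \<in> reg Z (pts Z)" and "\<And>z. z \<in> pts Z \<Longrightarrow> \<phi> z = \<Lambda> (c z)"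
  shows "morphism Z X \<phi>"
proof -
  have "morphism Z (sub (affine_space n) T) c"
    by (intro morphism_into_sub morphism_into_affine Z assms)
  from morphism_comp[OF this coordinatesD(3)] show ?thesis
    by (rule morphism_cong[OF Z]) (simp add: assms)
qed

lemma coordinates_sub: "coordinates (sub X {x \<in> pts X. \<kappa> x \<in> S}) n (T \<inter> S) \<kappa> \<Lambda>"
  unfolding coordinates_def
proof (intro conjI ballI)
  let ?U = "{x \<in> pts X. \<kappa> x \<in> S}"
  show U: "space_with_functions (sub X ?U)" by (rule space_with_functions_sub[OF coordinatesD(1)])
  show "morphism (sub X ?U) (sub (affine_space n) (T \<inter> S)) \<kappa>"
    by (rule morphism_into_sub[OF U morphism_from_sub[OF coordinatesD(1) coordinates_morphism]])
      (auto dest: coordinates_in)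
  have A: "space_with_functions (sub (affine_space n :: (_, 'a) fspace) (T \<inter> S))"
    by (rule space_with_functions_sub[OF space_with_functions_affine])
  have "morphism (sub (affine_space n) (T \<inter> S)) (sub (affine_space n) T) (\<lambda>v :: nat \<Rightarrow> 'a alg_closure. v)"
    by (rule morphism_into_sub[OF A morphism_inclusion[OF space_with_functions_affine]]) auto
  from morphism_comp[OF this coordinatesD(3)]
  have "morphism (sub (affine_space n) (T \<inter> S)) X \<Lambda>" by (simp add: comp_def)
  then show "morphism (sub (affine_space n) (T \<inter> S)) (sub X ?U) \<Lambda>"
    by (rule morphism_into_sub[OF A]) (auto simp: coordinatesD(5) coordinates_out)
qed (auto simp: coordinatesD)

text \<open>
  Morphisms over the ground field map points over it to points over it.\<close>

lemma rat_pts_coordinates: "rat_pts X = {x \<in> pts X. range (\<kappa> x) \<subseteq> range to_ac}"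
proof -
  have rat: "\<phi> y \<in> rat_pts Z" if \<phi>: "morphism Y Z \<phi>" and y: "y \<in> rat_pts Y"
    for Y :: "('r, 'a) fspace" and Z :: "('s, 'a) fspace" and \<phi> y
  proof -
    have y': "y \<in> pts Y" using y by (simp add: rat_pts_def)
    have "f (\<phi> y) \<in> range to_ac" if "openin (tp Z) W" "\<phi> y \<in> W" "f \<in> reg Z W" for W f
    proof -
      have "y \<in> {y \<in> pts Y. \<phi> y \<in> W}" using y' that by simp
      then have "(f \<circ> \<phi>) y \<in> range to_ac"
        using y morphismD(2,3)[OF \<phi> that(1)] that(3) unfolding rat_pts_def by blast
      then show ?thesis by simp
    qed
    then show ?thesis using morphismD(1)[OF \<phi> y'] unfolding rat_pts_def by blast
  qed
  have eq: "v \<in> rat_pts (sub (affine_space n) T) \<longleftrightarrow> v \<in> affine_pts n \<inter> T \<and> range v \<subseteq> range to_ac" for v :: "nat \<Rightarrow> 'a alg_closure"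
    by (auto simp: rat_pts_sub rat_pts_affine)
  show ?thesis
  proof (intro equalityI subsetI)
    fix x assume x: "x \<in> rat_pts X"
    then have "x \<in> pts X" by (simp add: rat_pts_def)
    moreover have "range (\<kappa> x) \<subseteq> range to_ac" using rat[OF coordinatesD(2) x] unfolding eq by blast
    ultimately show "x \<in> {x \<in> pts X. range (\<kappa> x) \<subseteq> range to_ac}" by blast
  next
    fix x assume "x \<in> {x \<in> pts X. range (\<kappa> x) \<subseteq> range to_ac}"
    then have x: "x \<in> pts X" "range (\<kappa> x) \<subseteq> range to_ac" by blast+
    then have "\<kappa> x \<in> rat_pts (sub (affine_space n) T)" unfolding eq using coordinates_in by blast
    from rat[OF coordinatesD(3) this] show "x \<in> rat_pts X" using coordinatesD(4)[OF x(1)] by simp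
  qed
qed

text \<open>
  The open subset of \<open>X\<close> where \<open>p \<noteq> 0\<close> becomes closed in an affine space with one more coordinate if
  this coordinate is given the value \<open>1 / p\<close>. The diagonal is closed because coordinates separate
  points.\<close>

lemma variety_coordinates:
  assumes P: "finite P" "P \<subseteq> polyfuns n" and T: "\<And>v. v \<in> affine_pts n \<Longrightarrow> v \<in> T \<longleftrightarrow> (\<exists>p\<in>P. p v \<noteq> 0)"
  shows "variety X"
proof -
  note X = coordinatesD(1)
  define U where "U p = {x \<in> pts X. p (\<kappa> x) \<noteq> 0}" for p :: "(nat \<Rightarrow> 'a alg_closure) \<Rightarrow> 'a alg_closure"
  have reg_p: "(\<lambda>x. p (\<kappa> x)) \<in> reg X (pts X)" if "p \<in> P" for p
    using that P(2) by (intro reg_polyfuns[OF X openin_topspace _ reg_coordinates]) auto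
  have openU: "openin (tp X) (U p)" if "p \<in> P" for p
    unfolding U_def using openin_nonzero[OF X openin_topspace reg_p[OF that]] by simp
  have "affine_variety (sub X (U p))" if p: "p \<in> P" for p
    unfolding affine_variety_def
  proof (intro exI conjI)
    let ?A = "affine_space (Suc n) :: (_, 'a) fspace"
    let ?cut = "\<lambda>w :: nat \<Rightarrow> 'a alg_closure. w(n := 0)"
    have pn: "p \<in> polyfuns n" using p P(2) by blast
    \<comment> \<open>The bounded quantifier brings the single equation into the form of \<open>closedin_equalizer\<close>.\<close>
    define C where "C = {w \<in> pts ?A. \<forall>i<1::nat. p (?cut w) * w n = 1}"
    have cut: "morphism ?A (affine_space n) ?cut"
    proof (rule morphism_into_affine[OF space_with_functions_affine])
      show "(\<lambda>w. ?cut w i) \<in> reg ?A (pts ?A)" if "i < n" for i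
        using coord_reg_affine[of i "Suc n"] that by simp
    qed (auto simp: affine_pts_def)
    have "(\<lambda>w. p (?cut w)) \<in> reg ?A (pts ?A)"
      using morphism_pullback[OF cut polyfuns_reg_affine[OF pn]] .
    then have "(\<lambda>w. p (?cut w) * w n) \<in> reg ?A (pts ?A)"
      by (rule reg_mult[OF space_with_functions_affine openin_topspace _ coord_reg_affine])
    then show "closedin (tp ?A) C"
      unfolding C_def
      by (rule closedin_equalizer[OF space_with_functions_affine]) (rule reg_1[OF space_with_functions_affine openin_topspace])
    let ?\<phi> = "\<lambda>x. (\<kappa> x)(n := inverse (p (\<kappa> x)))"
    have XU: "space_with_functions (sub X (U p))" by (rule space_with_functions_sub[OF X])
    have AC: "space_with_functions (sub ?A C)" by (rule space_with_functions_sub[OF space_with_functions_affine])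
    have cut_id: "?cut (\<kappa> x) = \<kappa> x" if "x \<in> pts X" for x
      using coordinates_in(1)[OF that] by (auto simp: affine_pts_def)
    show "isomorphism (sub X (U p)) (sub ?A C) ?\<phi>"
    proof (rule isomorphismI)
      have "(\<lambda>x. inverse (p (\<kappa> x))) \<in> reg (sub X (U p)) (pts (sub X (U p)))"
        using reg_sub_restrict[OF openU[OF p]] reg_inverse[OF X openin_topspace reg_p[OF p]] by (simp add: U_def)
      moreover have "(\<lambda>x. \<kappa> x i) \<in> reg (sub X (U p)) (pts (sub X (U p)))" for i
        using reg_coord[OF morphism_from_sub[OF X coordinates_morphism]] .
      ultimately have "(\<lambda>x. ?\<phi> x i) \<in> reg (sub X (U p)) (pts (sub X (U p)))" for i
        by (cases "i = n") simp_all
      then have "morphism (sub X (U p)) ?A ?\<phi>"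
        using coordinates_in(1) by (intro morphism_into_affine[OF XU]) (auto simp: affine_pts_def)
      then show "morphism (sub X (U p)) (sub ?A C) ?\<phi>"
        by (rule morphism_into_sub[OF XU])
          (use coordinates_in(1) cut_id in \<open>auto simp: C_def U_def affine_pts_def\<close>)
      have "morphism (sub ?A C) (affine_space n) ?cut"
        by (rule morphism_from_sub[OF space_with_functions_affine cut])
      moreover have in_T: "?cut w \<in> affine_pts n" "?cut w \<in> T" if "w \<in> C" for w
      proof -
        show *: "?cut w \<in> affine_pts n" using that by (auto simp: C_def affine_pts_def)
        show "?cut w \<in> T" unfolding T[OF *] using that p by (intro bexI[of _ p]) (auto simp: C_def)
      qed
      ultimately have "morphism (sub ?A C) (sub (affine_space n) T) ?cut"
        by (intro morphism_into_sub[OF AC]) auto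
      from morphism_comp[OF this coordinatesD(3)]
      show "morphism (sub ?A C) (sub X (U p)) (\<Lambda> \<circ> ?cut)"
      proof (rule morphism_into_sub[OF AC])
        fix w assume "w \<in> pts (sub ?A C)"
        then have w: "w \<in> C" by simp
        then have "p (?cut w) \<noteq> 0" by (auto simp: C_def)
        then show "(\<Lambda> \<circ> ?cut) w \<in> U p"
          using in_T[OF w] by (simp add: U_def coordinatesD(5) coordinates_out)
      qed
      show "(\<Lambda> \<circ> ?cut) (?\<phi> x) = x" if "x \<in> pts (sub X (U p))" for x
        using that cut_id[of x] coordinatesD(4)[of x] by simp
      fix w assume "w \<in> pts (sub ?A C)"
      then have w: "w \<in> C" by simp
      then have "p (?cut w) * w n = 1" by (simp add: C_def)
      then have "inverse (p (?cut w)) = w n" by (rule inverse_unique)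
      then show "?\<phi> ((\<Lambda> \<circ> ?cut) w) = w"
        using in_T[OF w] by (simp add: coordinatesD(5))
    qed
  qed
  moreover have "\<Union> (U ` P) = pts X"
    using T coordinates_in by (auto simp: U_def)
  ultimately have cover: "\<exists>\<U>. finite \<U> \<and> \<Union>\<U> = pts X \<and> (\<forall>U\<in>\<U>. openin (tp X) U \<and> affine_variety (sub X U))"
    using P(1) openU by (intro exI[of _ "U ` P"]) auto
  have XX: "space_with_functions (prod_space X X)" by (rule space_with_functions_prod[OF X X])
  have "closedin (tp (prod_space X X)) {z \<in> pts (prod_space X X). \<forall>i<n. \<kappa> (fst z) i = \<kappa> (snd z) i}"
    by (intro closedin_equalizer[OF XX] morphism_pullback[OF morphism_fst[OF X X] reg_coordinates]
        morphism_pullback[OF morphism_snd[OF X X] reg_coordinates])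
  also have "{z \<in> pts (prod_space X X). \<forall>i<n. \<kappa> (fst z) i = \<kappa> (snd z) i} = {(x, x) | x. x \<in> pts X}"
  proof -
    have "x = y" if "x \<in> pts X" "y \<in> pts X" "\<forall>i<n. \<kappa> x i = \<kappa> y i" for x y
    proof -
      have "\<kappa> x = \<kappa> y"
      proof
        show "\<kappa> x i = \<kappa> y i" for i
          using that coordinates_in(1)[of x] coordinates_in(1)[of y] by (cases "i < n") (auto simp: affine_pts_def)
      qed
      then show ?thesis using coordinatesD(4) that by metis
    qed
    then show ?thesis by (auto simp: pts_prod_space[OF X X])
  qed
  finally have "closedin (tp (prod_space X X)) {(x, x) | x. x \<in> pts X}" .
  moreover have "reg X U = reg (sub X (pts X)) U" if "openin (tp X) U" for U
    using X that unfolding space_with_functions_def by blast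
  ultimately show ?thesis using cover unfolding variety_def by blast
qed

end

lemma closed_embeddingI:
  assumes X: "space_with_functions X" and \<phi>: "morphism X Y \<phi>" and closed: "closedin (tp Y) (\<phi> ` pts X)"
    and \<psi>: "morphism (sub Y (\<phi> ` pts X)) X \<psi>" and inv: "\<And>x. x \<in> pts X \<Longrightarrow> \<psi> (\<phi> x) = x"
  shows "closed_embedding X Y \<phi>"
  unfolding closed_embedding_def
  using closed by (intro conjI isomorphismI[OF morphism_into_sub[OF X \<phi>] \<psi>]) (auto simp: inv)

text \<open>
  Inside \<open>Y\<close>, the points of \<open>X\<close> are those whose last coordinate vanishes.\<close>

lemma coordinates_closed_embedding:
  assumes X: "coordinates X n T \<kappa> \<Lambda>" and Y: "coordinates Y (Suc n) T \<kappa> \<Lambda>"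
  shows "pts X \<subseteq> pts Y" "closed_embedding X Y (\<lambda>x. x)"
proof -
  show sub: "pts X \<subseteq> pts Y"
    using affine_pts_mono[of n "Suc n"] by (auto simp: pts_coordinates[OF X] pts_coordinates[OF Y])
  note X' = coordinatesD(1)[OF X] and Y' = coordinatesD(1)[OF Y]
  show "closed_embedding X Y (\<lambda>x. x)"
  proof (rule closed_embeddingI[OF X'])
    show "morphism X Y (\<lambda>x. x)"
      by (rule morphism_into_coordinates[OF Y X', of \<kappa>])
        (use affine_pts_mono[of n "Suc n"] coordinates_in[OF X] reg_coordinates[OF X] coordinatesD(4)[OF X] in auto)
    have "pts X = {y \<in> pts Y. \<kappa> y n = 0}"
    proof (intro equalityI subsetI)
      fix x assume "x \<in> pts X"
      then show "x \<in> {y \<in> pts Y. \<kappa> y n = 0}"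
        using sub coordinates_in(1)[OF X] by (auto simp: affine_pts_def)
    next
      fix y assume y: "y \<in> {y \<in> pts Y. \<kappa> y n = 0}"
      then have "\<kappa> y \<in> affine_pts n" using coordinates_in(1)[OF Y, of y]
        by (auto simp: affine_pts_def) (metis le_antisym not_less_eq_eq)
      then have "\<Lambda> (\<kappa> y) \<in> pts X" using y coordinates_in(2)[OF Y] by (intro coordinates_out[OF X]) auto
      then show "y \<in> pts X" using y coordinatesD(4)[OF Y] by simp
    qed
    then show closed: "closedin (tp Y) ((\<lambda>x. x) ` pts X)"
      using closedin_zeros[OF Y' reg_coordinates[OF Y, of n]] by simp
    show "morphism (sub Y ((\<lambda>x. x) ` pts X)) X (\<lambda>x. x)"
      by (rule morphism_into_coordinates[OF X space_with_functions_sub[OF Y'], of _ \<kappa>])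
        (use coordinates_in[OF X] coordinatesD(4)[OF X] reg_coord[OF morphism_from_sub[OF Y' coordinates_morphism[OF Y]]] in auto)
  qed simp
qed

lemma coordinates_affine:
  "coordinates (affine_space n) n UNIV (\<lambda>v. v) (\<lambda>v. v)"
  unfolding coordinates_def
  by (auto intro: space_with_functions_affine morphism_into_sub morphism_id morphism_from_sub)

lemma ind_variety_coordinates:
  assumes co: "\<And>n. coordinates (X n) (n + k) T \<kappa> \<Lambda>"
    and P: "\<And>n. finite (P n)" "\<And>n. P n \<subseteq> polyfuns (n + k)"
    and T: "\<And>n v. v \<in> affine_pts (n + k) \<Longrightarrow> v \<in> T \<longleftrightarrow> (\<exists>p\<in>P n. p v \<noteq> 0)"
  shows "ind_variety X"
proof -
  have "coordinates (X (Suc n)) (Suc (n + k)) T \<kappa> \<Lambda>" for n using co[of "Suc n"] by simp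
  then show ?thesis
    unfolding ind_variety_def
    using variety_coordinates[OF co P T] coordinates_closed_embedding[OF co] by blast
qed

text \<open>
  In the coordinates, \<open>X\<close> is a non-empty open subset of an affine space.\<close>

lemma irreducible_coordinates:
  fixes X :: "('p, 'a::field_char_0) fspace"
  assumes co: "coordinates X n T \<kappa> \<Lambda>"
    and P: "P \<subseteq> polyfuns n" and T: "\<And>v. v \<in> affine_pts n \<Longrightarrow> v \<in> T \<longleftrightarrow> (\<exists>p\<in>P. p v \<noteq> 0)"
    and ne: "pts X \<noteq> {}"
  shows "irreducible_in (tp X) (pts X)"
proof -
  let ?A = "affine_space n :: (_, 'a) fspace"
  have "openin (tp ?A) {v \<in> pts ?A. p v \<noteq> 0}" if "p \<in> P" for p
    using that P by (intro openin_nonzero[OF space_with_functions_affine openin_topspace] polyfuns_reg_affine) auto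
  then have "openin (tp ?A) (\<Union>p\<in>P. {v \<in> pts ?A. p v \<noteq> 0})" by blast
  also have "(\<Union>p\<in>P. {v \<in> pts ?A. p v \<noteq> 0}) = affine_pts n \<inter> T" using T by auto
  finally have "irreducible_in (tp (sub ?A (affine_pts n \<inter> T))) (affine_pts n \<inter> T)"
    using ne by (intro irreducible_in_open_affine) (auto simp: pts_coordinates[OF co])
  moreover have "tp (sub ?A (affine_pts n \<inter> T)) = tp (sub ?A T)"
    using subtopology_restrict[of "tp ?A" T] by (simp add: sub_def)
  ultimately have "irreducible_in (tp X) (\<Lambda> ` (affine_pts n \<inter> T))"
    using coordinatesD(3)[OF co] by (auto simp: morphism_def intro: irreducible_in_image)
  then show ?thesis by (simp add: pts_coordinates[OF co])
qed

section \<open>Matrices\<close>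

context
  fixes m :: nat
begin

abbreviation entries_mat :: "(nat \<Rightarrow> 'a::field alg_closure) \<Rightarrow> 'a alg_closure mat" where
  "entries_mat \<equiv> \<lambda>v. mat m m (\<lambda>(i, j). v (i * m + j))"

lemma entry_index: "i < m \<Longrightarrow> j < m \<Longrightarrow> i * m + j < m * m"
proof -
  assume "i < m" "j < m"
  then have "i * m + j < Suc i * m" by simp
  also have "\<dots> \<le> m * m" using \<open>i < m\<close> by (intro mult_le_mono1) simp
  finally show ?thesis .
qed

lemma inj_entries_mat: "inj_on entries_mat (pts (affine_space (m * m)))"
proof (rule inj_onI)
  fix v w :: "nat \<Rightarrow> 'a::field alg_closure"
  assume v: "v \<in> pts (affine_space (m * m))" and w: "w \<in> pts (affine_space (m * m))" and eq: "entries_mat v = entries_mat w"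
  show "v = w"
  proof
    fix k
    show "v k = w k"
    proof (cases "k < m * m")
      case True
      then have "k div m < m" "k mod m < m" by (simp_all add: less_mult_imp_div_less) (metis mod_less_divisor mult_is_0 neq0_conv not_less0)
      then show ?thesis using arg_cong[OF eq, of "\<lambda>A. A $$ (k div m, k mod m)"] by simp
    qed (use v w in \<open>auto simp: affine_pts_def\<close>)
  qed
qed

lemma space_with_functions_mat: "space_with_functions (mat_space m :: (_, 'a::field) fspace)"
  unfolding mat_space_def by (rule space_with_functions_transport[OF space_with_functions_affine inj_entries_mat])

lemma pts_mat_space: "pts (mat_space m :: (_, 'a::field) fspace) = carrier_mat m m"
proof (intro equalityI subsetI)
  fix A :: "'a alg_closure mat" assume A: "A \<in> carrier_mat m m"
  define v where "v k = (if k < m * m then A $$ (k div m, k mod m) else 0)" for k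
  have "A = entries_mat v"
    by (rule eq_matI) (use A entry_index in \<open>auto simp: v_def\<close>)
  moreover have "v \<in> affine_pts (m * m)" by (auto simp: v_def affine_pts_def)
  ultimately show "A \<in> pts (mat_space m)" by (simp add: mat_space_def)
qed (auto simp: mat_space_def)

lemma reg_entry:
  assumes "i < m" "j < m"
  shows "(\<lambda>A. A $$ (i, j)) \<in> reg (mat_space m :: (_, 'a::field) fspace) (pts (mat_space m))"
proof -
  have "{v \<in> pts (affine_space (m * m)). entries_mat v \<in> pts (mat_space m)} = pts (affine_space (m * m) :: (_, 'a) fspace)"
    by (auto simp: mat_space_def)
  moreover have "(\<lambda>A. A $$ (i, j)) \<circ> entries_mat = (\<lambda>v :: nat \<Rightarrow> 'a alg_closure. v (i * m + j))"
    using assms by (simp add: comp_def)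
  ultimately show ?thesis
    using coord_reg_affine unfolding mat_space_def reg_transport by (simp only:)
qed

lemma morphism_into_mat_space:
  assumes Z: "space_with_functions Z" and c: "\<And>i j. i < m \<Longrightarrow> j < m \<Longrightarrow> (\<lambda>z. c z (i, j)) \<in> reg Z (pts Z)"
  shows "morphism Z (mat_space m) (\<lambda>z. mat m m (c z))"
proof -
  define w where "w z k = (if k < m * m then c z (k div m, k mod m) else 0)" for z k
  have "morphism Z (affine_space (m * m)) w"
  proof (rule morphism_into_affine[OF Z])
    fix k assume k: "k < m * m"
    then have "0 < m" by (cases m) auto
    then have "k div m < m" "k mod m < m" using k by (simp_all add: less_mult_imp_div_less)
    from c[OF this] show "(\<lambda>z. w z k) \<in> reg Z (pts Z)" using k by (simp add: w_def)
  qed (auto simp: w_def affine_pts_def)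
  from morphism_comp[OF this transport_morphisms(1)[OF space_with_functions_affine inj_entries_mat]]
  have "morphism Z (mat_space m) (entries_mat \<circ> w)" by (simp add: mat_space_def)
  then show ?thesis
  proof (rule morphism_cong[OF Z])
    show "(entries_mat \<circ> w) z = mat m m (c z)" for z
      by (rule eq_matI) (auto simp: w_def entry_index)
  qed
qed

end

section \<open>The additive group of finitely supported sequences\<close>

definition finseq :: "(nat \<Rightarrow> 'a::field alg_closure) set" where
  "finseq = (\<Union>n. affine_pts n)"

definition seq_group :: "(nat \<Rightarrow> 'a::field alg_closure) monoid" where
  "seq_group = \<lparr>carrier = finseq, monoid.mult = (\<lambda>x y i. x i + y i), one = (\<lambda>_. 0)\<rparr>"

lemma seq_group_simps [simp]:
  "carrier seq_group = finseq" "x \<otimes>\<^bsub>seq_group\<^esub> y = (\<lambda>i. x i + y i)" "\<one>\<^bsub>seq_group\<^esub> = (\<lambda>_. 0)"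
  by (simp_all add: seq_group_def)

lemma comm_group_seq_subgroup:
  assumes "(\<lambda>_. 0) \<in> H" "\<And>x y. x \<in> H \<Longrightarrow> y \<in> H \<Longrightarrow> (\<lambda>i. x i + y i) \<in> H" "\<And>x. x \<in> H \<Longrightarrow> (\<lambda>i. - x i) \<in> H"
  shows "comm_group (seq_group\<lparr>carrier := H\<rparr>)"
    "x \<in> H \<Longrightarrow> inv\<^bsub>seq_group\<lparr>carrier := H\<rparr>\<^esub> x = (\<lambda>i. - x i)"
proof -
  show *: "comm_group (seq_group\<lparr>carrier := H\<rparr>)"
  proof (rule comm_groupI)
    fix x assume "x \<in> carrier (seq_group\<lparr>carrier := H\<rparr>)"
    then show "\<exists>y\<in>carrier (seq_group\<lparr>carrier := H\<rparr>).
        y \<otimes>\<^bsub>seq_group\<lparr>carrier := H\<rparr>\<^esub> x = \<one>\<^bsub>seq_group\<lparr>carrier := H\<rparr>\<^esub>"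
      using assms(3) by (intro bexI[of _ "\<lambda>i. - x i"]) (simp_all add: seq_group_def)
  qed (use assms in \<open>simp_all add: seq_group_def fun_eq_iff algebra_simps\<close>)
  then interpret comm_group "seq_group\<lparr>carrier := H\<rparr>" .
  show "x \<in> H \<Longrightarrow> inv\<^bsub>seq_group\<lparr>carrier := H\<rparr>\<^esub> x = (\<lambda>i. - x i)"
    using assms(3) by (intro inv_equality) (simp_all add: seq_group_def)
qed

lemma affine_pts_subgroup:
  "(\<lambda>_. 0) \<in> affine_pts n" "x \<in> affine_pts n \<Longrightarrow> y \<in> affine_pts n \<Longrightarrow> (\<lambda>i. x i + y i) \<in> affine_pts n"
  "x \<in> affine_pts n \<Longrightarrow> (\<lambda>i. - x i) \<in> affine_pts n"
  by (auto simp: affine_pts_def)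

lemma finseq_subgroup:
  "(\<lambda>_. 0) \<in> finseq" "x \<in> finseq \<Longrightarrow> y \<in> finseq \<Longrightarrow> (\<lambda>i. x i + y i) \<in> finseq"
  "x \<in> finseq \<Longrightarrow> (\<lambda>i. - x i) \<in> finseq"
proof -
  assume "x \<in> finseq" "y \<in> finseq"
  then obtain n m where "x \<in> affine_pts n" "y \<in> affine_pts m" by (auto simp: finseq_def)
  then have "x \<in> affine_pts (max n m)" "y \<in> affine_pts (max n m)" by (auto simp: affine_pts_def)
  then show "(\<lambda>i. x i + y i) \<in> finseq" using affine_pts_subgroup(2) by (auto simp: finseq_def)
qed (auto simp: finseq_def affine_pts_def)

lemma seq_group_carrier: "seq_group\<lparr>carrier := finseq\<rparr> = seq_group"
  by (simp add: seq_group_def)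

lemma comm_group_seq_group: "comm_group seq_group"
  by (rule comm_group_seq_subgroup(1)[OF finseq_subgroup, unfolded seq_group_carrier])

lemma inv_seq_group: "x \<in> finseq \<Longrightarrow> inv\<^bsub>seq_group\<^esub> x = (\<lambda>i. - x i)"
  by (rule comm_group_seq_subgroup(2)[OF finseq_subgroup, unfolded seq_group_carrier])

lemma affine_pts_subset_finseq: "affine_pts n \<subseteq> finseq"
  by (auto simp: finseq_def)

lemma morphism_seq_add:
  "morphism (prod_space (affine_space n) (affine_space n)) (affine_space n) (\<lambda>(x, y) i. x i + y i)"
proof -
  let ?A = "affine_space n :: (_, 'a) fspace"
  note A = space_with_functions_affine[of n, where 'a = 'a]
  have AA: "space_with_functions (prod_space ?A ?A)" by (rule space_with_functions_prod[OF A A])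
  have "morphism (prod_space ?A ?A) ?A (\<lambda>z i. fst z i + snd z i)"
    by (intro morphism_into_affine[OF AA] reg_add[OF AA openin_topspace]
        reg_coord[OF morphism_fst[OF A A]] reg_coord[OF morphism_snd[OF A A]])
      (auto simp: pts_prod_space[OF A A] affine_pts_def)
  then show ?thesis by (simp add: case_prod_unfold)
qed

lemma morphism_seq_uminus: "morphism (affine_space n) (affine_space n) (\<lambda>x i. - x i)"
  by (intro morphism_into_affine space_with_functions_affine reg_uminus openin_topspace coord_reg_affine)
    (auto simp: affine_pts_def)

lemma ind_variety_affine: "ind_variety affine_space"
  by (rule ind_variety_coordinates[where k = 0 and P = "\<lambda>_. {\<lambda>_. 1}" and T = UNIV])
    (use coordinates_affine const_polyfuns in auto)

lemma ind_group_seq: "ind_group (affine_space :: nat \<Rightarrow> (_, 'a::field) fspace) seq_group"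
  unfolding ind_group_def
proof (intro conjI)
  show "group (seq_group :: (nat \<Rightarrow> 'a alg_closure) monoid)" using comm_group_seq_group comm_group.axioms(2) by blast
  show "carrier seq_group = ind_pts (affine_space :: nat \<Rightarrow> (_, 'a) fspace)"
    by (simp add: finseq_def ind_pts_def)
  show "ind_morphism (ind_prod affine_space affine_space) (affine_space :: nat \<Rightarrow> (_, 'a) fspace) (\<lambda>(x, y). x \<otimes>\<^bsub>seq_group\<^esub> y)"
    using morphism_seq_add by (auto simp: ind_morphism_def ind_prod_def)
  have "morphism (affine_space n) (affine_space n) (\<lambda>x :: nat \<Rightarrow> 'a alg_closure. inv\<^bsub>seq_group\<^esub> x)" for n
    by (rule morphism_cong[OF space_with_functions_affine morphism_seq_uminus])
      (simp add: inv_seq_group subsetD[OF affine_pts_subset_finseq])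
  then show "ind_morphism affine_space (affine_space :: nat \<Rightarrow> (_, 'a) fspace) (\<lambda>x. inv\<^bsub>seq_group\<^esub> x)"
    by (auto simp: ind_morphism_def)
qed (rule ind_variety_affine)

lemma algebraic_group_affine:
  "algebraic_group (affine_space n :: (_, 'a::field) fspace) (seq_group\<lparr>carrier := affine_pts n\<rparr>)"
  unfolding algebraic_group_def
proof (intro conjI)
  show "variety (affine_space n :: (_, 'a) fspace)" using ind_variety_affine[where 'a = 'a] by (simp add: ind_variety_def)
  show "group (seq_group\<lparr>carrier := affine_pts n\<rparr> :: (nat \<Rightarrow> 'a alg_closure) monoid)"
    using comm_group_seq_subgroup(1)[OF affine_pts_subgroup] comm_group.axioms(2) by blast
  show "morphism (prod_space (affine_space n) (affine_space n)) (affine_space n :: (_, 'a) fspace)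
          (\<lambda>(x, y). x \<otimes>\<^bsub>seq_group\<lparr>carrier := affine_pts n\<rparr>\<^esub> y)"
    using morphism_seq_add by (simp add: seq_group_def)
  show "morphism (affine_space n) (affine_space n) (\<lambda>x :: nat \<Rightarrow> 'a alg_closure. inv\<^bsub>seq_group\<lparr>carrier := affine_pts n\<rparr>\<^esub> x)"
    by (rule morphism_cong[OF space_with_functions_affine morphism_seq_uminus])
      (simp add: comm_group_seq_subgroup(2)[OF affine_pts_subgroup])
qed simp

text \<open>
  First row \<open>(1, v 0, \<dots>, v (n - 1))\<close>, other rows as in the identity matrix. The nilpotent parts of two
  such matrices have product zero, so that multiplying the matrices adds the sequences.\<close>

definition row_mat :: "nat \<Rightarrow> (nat \<Rightarrow> 'a::field alg_closure) \<Rightarrow> 'a alg_closure mat" where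
  "row_mat n v = mat (Suc n) (Suc n) (\<lambda>(i, j). if i = j then 1 else if i = 0 then v (j - 1) else 0)"

lemma row_mat_mult: "row_mat n (\<lambda>i. x i + y i) = row_mat n x * row_mat n y"
proof (rule eq_matI)
  fix i j assume "i < dim_row (row_mat n x * row_mat n y)" "j < dim_col (row_mat n x * row_mat n y)"
  then have ij: "i < Suc n" "j < Suc n" by (simp_all add: row_mat_def)
  have "(row_mat n x * row_mat n y) $$ (i, j) = (\<Sum>k\<in>{0..<Suc n}. row_mat n x $$ (i, k) * row_mat n y $$ (k, j))"
    using ij by (simp add: row_mat_def scalar_prod_def)
  also have "\<dots> = row_mat n (\<lambda>i. x i + y i) $$ (i, j)"
  proof (cases "i = 0")
    case True
    have "(\<Sum>k\<in>{0..<Suc n}. row_mat n x $$ (0, k) * row_mat n y $$ (k, j))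
      = row_mat n y $$ (0, j) + (\<Sum>k\<in>{0..<n}. x k * row_mat n y $$ (Suc k, j))"
      by (subst sum.atLeast0_lessThan_Suc_shift) (simp add: row_mat_def)
    also have "(\<Sum>k\<in>{0..<n}. x k * row_mat n y $$ (Suc k, j)) = (\<Sum>k\<in>{0..<n}. if Suc k = j then x k else 0)"
      using ij by (intro sum.cong) (auto simp: row_mat_def)
    also have "\<dots> = (if j = 0 then 0 else x (j - 1))" using ij by (cases j) auto
    finally show ?thesis using True ij by (auto simp: row_mat_def)
  next
    case False
    have "(\<Sum>k\<in>{0..<Suc n}. row_mat n x $$ (i, k) * row_mat n y $$ (k, j)) = (\<Sum>k\<in>{0..<Suc n}. if k = i then row_mat n y $$ (i, j) else 0)"
      using ij False by (intro sum.cong) (auto simp: row_mat_def)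
    then show ?thesis using ij False by (auto simp: row_mat_def)
  qed
  finally show "row_mat n (\<lambda>i. x i + y i) $$ (i, j) = (row_mat n x * row_mat n y) $$ (i, j)" ..
qed (simp_all add: row_mat_def)

text \<open>
  The image is cut out by prescribing all entries except those of the first row off the diagonal,
  and the inverse map reads off the latter.\<close>

lemma closed_embedding_row_mat:
  "closed_embedding (affine_space n :: (_, 'a::field) fspace) (mat_space (Suc n)) (row_mat n)"
proof (rule closed_embeddingI[OF space_with_functions_affine])
  let ?A = "affine_space n :: (_, 'a) fspace" and ?Y = "mat_space (Suc n) :: (_, 'a) fspace"
  note A = space_with_functions_affine[of n, where 'a = 'a]
  note Y = space_with_functions_mat[of "Suc n", where 'a = 'a]
  show "morphism ?A ?Y (row_mat n)"
    unfolding row_mat_def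
  proof (rule morphism_into_mat_space[OF A])
    fix i j :: nat
    show "(\<lambda>v. case (i, j) of (i, j) \<Rightarrow> if i = j then 1 else if i = 0 then v (j - 1) else 0) \<in> reg ?A (pts ?A)"
      using reg_1[OF A openin_topspace] reg_0[OF A openin_topspace] coord_reg_affine[of "j - 1" n, where 'a = 'a]
      by (cases "i = j"; cases "i = 0") simp_all
  qed
  \<comment> \<open>The index \<open>k\<close> stands for the entry in row \<open>k div (n + 1)\<close> and column \<open>k mod (n + 1)\<close>.\<close>
  define free where "free k \<longleftrightarrow> k div Suc n = 0 \<and> k mod Suc n \<noteq> 0" for k
  define \<alpha> where "\<alpha> M k = (if free k then 0 else M $$ (k div Suc n, k mod Suc n))" for M :: "'a alg_closure mat" and k
  define \<beta> where "\<beta> k = (if free k then 0 else if k div Suc n = k mod Suc n then 1 else 0 :: 'a alg_closure)" for k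
  have "(\<lambda>M. \<alpha> M k) \<in> reg ?Y (pts ?Y)" if "k < Suc n * Suc n" for k
    using that reg_entry[of "k div Suc n" "Suc n" "k mod Suc n", where 'a = 'a] reg_0[OF Y openin_topspace]
    by (cases "free k") (simp_all add: \<alpha>_def less_mult_imp_div_less del: mult_Suc mult_Suc_right)
  moreover have "(\<lambda>M. \<beta> k) \<in> reg ?Y (pts ?Y)" for k
    using reg_0[OF Y openin_topspace] reg_1[OF Y openin_topspace] by (simp add: \<beta>_def)
  ultimately have "closedin (tp ?Y) {M \<in> pts ?Y. \<forall>k<Suc n * Suc n. \<alpha> M k = \<beta> k}"
    by (intro closedin_equalizer[OF Y]) auto
  also have "{M \<in> pts ?Y. \<forall>k<Suc n * Suc n. \<alpha> M k = \<beta> k} = row_mat n ` pts ?A"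
  proof (intro equalityI subsetI)
    fix M assume "M \<in> {M \<in> pts ?Y. \<forall>k<Suc n * Suc n. \<alpha> M k = \<beta> k}"
    then have M: "M \<in> carrier_mat (Suc n) (Suc n)" "\<And>k. k < Suc n * Suc n \<Longrightarrow> \<alpha> M k = \<beta> k"
      by (simp_all add: pts_mat_space)
    define v where "v j = (if j < n then M $$ (0, Suc j) else 0)" for j
    have "M = row_mat n v"
    proof (rule eq_matI)
      fix i j assume "i < dim_row (row_mat n v)" "j < dim_col (row_mat n v)"
      then have ij: "i < Suc n" "j < Suc n" by (simp_all add: row_mat_def)
      have "(i * Suc n + j) div Suc n = i" "(i * Suc n + j) mod Suc n = j"
        using ij(2) by (simp_all del: mult_Suc_right)
      then show "M $$ (i, j) = row_mat n v $$ (i, j)"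
        using M(2)[OF entry_index[OF ij]] ij
        by (cases "i = 0"; cases "j = 0") (auto simp: \<alpha>_def \<beta>_def free_def row_mat_def v_def simp del: mult_Suc_right)
    qed (use M(1) in \<open>auto simp: row_mat_def\<close>)
    moreover have "v \<in> pts ?A" by (auto simp: v_def affine_pts_def)
    ultimately show "M \<in> row_mat n ` pts ?A" by blast
  next
    fix M assume "M \<in> row_mat n ` pts ?A"
    then obtain v where M: "M = row_mat n v" by blast
    have "\<alpha> M k = \<beta> k" if "k < Suc n * Suc n" for k
    proof -
      have "k div Suc n < Suc n" "k mod Suc n < Suc n" using that by (simp_all add: less_mult_imp_div_less del: mult_Suc mult_Suc_right)
      then show ?thesis by (auto simp: M \<alpha>_def \<beta>_def free_def row_mat_def)
    qed
    then show "M \<in> {M \<in> pts ?Y. \<forall>k<Suc n * Suc n. \<alpha> M k = \<beta> k}"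
      by (simp add: M pts_mat_space row_mat_def)
  qed
  finally show "closedin (tp ?Y) (row_mat n ` pts ?A)" .
  define \<psi> where "\<psi> M j = (if j < n then M $$ (0, Suc j) else 0)" for M :: "'a alg_closure mat" and j
  have "morphism ?Y ?A \<psi>"
  proof (rule morphism_into_affine[OF Y])
    show "(\<lambda>M. \<psi> M j) \<in> reg ?Y (pts ?Y)" if "j < n" for j
      using reg_entry[of 0 "Suc n" "Suc j", where 'a = 'a] that by (simp add: \<psi>_def)
  qed (auto simp: \<psi>_def affine_pts_def)
  then show "morphism (sub ?Y (row_mat n ` pts ?A)) ?A \<psi>" by (rule morphism_from_sub[OF Y])
  show "\<psi> (row_mat n v) = v" if "v \<in> pts ?A" for v
    using that by (auto simp: \<psi>_def row_mat_def affine_pts_def)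
qed

lemma equivalent_seqs_refl:
  assumes "ind_variety X" "\<And>n. space_with_functions (X n)"
  shows "equivalent_seqs X X"
  using assms morphism_id by (auto simp: equivalent_seqs_def ind_morphism_def)

lemma unipotent_ind_group_seq:
  "unipotent_ind_group (affine_space :: nat \<Rightarrow> (_, 'a::field) fspace) seq_group"
  unfolding unipotent_ind_group_def
proof (intro conjI ind_group_seq exI allI)
  show "equivalent_seqs affine_space (affine_space :: nat \<Rightarrow> (_, 'a) fspace)"
    by (intro equivalent_seqs_refl ind_variety_affine space_with_functions_affine)
  fix n
  have "upper_triangular (row_mat n x) \<and> (\<forall>i<Suc n. row_mat n x $$ (i, i) = 1)" for x :: "nat \<Rightarrow> 'a alg_closure"
    by (auto simp: upper_triangular_def row_mat_def)
  then show "unipotent_algebraic_group (affine_space n) (seq_group\<lparr>carrier := pts (affine_space n :: (_, 'a) fspace)\<rparr>)"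
    unfolding unipotent_algebraic_group_def
    using algebraic_group_affine[of n, where 'a = 'a] closed_embedding_row_mat[of n, where 'a = 'a]
    by (intro conjI exI[of _ "Suc n"] exI[of _ "row_mat n"]) (auto simp: seq_group_def row_mat_mult)
qed

section \<open>Coordinates on the Rota--Baxter operators\<close>

definition nonzero_tail :: "(nat \<Rightarrow> 'k::zero) set" where
  "nonzero_tail = {v. \<exists>i. v (Suc i) \<noteq> 0}"

text \<open>
  The operator \<open>J\<^sub>a \<circ> l\<^sub>r\<close> with coordinates \<open>(a, r\<^sub>0, r\<^sub>1, \<dots>)\<close>. In contrast to \<open>RB_param d\<close>, it does not refer
  to a bound on the degree of \<open>r\<close>.\<close>

definition op_of_seq :: "(nat \<Rightarrow> 'k::field_char_0) \<Rightarrow> 'k poly \<Rightarrow> 'k poly" where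
  "op_of_seq v = J_op (v 0) \<circ> mult_op (Abs_poly (\<lambda>i. v (Suc i)))"

lemma coeff_Abs_poly_affine: "w \<in> affine_pts n \<Longrightarrow> coeff (Abs_poly w) = w"
  by (rule Abs_poly_inverse) (auto simp: affine_pts_def MOST_nat_le intro: less_imp_le)

lemma Suc_affine_pts: "v \<in> affine_pts (Suc n) \<Longrightarrow> (\<lambda>i. v (Suc i)) \<in> affine_pts n"
  by (auto simp: affine_pts_def)

lemma op_of_seq_eq_iff:
  fixes v w :: "nat \<Rightarrow> 'a::field_char_0 alg_closure"
  assumes "v \<in> finseq" "w \<in> finseq" "v \<in> nonzero_tail"
  shows "op_of_seq v = op_of_seq w \<longleftrightarrow> v = w"
proof
  assume eq: "op_of_seq v = op_of_seq w"
  have c: "coeff (Abs_poly (\<lambda>i. u (Suc i))) = (\<lambda>i. u (Suc i))" if "u \<in> finseq" for u :: "nat \<Rightarrow> 'a alg_closure"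
  proof -
    obtain n where "u \<in> affine_pts n" using \<open>u \<in> finseq\<close> by (auto simp: finseq_def)
    then have "u \<in> affine_pts (Suc n)" by (auto simp: affine_pts_def)
    then show ?thesis by (rule coeff_Abs_poly_affine[OF Suc_affine_pts])
  qed
  have "Abs_poly (\<lambda>i. v (Suc i)) \<noteq> 0"
  proof
    assume "Abs_poly (\<lambda>i. v (Suc i)) = 0"
    then have "(\<lambda>i. v (Suc i)) = (\<lambda>_. 0)" using c[OF assms(1)] by (simp add: fun_eq_iff)
    then show False using assms(3) by (auto simp: nonzero_tail_def fun_eq_iff)
  qed
  from J_mult_inj[OF eq[unfolded op_of_seq_def] this]
  have v0: "v 0 = w 0" and p: "Abs_poly (\<lambda>i. v (Suc i)) = Abs_poly (\<lambda>i. w (Suc i))" by blast+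
  have vS: "(\<lambda>i. v (Suc i)) = (\<lambda>i. w (Suc i))"
    using arg_cong[OF p, of coeff] unfolding c[OF assms(1)] c[OF assms(2)] .
  have "v i = w i" for i using v0 fun_cong[OF vS] by (cases i) simp_all
  then show "v = w" ..
qed simp

definition seq_of_op :: "('a::field_char_0 alg_closure poly \<Rightarrow> 'a alg_closure poly) \<Rightarrow> nat \<Rightarrow> 'a alg_closure" where
  "seq_of_op = inv_into (finseq \<inter> nonzero_tail) op_of_seq"

lemma seq_of_op_of_seq: "v \<in> finseq \<Longrightarrow> v \<in> nonzero_tail \<Longrightarrow> seq_of_op (op_of_seq v) = v"
  unfolding seq_of_op_def by (rule inv_into_f_f) (auto intro!: inj_onI simp: op_of_seq_eq_iff)

text \<open>
  The structure on the operators is transported from pairs \<open>(a, r)\<close>, and joining such a pair into one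
  sequence is an isomorphism.\<close>

lemma coordinates_RB:
  "coordinates (RB_ind d :: (_, 'a::field_char_0) fspace) (d + 2) nonzero_tail seq_of_op op_of_seq"
proof -
  let ?A = "\<lambda>n. affine_space n :: (nat \<Rightarrow> 'a alg_closure, 'a) fspace"
  let ?V = "affine_pts (d + 1) - {\<lambda>_. 0} :: (nat \<Rightarrow> 'a alg_closure) set"
  define B where "B = prod_space (?A 1) (sub (?A (d + 1)) ?V)"
  note A = space_with_functions_affine[where 'a = 'a]
  note S = space_with_functions_sub[OF A]
  have B: "space_with_functions B" unfolding B_def by (rule space_with_functions_prod[OF A S])
  have pB: "pts B = affine_pts 1 \<times> ?V" unfolding B_def by (auto simp: pts_prod_space[OF A S])
  have inj: "inj_on (RB_param d) (pts B)" unfolding pB by (rule inj_RB_param)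
  have RB: "RB_ind d = transport (RB_param d) B" by (simp add: RB_ind_def B_def)
  have X: "space_with_functions (RB_ind d :: (_, 'a) fspace)"
    unfolding RB by (rule space_with_functions_transport[OF B inj])
  define split where "split v = (\<lambda>i::nat. if i = 0 then v 0 else 0, \<lambda>i. v (Suc i))" for v :: "nat \<Rightarrow> 'a alg_closure"
  define join where "join z = (\<lambda>i. case i of 0 \<Rightarrow> fst z 0 | Suc j \<Rightarrow> snd z j)" for z :: "(nat \<Rightarrow> 'a alg_closure) \<times> (nat \<Rightarrow> 'a alg_closure)"
  have split_pts: "split v \<in> pts B" if "v \<in> affine_pts (d + 2)" "v \<in> nonzero_tail" for v
    using that by (auto simp: pB split_def affine_pts_def nonzero_tail_def fun_eq_iff)
  have join_pts: "join z \<in> affine_pts (d + 2)" "join z \<in> nonzero_tail" "split (join z) = z" if "z \<in> pts B" for z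
  proof -
    show "join z \<in> affine_pts (d + 2)"
      using that by (auto simp: pB join_def affine_pts_def split: nat.split)
    have "snd z \<noteq> (\<lambda>_. 0)" using that by (auto simp: pB)
    then show "join z \<in> nonzero_tail" by (auto simp: nonzero_tail_def join_def)
    show "split (join z) = z"
      using that by (cases z) (auto simp: pB split_def join_def affine_pts_def fun_eq_iff)
  qed
  have param_split: "RB_param d (split v) = op_of_seq v" if "v \<in> affine_pts (d + 2)" for v
  proof -
    have "(\<lambda>i. v (Suc i)) \<in> affine_pts (d + 1)" using that by (auto simp: affine_pts_def)
    then have "poly_of_coords d (\<lambda>i. v (Suc i)) = Abs_poly (\<lambda>i. v (Suc i))"
      by (intro poly_eqI) (auto simp: coeff_poly_of_coords coeff_Abs_poly_affine affine_pts_def)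
    then show ?thesis by (simp add: RB_param_def split_def op_of_seq_def)
  qed
  have sop: "seq_of_op (RB_param d z) = join z" if "z \<in> pts B" for z
    using join_pts[OF that] param_split[of "join z"] seq_of_op_of_seq[of "join z"] affine_pts_subset_finseq[of "d + 2"]
    by auto
  have "morphism B (?A (d + 2)) join"
  proof (rule morphism_into_affine[OF B])
    show "(\<lambda>z. join z i) \<in> reg B (pts B)" for i
      using reg_coord[OF morphism_fst[OF A S]] reg_coord[OF morphism_comp[OF morphism_snd[OF A S] morphism_inclusion[OF A]]]
      by (cases i) (simp_all add: join_def B_def comp_def)
  qed (rule join_pts)
  from morphism_comp[OF transport_morphisms(2)[OF B inj] morphism_into_sub[OF B this join_pts(2)]]
  have "morphism (RB_ind d) (sub (?A (d + 2)) nonzero_tail) (join \<circ> inv_into (pts B) (RB_param d))"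
    unfolding RB .
  then have \<kappa>: "morphism (RB_ind d) (sub (?A (d + 2)) nonzero_tail) seq_of_op"
    by (rule morphism_cong[OF X]) (auto simp: RB sop inv_into_f_f[OF inj])
  let ?T = "sub (?A (d + 2)) nonzero_tail"
  have c: "(\<lambda>v. v i) \<in> reg ?T (pts ?T)" for i
    using reg_coord[OF morphism_inclusion[OF A]] .
  have "morphism ?T (?A 1) (\<lambda>v i. if i = 0 then v 0 else 0)"
    by (rule morphism_into_affine[OF S]) (use c in \<open>auto simp: affine_pts_def\<close>)
  moreover have "morphism ?T (sub (?A (d + 1)) ?V) (\<lambda>v i. v (Suc i))"
    by (intro morphism_into_sub morphism_into_affine S c)
      (auto simp: affine_pts_def nonzero_tail_def fun_eq_iff)
  ultimately have "morphism ?T B split"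
    unfolding B_def split_def by (rule morphism_pair[OF A S S])
  from morphism_comp[OF this transport_morphisms(1)[OF B inj]]
  have "morphism ?T (RB_ind d) (RB_param d \<circ> split)" unfolding RB .
  then have "morphism ?T (RB_ind d) op_of_seq"
    by (rule morphism_cong[OF S]) (simp add: param_split)
  moreover have "op_of_seq (seq_of_op x) = x" if "x \<in> pts (RB_ind d :: (_, 'a) fspace)" for x
  proof -
    obtain z where z: "z \<in> pts B" "x = RB_param d z" using \<open>x \<in> pts (RB_ind d)\<close> by (auto simp: RB)
    have "op_of_seq (seq_of_op x) = op_of_seq (join z)" by (simp add: z sop)
    also have "\<dots> = RB_param d (split (join z))" by (rule param_split[OF join_pts(1)[OF z(1)], symmetric])
    also have "\<dots> = x" by (simp add: join_pts(3)[OF z(1)] z(2))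
    finally show ?thesis .
  qed
  ultimately show ?thesis
    unfolding coordinates_def using X \<kappa> affine_pts_subset_finseq
    by (auto intro!: seq_of_op_of_seq)
qed

lemma nonzero_tail_coords:
  assumes "v \<in> affine_pts (n + 2)"
  shows "v \<in> nonzero_tail \<longleftrightarrow> (\<exists>p\<in>(\<lambda>i v. v i) ` {1..<n + 2}. p v \<noteq> 0)"
proof
  assume "v \<in> nonzero_tail"
  then obtain i where i: "v (Suc i) \<noteq> 0" by (auto simp: nonzero_tail_def)
  then have "Suc i < n + 2" using assms by (auto simp: affine_pts_def not_less[symmetric])
  then show "\<exists>p\<in>(\<lambda>i v. v i) ` {1..<n + 2}. p v \<noteq> 0" using i by (auto intro!: bexI[of _ "Suc i"])
next
  assume "\<exists>p\<in>(\<lambda>i v. v i) ` {1..<n + 2}. p v \<noteq> 0"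
  then obtain i where "1 \<le> i" "v i \<noteq> 0" by auto
  then show "v \<in> nonzero_tail" by (cases i) (auto simp: nonzero_tail_def)
qed

lemma ind_variety_RB: "ind_variety (RB_ind :: nat \<Rightarrow> (_, 'a::field_char_0) fspace)"
  by (rule ind_variety_coordinates[where k = 2 and P = "\<lambda>n. (\<lambda>i v. v i) ` {1..<n + 2}", OF coordinates_RB])
    (use nonzero_tail_coords in \<open>auto intro: polyfuns.coord\<close>)

lemma irreducible_RB: "irreducible_ind_variety (RB_ind :: nat \<Rightarrow> (_, 'a::field_char_0) fspace)"
  unfolding irreducible_ind_variety_def
proof (intro exI conjI allI)
  show "equivalent_seqs RB_ind (RB_ind :: nat \<Rightarrow> (_, 'a) fspace)"
    by (rule equivalent_seqs_refl[OF ind_variety_RB coordinatesD(1)[OF coordinates_RB]])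
  fix n
  define v :: "nat \<Rightarrow> 'a alg_closure" where "v i = (if i = 1 then 1 else 0)" for i
  have "v \<in> affine_pts (n + 2)" "v \<in> nonzero_tail" by (auto simp: v_def affine_pts_def nonzero_tail_def)
  then have "pts (RB_ind n :: (_, 'a) fspace) \<noteq> {}" using coordinates_out[OF coordinates_RB[of n]] by blast
  then show "irreducible_in (tp (RB_ind n :: (_, 'a) fspace)) (pts (RB_ind n))"
    by (rule irreducible_coordinates[OF coordinates_RB[of n], of "(\<lambda>i v. v i) ` {1..<n + 2}", rotated 2])
      (auto intro: polyfuns.coord simp: nonzero_tail_coords)
qed

section \<open>The action\<close>

text \<open>
  The value \<open>v 1\<close> is the constant coefficient \<open>r\<^sub>0\<close>, and \<open>v (j + 2)\<close> is \<open>r\<^sub>j\<^sub>+\<^sub>1\<close>.\<close>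

definition shift :: "(nat \<Rightarrow> 'a::field alg_closure) \<Rightarrow> (nat \<Rightarrow> 'a alg_closure) \<Rightarrow> nat \<Rightarrow> 'a alg_closure" where
  "shift t v i = v i + (if i < 2 then 0 else t (i - 2) * v 1)"

lemma shift_affine_pts: "t \<in> affine_pts n \<Longrightarrow> v \<in> affine_pts (n + 2) \<Longrightarrow> shift t v \<in> affine_pts (n + 2)"
  by (auto simp: shift_def affine_pts_def)

text \<open>
  The shift is trivial if \<open>r\<^sub>0 = 0\<close>, and otherwise \<open>r\<^sub>0\<close> remains a non-zero coefficient.\<close>

lemma shift_nonzero_tail:
  assumes "v \<in> nonzero_tail" shows "shift t v \<in> nonzero_tail"
proof (cases "v 1 = 0")
  case True
  then have "shift t v = v" by (auto simp: shift_def)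
  then show ?thesis using assms by simp
next
  case False
  then have "shift t v (Suc 0) \<noteq> 0" by (simp add: shift_def)
  then show ?thesis unfolding nonzero_tail_def by blast
qed

lemma shift_0: "shift (\<lambda>_. 0) v = v"
  and shift_add: "shift (\<lambda>i. s i + t i) v = shift s (shift t v)"
  by (auto simp: shift_def fun_eq_iff algebra_simps)

lemma shift_finseq: "t \<in> finseq \<Longrightarrow> v \<in> finseq \<Longrightarrow> shift t v \<in> finseq"
proof -
  assume "t \<in> finseq" "v \<in> finseq"
  then obtain n m where "t \<in> affine_pts n" "v \<in> affine_pts m" by (auto simp: finseq_def)
  then have "t \<in> affine_pts (max n m)" "v \<in> affine_pts (max n m + 2)" by (auto simp: affine_pts_def)
  from shift_affine_pts[OF this] show ?thesis using affine_pts_subset_finseq by blast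
qed

lemma RB_ops_coords:
  fixes x :: "'a::field_char_0 alg_closure poly \<Rightarrow> 'a alg_closure poly"
  assumes "x \<in> RB_ops"
  shows "seq_of_op x \<in> finseq" "seq_of_op x \<in> nonzero_tail" "op_of_seq (seq_of_op x) = x"
proof -
  obtain n where x: "x \<in> pts (RB_ind n :: (_, 'a) fspace)" using assms by (auto simp: ind_pts_def simp flip: ind_pts_RB_ind)
  show "seq_of_op x \<in> finseq" "seq_of_op x \<in> nonzero_tail" "op_of_seq (seq_of_op x) = x"
    using coordinates_in[OF coordinates_RB x] coordinatesD(4)[OF coordinates_RB x] affine_pts_subset_finseq by auto
qed

lemma op_of_seq_RB_ops:
  fixes v :: "nat \<Rightarrow> 'a::field_char_0 alg_closure"
  assumes "v \<in> finseq" "v \<in> nonzero_tail"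
  shows "op_of_seq v \<in> RB_ops"
proof -
  obtain n where "v \<in> affine_pts n" using assms(1) by (auto simp: finseq_def)
  then have "v \<in> affine_pts (n + 2)" using affine_pts_mono[of n "n + 2"] by auto
  then have "op_of_seq v \<in> pts (RB_ind n :: (_, 'a) fspace)" by (rule coordinates_out[OF coordinates_RB _ assms(2)])
  then show ?thesis by (auto simp: ind_pts_def simp flip: ind_pts_RB_ind)
qed

text \<open>
  The restriction is needed because group actions take values in the group of extensional
  bijections.\<close>

definition shift_op :: "(nat \<Rightarrow> 'a::field_char_0 alg_closure) \<Rightarrow>
    ('a alg_closure poly \<Rightarrow> 'a alg_closure poly) \<Rightarrow> 'a alg_closure poly \<Rightarrow> 'a alg_closure poly" where
  "shift_op t = (\<lambda>x\<in>RB_ops. op_of_seq (shift t (seq_of_op x)))"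

lemma shift_op_RB_ops:
  assumes "t \<in> finseq" "x \<in> RB_ops"
  shows "shift_op t x \<in> RB_ops" "seq_of_op (shift_op t x) = shift t (seq_of_op x)"
  using assms RB_ops_coords[OF assms(2)]
  by (auto simp: shift_op_def intro!: op_of_seq_RB_ops seq_of_op_of_seq shift_finseq shift_nonzero_tail)

lemma shift_op_add:
  assumes "s \<in> finseq" "t \<in> finseq" "x \<in> RB_ops"
  shows "shift_op (\<lambda>i. s i + t i) x = shift_op s (shift_op t x)"
proof -
  have "shift_op s (shift_op t x) = op_of_seq (shift s (seq_of_op (shift_op t x)))"
    using shift_op_RB_ops[OF assms(2,3)] by (simp add: shift_op_def)
  also have "\<dots> = op_of_seq (shift (\<lambda>i. s i + t i) (seq_of_op x))"
    by (simp add: shift_op_RB_ops[OF assms(2,3)] shift_add)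
  finally show ?thesis using assms(3) by (simp add: shift_op_def)
qed

lemma shift_op_0: "x \<in> RB_ops \<Longrightarrow> shift_op (\<lambda>_. 0) x = x"
  by (simp add: shift_op_def shift_0 RB_ops_coords)

lemma group_action_shift_op:
  "group_action seq_group (RB_ops :: ('a::field_char_0 alg_closure poly \<Rightarrow> _) set) shift_op"
proof -
  let ?E = "RB_ops :: ('a alg_closure poly \<Rightarrow> 'a alg_closure poly) set"
  have inv: "shift_op (\<lambda>i. - t i) (shift_op t x) = x" "shift_op t (shift_op (\<lambda>i. - t i) x) = x"
    if "t \<in> finseq" "x \<in> ?E" for t x
    using shift_op_add[OF finseq_subgroup(3)[OF that(1)] that] shift_op_add[OF that(1) finseq_subgroup(3)[OF that(1)] that(2)]
    by (simp_all add: shift_op_0 that(2))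
  have Bij: "shift_op t \<in> Bij ?E" if "t \<in> finseq" for t
    unfolding Bij_def
  proof (intro IntI CollectI)
    show "shift_op t \<in> extensional ?E" by (simp add: shift_op_def)
    show "bij_betw (shift_op t) ?E ?E"
      using that inv shift_op_RB_ops(1) finseq_subgroup(3)[OF that]
      by (intro bij_betwI[of _ _ _ "shift_op (\<lambda>i. - t i)"]) auto
  qed
  have "shift_op (\<lambda>i. s i + t i) = compose ?E (shift_op s) (shift_op t)" if "s \<in> finseq" "t \<in> finseq" for s t
  proof
    fix x
    show "shift_op (\<lambda>i. s i + t i) x = compose ?E (shift_op s) (shift_op t) x"
      using shift_op_add[OF that, of x] by (cases "x \<in> ?E") (auto simp: compose_def shift_op_def)
  qed
  then have "shift_op \<in> hom seq_group (BijGroup ?E)"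
    using Bij by (auto simp: hom_def BijGroup_def)
  then show ?thesis
    unfolding group_action_def group_hom_def group_hom_axioms_def
    using comm_group_seq_group comm_group.axioms(2) group_BijGroup by blast
qed

lemma regular_action_shift_op:
  "regular_action affine_space seq_group shift_op (RB_ind :: nat \<Rightarrow> (_, 'a::field_char_0) fspace)"
  unfolding regular_action_def
proof (intro conjI ind_group_seq ind_variety_RB)
  show "group_action seq_group (ind_pts (RB_ind :: nat \<Rightarrow> (_, 'a) fspace)) shift_op"
    unfolding ind_pts_RB_ind by (rule group_action_shift_op)
  have "morphism (prod_space (affine_space n) (RB_ind n :: (_, 'a) fspace)) (RB_ind n) (\<lambda>(t, x). shift_op t x)" for n
  proof -
    let ?A = "affine_space n :: (_, 'a) fspace" and ?X = "RB_ind n :: (_, 'a) fspace"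
    note A = space_with_functions_affine[of n, where 'a = 'a]
    note X = coordinatesD(1)[OF coordinates_RB[of n, where 'a = 'a]]
    have AX: "space_with_functions (prod_space ?A ?X)" by (rule space_with_functions_prod[OF A X])
    note op = openin_topspace[of "tp (prod_space ?A ?X)"]
    have t: "(\<lambda>z. fst z i) \<in> reg (prod_space ?A ?X) (pts (prod_space ?A ?X))" for i
      using reg_coord[OF morphism_fst[OF A X]] .
    have v: "(\<lambda>z. seq_of_op (snd z) i) \<in> reg (prod_space ?A ?X) (pts (prod_space ?A ?X))" for i
      using morphism_pullback[OF morphism_snd[OF A X] reg_coordinates[OF coordinates_RB]] .
    show ?thesis
    proof (rule morphism_into_coordinates[OF coordinates_RB AX, of "\<lambda>z. shift (fst z) (seq_of_op (snd z))"])
      fix z assume "z \<in> pts (prod_space ?A ?X)"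
      then have z: "fst z \<in> affine_pts n" "snd z \<in> pts ?X" by (auto simp: pts_prod_space[OF A X])
      show "shift (fst z) (seq_of_op (snd z)) \<in> affine_pts (n + 2)"
        by (rule shift_affine_pts[OF z(1) coordinates_in(1)[OF coordinates_RB z(2)]])
      show "shift (fst z) (seq_of_op (snd z)) \<in> nonzero_tail"
        by (rule shift_nonzero_tail[OF coordinates_in(2)[OF coordinates_RB z(2)]])
      have "snd z \<in> RB_ops" using z(2) by (auto simp: ind_pts_def simp flip: ind_pts_RB_ind)
      then show "(case z of (t, x) \<Rightarrow> shift_op t x) = op_of_seq (shift (fst z) (seq_of_op (snd z)))"
        by (simp add: case_prod_unfold shift_op_def)
    next
      fix i
      show "(\<lambda>z. shift (fst z) (seq_of_op (snd z)) i) \<in> reg (prod_space ?A ?X) (pts (prod_space ?A ?X))"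
        unfolding shift_def using reg_add[OF AX op v reg_mult[OF AX op t v]] v
        by (cases "i < 2") simp_all
    qed
  qed
  then show "ind_morphism (ind_prod affine_space RB_ind) (RB_ind :: nat \<Rightarrow> (_, 'a) fspace) (\<lambda>(t, x). shift_op t x)"
    by (auto simp: ind_morphism_def ind_prod_def)
qed

section \<open>The generic quotient\<close>

definition quotient_coords :: "(nat \<Rightarrow> 'k::zero) \<Rightarrow> nat \<Rightarrow> 'k" where
  "quotient_coords v i = (if i < 2 then v i else 0)"

text \<open>
  The operator with coordinates \<open>(a, r\<^sub>0, 0, 0, \<dots>)\<close> is moved to the one with coefficients \<open>r\<^sub>j\<^sub>+\<^sub>1\<close> by the
  sequence \<open>t j = r\<^sub>j\<^sub>+\<^sub>1 / r\<^sub>0\<close>. The set \<open>A\<close> is the field of coordinates: the algebraic closure for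
  geometric points, and the ground field for the points over it.\<close>

lemma fibre_is_orbit:
  fixes z :: "nat \<Rightarrow> 'a::field_char_0 alg_closure"
  assumes A: "0 \<in> A" "\<And>x y. x \<in> A \<Longrightarrow> y \<in> A \<Longrightarrow> x + y \<in> A \<and> x * y \<in> A \<and> x / y \<in> A"
    and z: "z \<in> affine_pts 2" "z 1 \<noteq> 0" "range z \<subseteq> A"
  shows "{x \<in> RB_ops. seq_of_op x 1 \<noteq> 0 \<and> range (seq_of_op x) \<subseteq> A \<and> quotient_coords (seq_of_op x) = z}
    = {shift_op t (op_of_seq z) | t. t \<in> finseq \<and> range t \<subseteq> A}"
proof -
  have zf: "z \<in> finseq" "z \<in> nonzero_tail" using z affine_pts_subset_finseq by (auto simp: nonzero_tail_def)
  have zs: "seq_of_op (op_of_seq z) = z" "op_of_seq z \<in> RB_ops"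
    using seq_of_op_of_seq[OF zf] op_of_seq_RB_ops[OF zf] .
  show ?thesis
  proof (intro equalityI subsetI)
    fix x assume "x \<in> {x \<in> RB_ops. seq_of_op x 1 \<noteq> 0 \<and> range (seq_of_op x) \<subseteq> A \<and> quotient_coords (seq_of_op x) = z}"
    then have x: "x \<in> RB_ops" "range (seq_of_op x) \<subseteq> A" "quotient_coords (seq_of_op x) = z" by auto
    define t where "t j = seq_of_op x (j + 2) / z 1" for j
    obtain n where "seq_of_op x \<in> affine_pts n" using RB_ops_coords(1)[OF x(1)] by (auto simp: finseq_def)
    then have "t \<in> affine_pts n" by (auto simp: t_def affine_pts_def)
    then have "t \<in> finseq" using affine_pts_subset_finseq by blast
    moreover have "t j \<in> A" for j using A(2)[of "seq_of_op x (j + 2)" "z 1"] x(2) z(3) unfolding t_def by blast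
    then have "range t \<subseteq> A" by blast
    moreover have "shift t z = seq_of_op x"
    proof
      fix i
      have zi: "z i = (if i < 2 then seq_of_op x i else 0)"
        unfolding x(3)[symmetric] by (simp add: quotient_coords_def)
      show "shift t z i = seq_of_op x i"
      proof (cases "i < 2")
        case False
        then obtain j where "i = j + 2" by (metis add.commute le_Suc_ex not_less)
        then show ?thesis using zi z(2) by (simp add: shift_def t_def)
      qed (simp add: zi shift_def)
    qed
    then have "shift_op t (op_of_seq z) = x" using zs RB_ops_coords(3)[OF x(1)] by (simp add: shift_op_def)
    ultimately show "x \<in> {shift_op t (op_of_seq z) | t. t \<in> finseq \<and> range t \<subseteq> A}" by blast
  next
    fix x assume "x \<in> {shift_op t (op_of_seq z) | t. t \<in> finseq \<and> range t \<subseteq> A}"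
    then obtain t where t: "t \<in> finseq" "range t \<subseteq> A" "x = shift_op t (op_of_seq z)" by blast
    have x: "x \<in> RB_ops" "seq_of_op x = shift t z"
      using shift_op_RB_ops[OF t(1) zs(2)] by (simp_all add: t(3) zs(1))
    have "shift t z i \<in> A" for i
      using A t(2) z(3) by (auto simp: shift_def image_subset_iff)
    moreover have "quotient_coords (shift t z) = z"
      using z(1) by (auto simp: quotient_coords_def shift_def affine_pts_def fun_eq_iff)
    ultimately show "x \<in> {x \<in> RB_ops. seq_of_op x 1 \<noteq> 0 \<and> range (seq_of_op x) \<subseteq> A \<and> quotient_coords (seq_of_op x) = z}"
      using x z(2) by (auto simp: shift_def)
  qed
qed

lemma orbits_seq_subgroup:
  assumes "x \<in> E"
  shows "{shift_op t x | t. t \<in> H} \<in> orbits (seq_group\<lparr>carrier := H\<rparr>) E shift_op"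
  using assms by (auto simp: orbits_def orbit_def)

lemma generic_modality_shift_op:
  "generic_modality affine_space seq_group shift_op (RB_ind :: nat \<Rightarrow> (_, 'a::field_char_0) fspace) 2"
proof -
  let ?X = "RB_ind :: nat \<Rightarrow> (_, 'a) fspace"
  define O1 where "O1 = {v :: nat \<Rightarrow> 'a alg_closure. v 1 \<noteq> 0}"
  define U where "U n = {x \<in> pts (?X n). seq_of_op x \<in> O1}" for n
  define Z where "Z = sub (affine_space 2 :: (_, 'a) fspace) {v \<in> pts (affine_space 2). v \<in> O1}"
  define \<pi> where "\<pi> x = quotient_coords (seq_of_op x)" for x :: "'a alg_closure poly \<Rightarrow> 'a alg_closure poly"
  have coU: "coordinates (sub (?X n) (U n)) (n + 2) (nonzero_tail \<inter> O1) seq_of_op op_of_seq" for n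
    unfolding U_def by (rule coordinates_sub[OF coordinates_RB])
  have coZ: "coordinates Z 2 O1 (\<lambda>v. v) (\<lambda>v. v)"
    using coordinates_sub[OF coordinates_affine[of 2, where 'a = 'a], of O1] by (simp add: Z_def)
  have ptsZ: "pts Z = {v \<in> affine_pts 2. v 1 \<noteq> 0}" by (auto simp: Z_def O1_def)
  have openU: "openin (tp (?X n)) (U n)" for n
    unfolding U_def O1_def
    using openin_nonzero[OF coordinatesD(1)[OF coordinates_RB] openin_topspace reg_coordinates[OF coordinates_RB]]
    by simp
  have ind_U: "ind_variety (\<lambda>n. sub (?X n) (U n))"
    by (rule ind_variety_coordinates[where k = 2 and P = "\<lambda>_. {\<lambda>v. v 1}", OF coU])
      (auto intro!: polyfuns.coord simp: O1_def nonzero_tail_def)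
  have UN_U: "(\<Union>n. U n) = {x \<in> RB_ops. seq_of_op x 1 \<noteq> 0}"
    unfolding ind_pts_RB_ind[symmetric] by (auto simp: U_def O1_def ind_pts_def)
  have var_Z: "variety Z"
    by (rule variety_coordinates[OF coZ, of "{\<lambda>v. v 1}"]) (auto intro!: polyfuns.coord simp: O1_def)
  have dim_Z: "dimension Z = enat 2"
    unfolding Z_def
  proof (rule dimension_open_affine)
    show "openin (tp (affine_space 2 :: (_, 'a) fspace)) {v \<in> pts (affine_space 2). v \<in> O1}"
      unfolding O1_def mem_Collect_eq
      by (rule openin_nonzero[OF space_with_functions_affine openin_topspace coord_reg_affine])
    show "(\<lambda>i. if i = 1 then 1 else 0) \<in> {v \<in> pts (affine_space 2 :: (_, 'a) fspace). v \<in> O1}"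
      by (auto simp: O1_def affine_pts_def)
    show "range (\<lambda>i::nat. if i = 1 then 1 else 0 :: 'a alg_closure) \<subseteq> range to_ac"
      using rangeI[of to_ac "1::'a"] zero_range_to_ac by auto
  qed
  have mor: "morphism (sub (?X n) (U n)) Z \<pi>" for n
  proof (rule morphism_into_coordinates[OF coZ coordinatesD(1)[OF coU], of _ \<pi>])
    fix x assume "x \<in> pts (sub (?X n) (U n))"
    then have "seq_of_op x \<in> O1" using coordinates_in(2)[OF coU] by blast
    then show "\<pi> x \<in> O1" by (simp add: O1_def \<pi>_def quotient_coords_def)
  next
    show "(\<lambda>x. \<pi> x i) \<in> reg (sub (?X n) (U n)) (pts (sub (?X n) (U n)))" if "i < 2" for i
      using reg_coordinates[OF coU] that by (simp add: \<pi>_def quotient_coords_def)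
  qed (auto simp: \<pi>_def quotient_coords_def affine_pts_def)
  have rat_X: "ind_rat_pts ?X = {x \<in> RB_ops. range (seq_of_op x) \<subseteq> range to_ac}"
    unfolding ind_pts_RB_ind[symmetric] ind_rat_pts_def ind_pts_def
    by (auto simp: rat_pts_coordinates[OF coordinates_RB])
  have rat_U: "ind_rat_pts (\<lambda>n. sub (?X n) (U n)) = {x \<in> RB_ops. seq_of_op x 1 \<noteq> 0 \<and> range (seq_of_op x) \<subseteq> range to_ac}"
    (is "?L = ?R")
  proof -
    have "x \<in> rat_pts (sub (?X n) (U n)) \<longleftrightarrow> x \<in> U n \<and> range (seq_of_op x) \<subseteq> range to_ac" for x n
      by (auto simp: rat_pts_sub U_def rat_pts_coordinates[OF coordinates_RB])
    then have "x \<in> ?L \<longleftrightarrow> x \<in> (\<Union>n. U n) \<and> range (seq_of_op x) \<subseteq> range to_ac" for x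
      by (auto simp: ind_rat_pts_def)
    then show ?thesis unfolding UN_U by blast
  qed
  have rat_G: "ind_rat_pts (affine_space :: nat \<Rightarrow> (_, 'a) fspace) = {t \<in> finseq. range t \<subseteq> range to_ac}"
    by (auto simp: ind_rat_pts_def rat_pts_affine finseq_def)
  have op_z: "op_of_seq z \<in> RB_ops" "seq_of_op (op_of_seq z) = z" if "z \<in> pts Z" for z
  proof -
    have "z \<in> finseq" "z \<in> nonzero_tail" using that affine_pts_subset_finseq by (auto simp: ptsZ nonzero_tail_def)
    then show "op_of_seq z \<in> RB_ops" "seq_of_op (op_of_seq z) = z" by (rule op_of_seq_RB_ops, rule seq_of_op_of_seq)
  qed
  have fibre: "{x \<in> (\<Union>n. U n). \<pi> x = z} \<in> orbits seq_group (ind_pts ?X) shift_op" if z: "z \<in> pts Z" for z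
  proof -
    have "{x \<in> (\<Union>n. U n). \<pi> x = z} = {shift_op t (op_of_seq z) | t. t \<in> finseq}"
      using fibre_is_orbit[of UNIV z] z by (simp add: UN_U \<pi>_def ptsZ)
    then show ?thesis
      using orbits_seq_subgroup[OF op_z(1)[OF z], of finseq] by (simp add: seq_group_carrier ind_pts_RB_ind)
  qed
  have rat_fibre: "{x \<in> ind_rat_pts (\<lambda>n. sub (?X n) (U n)). \<pi> x = z}
      \<in> orbits (seq_group\<lparr>carrier := ind_rat_pts affine_space\<rparr>) (ind_rat_pts ?X) shift_op" if z: "z \<in> rat_pts Z" for z
  proof -
    have z': "z \<in> pts Z" "range z \<subseteq> range to_ac"
      using z unfolding rat_pts_coordinates[OF coZ] by blast+
    have "{x \<in> RB_ops. seq_of_op x 1 \<noteq> 0 \<and> range (seq_of_op x) \<subseteq> range to_ac \<and> quotient_coords (seq_of_op x) = z}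
        = {shift_op t (op_of_seq z) | t. t \<in> finseq \<and> range t \<subseteq> range to_ac}"
    proof (rule fibre_is_orbit[OF zero_range_to_ac])
      show "x + y \<in> range to_ac \<and> x * y \<in> range to_ac \<and> x / y \<in> range to_ac"
        if "x \<in> range to_ac" "y \<in> range to_ac" for x y :: "'a alg_closure"
        using range_to_ac_closed[OF that] by blast
      show "z \<in> affine_pts 2" "z 1 \<noteq> 0" using z'(1) unfolding ptsZ by blast+
    qed (rule z'(2))
    then have "{x \<in> ind_rat_pts (\<lambda>n. sub (?X n) (U n)). \<pi> x = z}
        = {shift_op t (op_of_seq z) | t. t \<in> finseq \<and> range t \<subseteq> range to_ac}"
      by (simp add: rat_U \<pi>_def conj_assoc)
    moreover have "op_of_seq z \<in> ind_rat_pts ?X" using op_z[OF z'(1)] z'(2) by (simp add: rat_X)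
    ultimately show ?thesis using orbits_seq_subgroup[of "op_of_seq z" _ "ind_rat_pts affine_space"] by (simp add: rat_G)
  qed
  define z0 where "z0 = (\<lambda>i::nat. if i = 1 then 1 else 0 :: 'a alg_closure)"
  have "z0 \<in> pts Z" by (auto simp: z0_def ptsZ affine_pts_def)
  then have "op_of_seq z0 \<in> (\<Union>n. U n)" using op_z by (simp add: UN_U z0_def)
  then have "(\<Union>n. U n) \<noteq> {}" by blast
  moreover have "open_ind_subvariety U ?X" using openU ind_U by (simp add: open_ind_subvariety_def)
  moreover have "ind_morphism (\<lambda>n. sub (?X n) (U n)) (\<lambda>_. Z) \<pi>" using mor by (simp add: ind_morphism_def)
  ultimately show ?thesis
    unfolding generic_modality_def
    using irreducible_RB regular_action_shift_op var_Z dim_Z fibre rat_fibre by blast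
qed

theorem corollary4p14:
  shows "\<exists>(G :: nat \<Rightarrow> (nat \<Rightarrow> 'a alg_closure, 'a) fspace) M act.
           additive_structure G M act
             (RB_ind :: nat \<Rightarrow> ('a::field_char_0 alg_closure poly \<Rightarrow> 'a alg_closure poly, 'a) fspace) 2"
  unfolding additive_structure_def
  using unipotent_ind_group_seq comm_group_seq_group generic_modality_shift_op by blast

end
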